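(* Let $\Omega\subseteq\mathbb{R}^3$ be open, bounded and weak Lipschitz, with connected complement $\mathbb{R}^3\setminus\Omega$. Let $0<\alpha\le\beta$, $a\in\mathcal{M}(\alpha,\beta)$, let $F\colon\mathbb{C}^3\to\mathbb{C}$ be continuous and bounded, let $f\in \mathrm{L}_2(\Omega)$ and $g\in\operatorname{ran}(\mathring{\operatorname{curl}})$. For $E\in \mathrm{L}_2(\Omega)^3$ put $$\varepsilon(E):=aE+F(E)\ast E .$$ If $\|F\|_\infty\,\lambda(\Omega)<\alpha$, where $\lambda$ is the Lebesgue measure on $\mathbb{R}^3$ and $\|F\|_\infty=\sup_{z\in\mathbb{C}^3}|F(z)|$, then there exists $E\in \mathrm{L}_2(\Omega)^3$ with $E\in \mathrm{H}(\mathring{\operatorname{curl}},\Omega)$ and $\varepsilon(E)\in \mathrm{H}(\operatorname{div},\Omega)$ such that $$-\operatorname{div}\varepsilon(E)=f\quad\text{and}\quad \mathring{\operatorname{curl}}\,E=g .$$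
   Context: All function spaces are complex-valued; scalar products are conjugate linear in the first and linear in the second component. A bounded open set $\Omega\subseteq\mathbb{R}^3$ is weak Lipschitz if $\partial\Omega$ is a Lipschitz manifold, in the usual sense: each boundary point has an open neighbourhood $U$ and a bi-Lipschitz map from $U$ onto the cube $(-1,1)^3$ sending $U\cap\Omega$ onto $\{x_3>0\}$ and $U\cap\partial\Omega$ onto $\{x_3=0\}$. $\operatorname{grad}$ and $\operatorname{curl}$ are the distributional gradient and curl as unbounded operators $\mathrm{L}_2(\Omega)\to\mathrm{L}_2(\Omega)^3$, resp. $\mathrm{L}_2(\Omega)^3\to\mathrm{L}_2(\Omega)^3$, with maximal $\mathrm{L}_2$-domains. $\mathring{\operatorname{grad}}$ and $\mathring{\operatorname{curl}}$ are the closures of their restrictions to $C_c^\infty(\Omega)$, resp. $C_c^\infty(\Omega)^3$. $\operatorname{div}:=-\mathring{\operatorname{grad}}^{*}$ (the distributional divergence with maximal $\mathrm{L}_2$-domain). $\mathrm{H}(\mathring{\operatorname{curl}},\Omega)=\operatorname{dom}(\mathring{\operatorname{curl}})$ and $\mathrm{H}(\operatorname{div},\Omega)=\operatorname{dom}(\operatorname{div})$. $\mathcal{L}_b(X)$ denotes the bounded linear operators on $X$. For a bounded operator $a$ on a Hilbert space, $\operatorname{Re}a:=(a+a^* )/2$, and inequalities such as $\operatorname{Re}a\ge\alpha$ are in the sense of positive definiteness. For $0<\alpha\le\beta$, $$\mathcal{M}(\alpha,\beta):=\{a\in\mathcal{L}_b(\mathrm{L}_2(\Omega)^3): \operatorname{Re}a\ge\alpha,\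 \operatorname{Re}a^{-1}\ge 1/\beta\}.$$ For $E\in\mathrm{L}_2(\Omega)^3$, $F(E)$ is the function $F(E)(x):=F(E(x))$, $x\in\Omega$, extended by zero to $\mathbb{R}^3$. For $\phi\in \mathrm{L}_1(\mathbb{R}^3)$ and $h\in\mathrm{L}_2(\Omega)^d$, $(\phi\ast h)(x):=\int_\Omega\phi(x-y)h(y)\,dy$ for $x\in\Omega$; this defines an element of $\mathrm{L}_2(\Omega)^d$. *)

theory Defs
  imports "HOL-Analysis.Analysis"
begin

text \<open>
  Elements of \<open>L\<^sub>2(\<Omega>)\<close> (values in \<open>\<complex>\<close>) and \<open>L\<^sub>2(\<Omega>)\<^sup>3\<close> (values in \<open>\<complex>\<^sup>3\<close>) are represented by
  square-integrable functions on \<open>\<real>\<^sup>3\<close> whose values outside \<open>\<Omega>\<close> are irrelevant; equality in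
  \<open>L\<^sub>2\<close> is equality almost everywhere on \<open>\<Omega>\<close>.  Operators are represented either by maps on
  representatives that respect this equality, or (if unbounded) by their graphs, which are
  closed under it.
\<close>

definition L2_space :: "(real^3) set \<Rightarrow> (real^3 \<Rightarrow> 'b::euclidean_space) set" where
  "L2_space \<Omega> = {u. u \<in> borel_measurable (lebesgue_on \<Omega>) \<and>
                    integrable (lebesgue_on \<Omega>) (\<lambda>x. (norm (u x))\<^sup>2)}"

definition L2_eq :: "(real^3) set \<Rightarrow> (real^3 \<Rightarrow> 'b) \<Rightarrow> (real^3 \<Rightarrow> 'b) \<Rightarrow> bool" where
  "L2_eq \<Omega> u v \<longleftrightarrow> (AE x in lebesgue_on \<Omega>. u x = v x)"

definition L2_norm :: "(real^3) set \<Rightarrow> (real^3 \<Rightarrow> 'b::euclidean_space) \<Rightarrow> real" where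
  "L2_norm \<Omega> u = sqrt (LINT x|lebesgue_on \<Omega>. (norm (u x))\<^sup>2)"

definition L2_inner :: "(real^3) set \<Rightarrow> (real^3 \<Rightarrow> complex) \<Rightarrow> (real^3 \<Rightarrow> complex) \<Rightarrow> complex" where
  "L2_inner \<Omega> u v = (LINT x|lebesgue_on \<Omega>. cnj (u x) * v x)"

definition L2_inner3 ::
    "(real^3) set \<Rightarrow> (real^3 \<Rightarrow> complex^3) \<Rightarrow> (real^3 \<Rightarrow> complex^3) \<Rightarrow> complex" where
  "L2_inner3 \<Omega> u v = (LINT x|lebesgue_on \<Omega>. (\<Sum>i\<in>UNIV. cnj (u x $ i) * v x $ i))"


subsection \<open>Weak Lipschitz domains\<close>

definition bi_lipschitz_on :: "('a::metric_space) set \<Rightarrow> ('a \<Rightarrow> 'b::metric_space) \<Rightarrow> bool" where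
  "bi_lipschitz_on U \<psi> \<longleftrightarrow> inj_on \<psi> U \<and> (\<exists>C. C-lipschitz_on U \<psi>) \<and>
                          (\<exists>C. C-lipschitz_on (\<psi> ` U) (inv_into U \<psi>))"

definition weak_Lipschitz :: "(real^3) set \<Rightarrow> bool" where
  "weak_Lipschitz \<Omega> \<longleftrightarrow>
     (\<forall>x\<in>frontier \<Omega>. \<exists>U. \<exists>\<psi> :: real^3 \<Rightarrow> real^3.
        open U \<and> x \<in> U \<and> bi_lipschitz_on U \<psi> \<and>
        \<psi> ` U = {y. \<forall>i. -1 < y $ i \<and> y $ i < 1} \<and>
        \<psi> ` (U \<inter> \<Omega>) = {y. (\<forall>i. -1 < y $ i \<and> y $ i < 1) \<and> 0 < y $ 3} \<and>
        \<psi> ` (U \<inter> frontier \<Omega>) = {y. (\<forall>i. -1 < y $ i \<and> y $ i < 1) \<and> y $ 3 = 0})"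


subsection \<open>Test functions and their derivatives\<close>

fun times_cont_differentiable ::
    "nat \<Rightarrow> (real^3 \<Rightarrow> 'b::real_normed_vector) \<Rightarrow> bool" where
  "times_cont_differentiable 0 f \<longleftrightarrow> continuous_on UNIV f"
| "times_cont_differentiable (Suc n) f \<longleftrightarrow>
     (\<forall>x. f differentiable (at x)) \<and>
     (\<forall>v. times_cont_differentiable n (\<lambda>x. frechet_derivative f (at x) v))"

definition test_functions :: "(real^3) set \<Rightarrow> (real^3 \<Rightarrow> 'b::real_normed_vector) set" where
  "test_functions \<Omega> = {\<phi>. (\<forall>n. times_cont_differentiable n \<phi>) \<and>
                          compact (closure {x. \<phi> x \<noteq> 0}) \<and> closure {x. \<phi> x \<noteq> 0} \<subseteq> \<Omega>}"

definition partial :: "3 \<Rightarrow> (real^3 \<Rightarrow> complex) \<Rightarrow> real^3 \<Rightarrow> complex" where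
  "partial i f x = frechet_derivative f (at x) (axis i 1)"

definition grad :: "(real^3 \<Rightarrow> complex) \<Rightarrow> real^3 \<Rightarrow> complex^3" where
  "grad \<phi> x = (\<chi> i. partial i \<phi> x)"

definition curl :: "(real^3 \<Rightarrow> complex^3) \<Rightarrow> real^3 \<Rightarrow> complex^3" where
  "curl \<Phi> x = vector
     [partial 2 (\<lambda>y. \<Phi> y $ 3) x - partial 3 (\<lambda>y. \<Phi> y $ 2) x,
      partial 3 (\<lambda>y. \<Phi> y $ 1) x - partial 1 (\<lambda>y. \<Phi> y $ 3) x,
      partial 1 (\<lambda>y. \<Phi> y $ 2) x - partial 2 (\<lambda>y. \<Phi> y $ 1) x]"


subsection \<open>Unbounded operators, given by their graphs\<close>

definition L2_closure ::
    "(real^3) set \<Rightarrow> ((real^3 \<Rightarrow> 'a::euclidean_space) \<times> (real^3 \<Rightarrow> 'b::euclidean_space)) set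
     \<Rightarrow> ((real^3 \<Rightarrow> 'a) \<times> (real^3 \<Rightarrow> 'b)) set" where
  "L2_closure \<Omega> A = {(u, v). u \<in> L2_space \<Omega> \<and> v \<in> L2_space \<Omega> \<and>
     (\<exists>p q. (\<forall>n. (p n, q n) \<in> A) \<and>
        (\<lambda>n. L2_norm \<Omega> (\<lambda>x. p n x - u x)) \<longlonglongrightarrow> 0 \<and>
        (\<lambda>n. L2_norm \<Omega> (\<lambda>x. q n x - v x)) \<longlonglongrightarrow> 0)}"

text \<open>
  On test functions the distributional gradient and curl are the classical ones, so the
  operators with homogeneous boundary condition are the following closures.
\<close>

definition grad0 :: "(real^3) set \<Rightarrow> ((real^3 \<Rightarrow> complex) \<times> (real^3 \<Rightarrow> complex^3)) set" where
  "grad0 \<Omega> = L2_closure \<Omega> {(\<phi>, grad \<phi>) | \<phi>. \<phi> \<in> test_functions \<Omega>}"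

definition curl0 :: "(real^3) set \<Rightarrow> ((real^3 \<Rightarrow> complex^3) \<times> (real^3 \<Rightarrow> complex^3)) set" where
  "curl0 \<Omega> = L2_closure \<Omega> {(\<Phi>, curl \<Phi>) | \<Phi>. \<Phi> \<in> test_functions \<Omega>}"

text \<open>The graph of minus the Hilbert space adjoint of \<^const>\<open>grad0\<close>.\<close>

definition div_op :: "(real^3) set \<Rightarrow> ((real^3 \<Rightarrow> complex^3) \<times> (real^3 \<Rightarrow> complex)) set" where
  "div_op \<Omega> = {(v, w). v \<in> L2_space \<Omega> \<and> w \<in> L2_space \<Omega> \<and>
     (\<forall>(u, z)\<in>grad0 \<Omega>. L2_inner3 \<Omega> z v = - L2_inner \<Omega> u w)}"


subsection \<open>Bounded operators and the material law\<close>

definition L2_bounded_op ::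
    "(real^3) set \<Rightarrow> ((real^3 \<Rightarrow> complex^3) \<Rightarrow> real^3 \<Rightarrow> complex^3) \<Rightarrow> bool" where
  "L2_bounded_op \<Omega> a \<longleftrightarrow>
     (\<forall>u\<in>L2_space \<Omega>. a u \<in> L2_space \<Omega>) \<and>
     (\<forall>u\<in>L2_space \<Omega>. \<forall>v\<in>L2_space \<Omega>. L2_eq \<Omega> u v \<longrightarrow> L2_eq \<Omega> (a u) (a v)) \<and>
     (\<forall>u\<in>L2_space \<Omega>. \<forall>v\<in>L2_space \<Omega>. L2_eq \<Omega> (a (\<lambda>x. u x + v x)) (\<lambda>x. a u x + a v x)) \<and>
     (\<forall>c. \<forall>u\<in>L2_space \<Omega>. L2_eq \<Omega> (a (\<lambda>x. c *s u x)) (\<lambda>x. c *s a u x)) \<and>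
     (\<exists>C. \<forall>u\<in>L2_space \<Omega>. L2_norm \<Omega> (a u) \<le> C * L2_norm \<Omega> u)"

definition L2_adjoint ::
    "(real^3) set \<Rightarrow> ((real^3 \<Rightarrow> complex^3) \<Rightarrow> real^3 \<Rightarrow> complex^3)
     \<Rightarrow> ((real^3 \<Rightarrow> complex^3) \<Rightarrow> real^3 \<Rightarrow> complex^3) \<Rightarrow> bool" where
  "L2_adjoint \<Omega> a b \<longleftrightarrow> L2_bounded_op \<Omega> b \<and>
     (\<forall>u\<in>L2_space \<Omega>. \<forall>v\<in>L2_space \<Omega>. L2_inner3 \<Omega> (a u) v = L2_inner3 \<Omega> u (b v))"

definition L2_inverse ::
    "(real^3) set \<Rightarrow> ((real^3 \<Rightarrow> complex^3) \<Rightarrow> real^3 \<Rightarrow> complex^3)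
     \<Rightarrow> ((real^3 \<Rightarrow> complex^3) \<Rightarrow> real^3 \<Rightarrow> complex^3) \<Rightarrow> bool" where
  "L2_inverse \<Omega> a b \<longleftrightarrow> L2_bounded_op \<Omega> b \<and>
     (\<forall>u\<in>L2_space \<Omega>. L2_eq \<Omega> (b (a u)) u \<and> L2_eq \<Omega> (a (b u)) u)"

text \<open>
  \<open>Re a \<ge> c\<close> with \<open>Re a = (a + a\<^sup>*)/2\<close>.  The adjoint \<open>b = a\<^sup>*\<close> of a bounded operator always exists
  and is unique up to equality in \<open>L\<^sub>2\<close>.  Since \<open>Re a\<close> is selfadjoint, the scalar product below
  is real and \<^const>\<open>Re\<close> only converts it to type \<^typ>\<open>real\<close>.
\<close>

definition L2_Re_ge ::
    "(real^3) set \<Rightarrow> real \<Rightarrow> ((real^3 \<Rightarrow> complex^3) \<Rightarrow> real^3 \<Rightarrow> complex^3) \<Rightarrow> bool" where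
  "L2_Re_ge \<Omega> c a \<longleftrightarrow> (\<exists>b. L2_adjoint \<Omega> a b \<and>
     (\<forall>u\<in>L2_space \<Omega>. c * (L2_norm \<Omega> u)\<^sup>2 \<le> Re (L2_inner3 \<Omega> u (\<lambda>x. (1/2) *s (a u x + b u x)))))"

definition material_laws ::
    "(real^3) set \<Rightarrow> real \<Rightarrow> real \<Rightarrow> ((real^3 \<Rightarrow> complex^3) \<Rightarrow> real^3 \<Rightarrow> complex^3) set" where
  "material_laws \<Omega> \<alpha> \<beta> = {a. L2_bounded_op \<Omega> a \<and> L2_Re_ge \<Omega> \<alpha> a \<and>
     (\<exists>b. L2_inverse \<Omega> a b \<and> L2_Re_ge \<Omega> (1/\<beta>) b)}"

definition zero_extend :: "(real^3) set \<Rightarrow> (real^3 \<Rightarrow> complex) \<Rightarrow> real^3 \<Rightarrow> complex" where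
  "zero_extend \<Omega> \<phi> x = (if x \<in> \<Omega> then \<phi> x else 0)"

definition convolve ::
    "(real^3) set \<Rightarrow> (real^3 \<Rightarrow> complex) \<Rightarrow> (real^3 \<Rightarrow> complex^3) \<Rightarrow> real^3 \<Rightarrow> complex^3" where
  "convolve \<Omega> \<phi> h x = (LINT y|lebesgue_on \<Omega>. \<phi> (x - y) *s h y)"

definition epsilon_law ::
    "(real^3) set \<Rightarrow> ((real^3 \<Rightarrow> complex^3) \<Rightarrow> real^3 \<Rightarrow> complex^3) \<Rightarrow> (complex^3 \<Rightarrow> complex)
     \<Rightarrow> (real^3 \<Rightarrow> complex^3) \<Rightarrow> real^3 \<Rightarrow> complex^3" where
  "epsilon_law \<Omega> a F E x = a E x + convolve \<Omega> (zero_extend \<Omega> (\<lambda>z. F (E z))) E x"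

end

(*
  Since gradients of test functions are curl free, it suffices to find E = E_g + grad u, where E_g is
  any field with curl E_g = g.  The compact convex set on which a fixed point is sought is the set
  K of kernels Phi on Omega with |Phi| <= sup |F|, in the weak topology of L2: for a frozen kernel
  Phi in K, Young's inequality makes a + Phi * coercive with constant
  alpha - sup |F| * lambda(Omega) > 0, so the linear problem for u is solved by the Lax-Milgram lemma
  and Poincare's inequality.  If Phi_n -> Phi weakly, then Phi_n * h -> Phi * h strongly for every
  fixed h (pointwise and dominated), hence the solutions E(Phi_n) converge strongly, and
  so do the new kernels F(E(Phi_n)).  Thus Phi |-> F(E(Phi)) maps K to K and is continuous from the
  weak to the strong topology, and Schauder's fixed point theorem, reduced to Brouwer's theorem on
  cubes, applies.
*)
theory Submission
  imports Defs "HOL-Library.Diagonal_Subsequence"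
begin

text \<open>A fixed point argument for the field \<open>E\<close> itself has no compactness to rest
  on: bounded sets of fields are only weakly compact, the map from \<open>E\<close> to
  \<open>F(E)\<close> is in general not weakly continuous, and a merely bounded \<open>a\<close>
  gives no strong compactness of gradients. The kernel is the better unknown, because it enters
  through a convolution, which turns its weak convergence into strong convergence. This convergence
  is not in operator norm, so the stability estimate compares two linear operators only at the limit
  solution, which is fixed.

  The Hilbert space theory is real, the inner product being the real part of the complex one.
  Coercivity concerns real parts anyway, and the domain of the gradient is invariant under
  multiplication by \<open>\<i>\<close>, so a real identity for all its elements implies the complex
  one. All functions live on the whole space and are cut off outside \<Omega>, so that reflections
  in the convolution cause no trouble with domains.\<close>

section \<open>Brouwer's theorem on cubes of arbitrary dimension\<close>

text \<open>A diagonal sequence makes countably many bounded coordinates converge together. It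
  serves the finitely many coordinates of a cube and, in a Hilbert space, the inner products of a
  sequence with its own members.\<close>

lemma bounded_coordinates_convergent_subsequence:
  fixes X :: "nat \<Rightarrow> nat \<Rightarrow> real"
  assumes "\<And>k i. \<bar>X k i\<bar> \<le> B i"
  obtains r l where "strict_mono r" "\<And>i. (\<lambda>k. X (r k) i) \<longlonglongrightarrow> l i"
proof -
  let ?P = "\<lambda>i s. convergent (\<lambda>k. X (s k) i)"
  interpret subseqs ?P
  proof
    fix i and s :: "nat \<Rightarrow> nat"
    have "\<forall>k. X (s k) i \<in> {- B i..B i}"
      using assms by (simp add: abs_le_iff minus_le_iff)
    then obtain l r where "strict_mono r" "((\<lambda>k. X (s k) i) \<circ> r) \<longlonglongrightarrow> l"
      using compact_Icc compact_imp_seq_compact seq_compactE by metis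
    then show "\<exists>r. strict_mono r \<and> ?P i (s \<circ> r)"
      by (auto simp: comp_def convergent_def)
  qed
  have "?P i diagseq" for i
  proof -
    \<comment> \<open>Only from index \<open>Suc i\<close> on is the diagonal a subsequence of one
      along which coordinate \<open>i\<close> converges; hence the shift, which does not affect
      convergence.\<close>
    have "?P i (diagseq \<circ> ((+) (Suc i)))"
    proof (rule diagseq_holds)
      fix r s :: "nat \<Rightarrow> nat" and n
      assume "strict_mono r" "?P n s"
      then show "?P n (s \<circ> r)"
        using convergent_subseq_convergent[of "\<lambda>k. X (s k) n" r] by (simp add: comp_def)
    qed
    then have "convergent (\<lambda>k. X (diagseq (k + Suc i)) i)"
      by (simp add: comp_def add.commute)
    then show ?thesis
      using convergent_ignore_initial_segment[of "\<lambda>k. X (diagseq k) i" "Suc i"] by simp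
  qed
  then have "\<forall>i. \<exists>l. (\<lambda>k. X (diagseq k) i) \<longlonglongrightarrow> l"
    by (simp add: convergent_def)
  then show ?thesis
    using that subseq_diagseq by metis
qed

text \<open>Kuhn's combinatorial lemma on the grid of mesh \<open>1 / Suc k\<close>. The label of a
  grid point in coordinate \<open>i\<close> records in which direction \<open>f\<close> moves it,
  and some cell with corner \<open>Q\<close> has, for each \<open>i\<close>, two vertices
  \<open>R i\<close> and \<open>S i\<close> whose labels in coordinate \<open>i\<close> differ. The
  vertices depend on \<open>i\<close>; letting the mesh tend to 0 merges them into one
  point.\<close>

lemma kuhn_approximate_fixed_point:
  fixes f :: "(nat \<Rightarrow> real) \<Rightarrow> nat \<Rightarrow> real" and n k :: nat
  assumes range: "\<And>x. \<forall>i<n. x i \<in> {0..1} \<Longrightarrow> \<forall>i<n. f x i \<in> {0..1}"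
  shows "\<exists>Q R S. (\<forall>j<n. Q j \<in> {0..1}) \<and>
           (\<forall>i<n. \<forall>j<n. R i j \<in> {0..1} \<and> S i j \<in> {0..1} \<and>
              \<bar>R i j - Q j\<bar> \<le> 1 / Suc k \<and> \<bar>S i j - Q j\<bar> \<le> 1 / Suc k) \<and>
           (\<forall>i<n. R i i \<le> f (R i) i \<and> f (S i) i \<le> S i i)"
proof -
  define p where "p = Suc k"
  define pt where "pt y = (\<lambda>i. real (y i) / p)" for y :: "nat \<Rightarrow> nat"
  have p: "0 < p" by (simp add: p_def)
  have pt01: "pt y i \<in> {0..1}" if "y i \<le> p" for y i
    using that p by (simp add: pt_def)
  \<comment> \<open>Kuhn's lemma prescribes the labels on the faces \<open>y i = 0\<close> and
    \<open>y i = p\<close>. They still describe the direction correctly there, because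
    \<open>f\<close> maps the cube to itself.\<close>
  define label where "label y i =
    (if y i = 0 then 0 else if y i = p then 1 else if pt y i \<le> f (pt y) i then 0 else 1::nat)" for y i
  have lab0: "pt y i \<le> f (pt y) i" if "label y i = 0" "\<forall>i<n. y i \<le> p" "i < n" for y i
  proof (cases "y i = 0")
    case True
    have "f (pt y) i \<in> {0..1}" using range[of "pt y"] that pt01 by blast
    then show ?thesis using True by (simp add: pt_def)
  next
    case False
    then show ?thesis using that by (auto simp: label_def split: if_splits)
  qed
  have lab1: "f (pt y) i \<le> pt y i" if "label y i = 1" "\<forall>i<n. y i \<le> p" "i < n" for y i
  proof (cases "y i = p")
    case True
    have "f (pt y) i \<in> {0..1}" using range[of "pt y"] that pt01 by blast
    then show ?thesis using True p by (simp add: pt_def)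
  next
    case False
    then show ?thesis using that by (auto simp: label_def split: if_splits)
  qed
  obtain q where q: "\<forall>i<n. q i < p" and
    qe: "\<forall>i<n. \<exists>r s. (\<forall>j<n. q j \<le> r j \<and> r j \<le> q j + 1) \<and> (\<forall>j<n. q j \<le> s j \<and> s j \<le> q j + 1) \<and> label r i \<noteq> label s i"
  proof (rule kuhn_lemma[OF p, of n label])
    show "\<forall>x. (\<forall>i<n. x i \<le> p) \<longrightarrow> (\<forall>i<n. label x i = 0 \<or> label x i = 1)"
      by (auto simp: label_def)
  qed (use p in \<open>auto simp: label_def\<close>)
  have near: "\<bar>pt r j - pt q j\<bar> \<le> 1 / p" if "q j \<le> r j \<and> r j \<le> q j + 1" for r j
  proof -
    have "pt r j - pt q j = (real (r j) - real (q j)) / p" by (simp add: pt_def diff_divide_distrib)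
    also have "\<bar>\<dots>\<bar> \<le> 1 / p" using that p by (simp add: divide_right_mono)
    finally show ?thesis .
  qed
  have "\<exists>R S. (\<forall>j<n. R j \<in> {0..1} \<and> S j \<in> {0..1} \<and> \<bar>R j - pt q j\<bar> \<le> 1/p \<and> \<bar>S j - pt q j\<bar> \<le> 1/p) \<and>
      R i \<le> f R i \<and> f S i \<le> S i" if i: "i < n" for i
  proof -
    obtain r0 s0 where rs: "\<forall>j<n. q j \<le> r0 j \<and> r0 j \<le> q j + 1" "\<forall>j<n. q j \<le> s0 j \<and> s0 j \<le> q j + 1"
        "label r0 i \<noteq> label s0 i"
      using qe i by blast
    moreover have "label r0 i \<in> {0,1}" "label s0 i \<in> {0,1}" by (auto simp: label_def)
    ultimately obtain r s where rs: "\<forall>j<n. q j \<le> r j \<and> r j \<le> q j + 1" "\<forall>j<n. q j \<le> s j \<and> s j \<le> q j + 1"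
        "label r i = 0" "label s i = 1"
      by (metis empty_iff insertE)
    \<comment> \<open>The cell lies inside the grid, since \<open>q j < p\<close> gives
      \<open>q j + 1 \<le> p\<close>.\<close>
    have le: "\<forall>j<n. r j \<le> p" "\<forall>j<n. s j \<le> p"
      using rs q by (metis Suc_eq_plus1 Suc_leI le_trans)+
    have "\<forall>j<n. pt r j \<in> {0..1} \<and> pt s j \<in> {0..1} \<and> \<bar>pt r j - pt q j\<bar> \<le> 1/p \<and> \<bar>pt s j - pt q j\<bar> \<le> 1/p"
      by (intro allI impI conjI near pt01) (use rs le in auto)
    moreover have "pt r i \<le> f (pt r) i" "f (pt s) i \<le> pt s i"
      using lab0[OF rs(3) le(1) i] lab1[OF rs(4) le(2) i] by auto
    ultimately show ?thesis by blast
  qed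
  then obtain R S where
    RS: "\<And>i j. i < n \<Longrightarrow> j < n \<Longrightarrow> R i j \<in> {0..1} \<and> S i j \<in> {0..1} \<and> \<bar>R i j - pt q j\<bar> \<le> 1/p \<and> \<bar>S i j - pt q j\<bar> \<le> 1/p"
    "\<And>i. i < n \<Longrightarrow> R i i \<le> f (R i) i \<and> f (S i) i \<le> S i i"
    by metis
  moreover have "\<forall>j<n. pt q j \<in> {0..1}" using q pt01 by (meson less_imp_le)
  ultimately show ?thesis
    unfolding p_def by blast
qed

text \<open>Points of the cube are functions on all of \<^typ>\<open>nat\<close> of which only the first \<open>n\<close> values
  matter, since a Euclidean space type would not allow \<open>n\<close> to vary inside a proof.\<close>

lemma brouwer_nat_cube:
  fixes f :: "(nat \<Rightarrow> real) \<Rightarrow> nat \<Rightarrow> real" and n :: nat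
  assumes cont: "\<And>X x. \<lbrakk>\<And>k i. i < n \<Longrightarrow> X k i \<in> {0..1}; \<And>i. i < n \<Longrightarrow> (\<lambda>k. X k i) \<longlonglongrightarrow> x i\<rbrakk>
      \<Longrightarrow> \<forall>i<n. (\<lambda>k. f (X k) i) \<longlonglongrightarrow> f x i"
    and range: "\<And>x. \<forall>i<n. x i \<in> {0..1} \<Longrightarrow> \<forall>i<n. f x i \<in> {0..1}"
  obtains x where "\<forall>i<n. x i \<in> {0..1}" "\<forall>i<n. f x i = x i"
proof -
  have "\<forall>k. \<exists>Q R S. (\<forall>j<n. Q j \<in> {0..1}) \<and>
           (\<forall>i<n. \<forall>j<n. R i j \<in> {0..1} \<and> S i j \<in> {0..1} \<and>
              \<bar>R i j - Q j\<bar> \<le> 1 / Suc k \<and> \<bar>S i j - Q j\<bar> \<le> 1 / Suc k) \<and>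
           (\<forall>i<n. R i i \<le> f (R i) i \<and> f (S i) i \<le> S i i)"
    using kuhn_approximate_fixed_point[of n f] range by blast
  then obtain Q R S where Q: "\<And>k j. j < n \<Longrightarrow> Q k j \<in> {0..1}"
    and RS: "\<And>k i j. i < n \<Longrightarrow> j < n \<Longrightarrow> R k i j \<in> {0..1} \<and> S k i j \<in> {0..1} \<and>
              \<bar>R k i j - Q k j\<bar> \<le> 1 / Suc k \<and> \<bar>S k i j - Q k j\<bar> \<le> 1 / Suc k"
    and f: "\<And>k i. i < n \<Longrightarrow> R k i i \<le> f (R k i) i \<and> f (S k i) i \<le> S k i i"
    by metis
  \<comment> \<open>Coordinates from \<open>n\<close> on are arbitrary and possibly unbounded;
    setting them to 0 makes the diagonal argument applicable.\<close>
  let ?Q = "\<lambda>k i. if i < n then Q k i else 0"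
  have "\<bar>?Q k i\<bar> \<le> 1" for k i using Q[of i k] by auto
  then obtain r x where r: "strict_mono r" and x: "\<And>i. (\<lambda>k. ?Q (r k) i) \<longlonglongrightarrow> x i"
    by (rule bounded_coordinates_convergent_subsequence[of ?Q "\<lambda>_. 1"]) blast
  have Qx: "(\<lambda>k. Q (r k) j) \<longlonglongrightarrow> x j" if "j < n" for j
    using x[of j] that by simp
  have lim0: "(\<lambda>k. 1 / real (Suc (r k))) \<longlonglongrightarrow> 0"
    using LIMSEQ_subseq_LIMSEQ[OF LIMSEQ_inverse_real_of_nat r] by (simp add: comp_def inverse_eq_divide)
  have aux: "(\<lambda>k. Y (r k) j) \<longlonglongrightarrow> x j" if "j < n" "\<And>k. \<bar>Y k j - Q k j\<bar> \<le> 1 / Suc k" for Y :: "nat \<Rightarrow> nat \<Rightarrow> real" and j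
  proof -
    have "(\<lambda>k. Y (r k) j - Q (r k) j) \<longlonglongrightarrow> 0"
      by (rule Lim_null_comparison[OF _ lim0]) (use that in auto)
    from tendsto_add[OF this Qx[OF that(1)]] show ?thesis by simp
  qed
  have Rx: "(\<lambda>k. R (r k) i j) \<longlonglongrightarrow> x j" and Sx: "(\<lambda>k. S (r k) i j) \<longlonglongrightarrow> x j" if "i < n" "j < n" for i j
    using aux[of j "\<lambda>k. R k i"] aux[of j "\<lambda>k. S k i"] RS that by auto
  have x01: "x i \<in> {0..1}" if "i < n" for i
    using closed_sequentially[OF _ _ Qx[OF that], of "{0..1}"] Q that by auto
  \<comment> \<open>The inequalities at \<open>R\<close> and \<open>S\<close> bound
    \<open>f x i\<close> from both sides in the limit, since both points converge to
    \<open>x\<close>.\<close>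
  have "f x i = x i" if i: "i < n" for i
  proof (rule antisym)
    have fR: "(\<lambda>k. f (R (r k) i) i) \<longlonglongrightarrow> f x i"
      using cont[of "\<lambda>k. R (r k) i" x] RS Rx i by blast
    show "x i \<le> f x i"
      using LIMSEQ_le[OF Rx[OF i i] fR] f i by blast
    have fS: "(\<lambda>k. f (S (r k) i) i) \<longlonglongrightarrow> f x i"
      using cont[of "\<lambda>k. S (r k) i" x] RS Sx i by blast
    show "f x i \<le> x i"
      using LIMSEQ_le[OF fS Sx[OF i i]] f i by blast
  qed
  with x01 show ?thesis using that by blast
qed

section \<open>Hilbert spaces\<close>

text \<open>A minimising sequence for the distance to \<open>x\<close> is Cauchy by the
  parallelogram law, because midpoints stay in \<open>C\<close>. The obtuse angle form of minimality
  yields orthogonality when \<open>C\<close> is a subspace and a separating functional in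
  general.\<close>

lemma convex_closest_point_exists:
  fixes C :: "'a::{real_inner, complete_space} set"
  assumes C: "closed C" "convex C" "C \<noteq> {}"
  obtains p where "p \<in> C" "\<And>y. y \<in> C \<Longrightarrow> (x - p) \<bullet> (y - p) \<le> 0"
proof -
  define d where "d = (INF y\<in>C. (norm (x - y))\<^sup>2)"
  have bdd: "bdd_below ((\<lambda>y. (norm (x - y))\<^sup>2) ` C)"
    by (rule bdd_belowI[of _ 0]) auto
  have d_le: "d \<le> (norm (x - y))\<^sup>2" if "y \<in> C" for y
    unfolding d_def using bdd that by (rule cINF_lower)
  have "\<exists>y\<in>C. (norm (x - y))\<^sup>2 < d + 1 / Suc n" for n
    using cINF_less_iff[of C "\<lambda>y. (norm (x - y))\<^sup>2" "d + 1 / Suc n"] C bdd by (simp add: d_def)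
  then obtain y where yC: "\<And>n. y n \<in> C" and yd: "\<And>n. (norm (x - y n))\<^sup>2 < d + 1 / Suc n"
    by metis
  have para: "(norm (y m - y n))\<^sup>2 \<le> 2 / Suc m + 2 / Suc n" for m n
  proof -
    have "(1/2) *\<^sub>R y m + (1/2) *\<^sub>R y n \<in> C"
      using convexD[OF C(2) yC yC, of "1/2" "1/2"] by simp
    from d_le[OF this] have "4 * d \<le> (norm (2 *\<^sub>R (x - ((1/2) *\<^sub>R y m + (1/2) *\<^sub>R y n))))\<^sup>2"
      unfolding norm_scaleR by (simp add: power_mult_distrib)
    also have "2 *\<^sub>R (x - ((1/2) *\<^sub>R y m + (1/2) *\<^sub>R y n)) = (x - y m) + (x - y n)"
      by (simp add: algebra_simps flip: scaleR_2)
    finally have "4 * d \<le> (norm ((x - y m) + (x - y n)))\<^sup>2" .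
    moreover have "(norm ((x - y m) + (x - y n)))\<^sup>2 + (norm (y m - y n))\<^sup>2 = 2 * (norm (x - y m))\<^sup>2 + 2 * (norm (x - y n))\<^sup>2"
      by (simp add: power2_norm_eq_inner inner_simps inner_commute)
    ultimately show ?thesis using yd[of m] yd[of n] by simp
  qed
  have "Cauchy y"
  proof (rule metric_CauchyI)
    fix e :: real assume "0 < e"
    then obtain N where N: "1 / Suc N < e\<^sup>2 / 4"
      using reals_Archimedean[of "e\<^sup>2/4"] by (auto simp: inverse_eq_divide)
    have "dist (y m) (y n) < e" if "N \<le> m" "N \<le> n" for m n
    proof -
      have "2 / Suc m \<le> 2 / Suc N" "2 / Suc n \<le> 2 / Suc N"
        using that by (auto intro!: divide_left_mono)
      with para[of m n] N have "(norm (y m - y n))\<^sup>2 < e\<^sup>2" by simp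
      then show ?thesis
        using power_less_imp_less_base[of "norm (y m - y n)" 2 e] \<open>0 < e\<close> by (simp add: dist_norm)
    qed
    then show "\<exists>M. \<forall>m\<ge>M. \<forall>n\<ge>M. dist (y m) (y n) < e" by blast
  qed
  then obtain p where p: "y \<longlonglongrightarrow> p"
    by (auto simp: Cauchy_convergent_iff convergent_def)
  have pC: "p \<in> C" using closed_sequentially[OF C(1) _ p] yC by blast
  have "(norm (x - p))\<^sup>2 \<le> d"
  proof (rule LIMSEQ_le)
    show "(\<lambda>n. (norm (x - y n))\<^sup>2) \<longlonglongrightarrow> (norm (x - p))\<^sup>2"
      by (intro tendsto_intros p)
    show "(\<lambda>n. d + 1 / Suc n) \<longlonglongrightarrow> d"
      using tendsto_add[OF tendsto_const LIMSEQ_inverse_real_of_nat, of d] by (simp add: inverse_eq_divide)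
    show "\<exists>N. \<forall>n\<ge>N. (norm (x - y n))\<^sup>2 \<le> d + 1 / Suc n" using yd less_imp_le by blast
  qed
  then have "dist x p \<le> dist x z" if "z \<in> C" for z
    unfolding dist_norm
    by (rule power2_le_imp_le[OF order_trans[OF _ d_le[OF that]]]) auto
  then show ?thesis
    using that[OF pC] any_closest_point_dot[OF C(2,1) pC] by blast
qed

lemma orthogonal_projection_exists:
  fixes W :: "'a::{real_inner, complete_space} set"
  assumes "subspace W" "closed W"
  obtains p where "p \<in> W" "\<And>v. v \<in> W \<Longrightarrow> (x - p) \<bullet> v = 0"
proof -
  have "W \<noteq> {}" using assms(1) subspace_0 by auto
  then obtain p where p: "p \<in> W" "\<And>y. y \<in> W \<Longrightarrow> (x - p) \<bullet> (y - p) \<le> 0"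
    using convex_closest_point_exists[OF assms(2) subspace_imp_convex[OF assms(1)]] by metis
  \<comment> \<open>Both \<open>p + v\<close> and \<open>p - v\<close> lie in \<open>W\<close>; the
    two inequalities together give orthogonality.\<close>
  have le: "(x - p) \<bullet> v \<le> 0" if "v \<in> W" for v
    using p(2)[of "p + v"] p(1) that assms(1) by (simp add: subspace_add)
  have "(x - p) \<bullet> v = 0" if "v \<in> W" for v
    using le[OF that] le[of "- v"] that assms(1) by (simp add: subspace_neg)
  then show ?thesis using that p(1) by blast
qed

text \<open>With \<open>p\<close> the point of \<open>C\<close> closest to \<open>x\<close>, the
  inner product with \<open>x - p\<close> separates \<open>x\<close> from \<open>C\<close>. Testing
  weak convergence with this one vector forces \<open>x = p\<close>.\<close>

lemma convex_closed_weakly_closed: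
  fixes C :: "'a::{real_inner, complete_space} set"
  assumes C: "closed C" "convex C" and X: "\<And>n. X n \<in> C" "\<And>y. (\<lambda>n. X n \<bullet> y) \<longlonglongrightarrow> x \<bullet> y"
  shows "x \<in> C"
proof -
  have "C \<noteq> {}" using X(1) by blast
  then obtain p where p: "p \<in> C" "\<And>y. y \<in> C \<Longrightarrow> (x - p) \<bullet> (y - p) \<le> 0"
    using convex_closest_point_exists[OF C] by metis
  have "(\<lambda>n. X n \<bullet> (x - p) - p \<bullet> (x - p)) \<longlonglongrightarrow> x \<bullet> (x - p) - p \<bullet> (x - p)"
    by (intro tendsto_intros X)
  moreover have "X n \<bullet> (x - p) - p \<bullet> (x - p) \<le> 0" for n
    using p(2)[OF X(1)[of n]] by (simp add: inner_diff_left inner_diff_right inner_commute)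
  ultimately have "x \<bullet> (x - p) - p \<bullet> (x - p) \<le> 0"
    by (meson LIMSEQ_le_const2)
  then have "(x - p) \<bullet> (x - p) \<le> 0" by (simp add: inner_diff_left)
  then have "x = p" using inner_ge_zero[of "x - p"] by (simp add: antisym)
  then show ?thesis using p by simp
qed

lemma riesz_representation:
  fixes l :: "'a::{real_inner, complete_space} \<Rightarrow> real"
  assumes "bounded_linear l"
  obtains z where "\<And>y. l y = z \<bullet> y"
proof (cases "\<forall>y. l y = 0")
  case True
  then show ?thesis using that[of 0] by simp
next
  case False
  then obtain x where x: "l x \<noteq> 0" by blast
  interpret bounded_linear l by fact
  let ?N = "{y. l y = 0}"
  have "subspace ?N" by (auto simp: subspace_def add scaleR zero)
  moreover have "closed ?N"
    using continuous_closed_preimage_constant[of UNIV l 0] linear_continuous_on[OF assms] by simp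
  ultimately obtain p where p: "p \<in> ?N" "\<And>v. v \<in> ?N \<Longrightarrow> (x - p) \<bullet> v = 0"
    by (rule orthogonal_projection_exists[of _ x]) blast
  \<comment> \<open>This vector is normal to the kernel of \<open>l\<close>, so the representing
    vector is a multiple of it.\<close>
  define w where "w = x - p"
  have lw: "l w \<noteq> 0" using x p by (simp add: w_def diff)
  then have w0: "w \<noteq> 0" using zero by auto
  show ?thesis
  proof (rule that[of "(l w / (w \<bullet> w)) *\<^sub>R w"])
    fix y
    have "l (y - (l y / l w) *\<^sub>R w) = 0" using lw by (simp add: diff scaleR)
    then have "w \<bullet> (y - (l y / l w) *\<^sub>R w) = 0" using p(2) by (simp add: w_def)
    then have "w \<bullet> y = (l y / l w) * (w \<bullet> w)" by (simp add: inner_diff_right)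
    then show "l y = (l w / (w \<bullet> w)) *\<^sub>R w \<bullet> y" using lw w0 by simp
  qed
qed

text \<open>The diagonal argument handles the inner products with the countably many
  \<open>X m\<close>. The vectors against which the subsequence converges form a closed subspace
  \<open>Y\<close> containing every \<open>X m\<close>. A vector orthogonal to \<open>Y\<close> is
  orthogonal to every \<open>X m\<close>, hence belongs to \<open>Y\<close> too; so \<open>Y\<close>
  is everything, without any appeal to separability.\<close>

lemma bounded_weakly_convergent_subsequence:
  fixes X :: "nat \<Rightarrow> 'a::{real_inner, complete_space}"
  assumes B: "\<And>n. norm (X n) \<le> B"
  obtains r x where "strict_mono r" "\<And>y. (\<lambda>n. X (r n) \<bullet> y) \<longlonglongrightarrow> x \<bullet> y"
proof -
  have CS: "\<bar>X n \<bullet> y\<bar> \<le> B * norm y" for n y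
    by (meson B Cauchy_Schwarz_ineq2 mult_right_mono norm_ge_zero order_trans)
  obtain r l where r: "strict_mono r" and l: "\<And>m. (\<lambda>n. X (r n) \<bullet> X m) \<longlonglongrightarrow> l m"
    by (rule bounded_coordinates_convergent_subsequence[of "\<lambda>n m. X n \<bullet> X m", OF CS]) blast
  define Y where "Y = {y. convergent (\<lambda>n. X (r n) \<bullet> y)}"
  have "subspace Y"
    by (auto simp: Y_def subspace_def inner_add_right convergent_const intro: convergent_add convergent_mult)
  moreover have "closed Y"
    unfolding closed_sequential_limits
  proof safe
    fix y z assume y: "\<forall>n. y n \<in> Y" and yz: "y \<longlonglongrightarrow> z"
    have "Cauchy (\<lambda>n. X (r n) \<bullet> z)"
    proof (rule metric_CauchyI)
      fix e :: real assume e: "0 < e"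
      have B0: "0 \<le> B" using B[of 0] norm_ge_zero order_trans by blast
      \<comment> \<open>The bound \<open>B\<close> may be 0, so the division is by a multiple of
        \<open>B + 1\<close>.\<close>
      have "0 < e / (3 * (B + 1))" using e B0 by simp
      then obtain k where k: "norm (y k - z) < e / (3 * (B + 1))"
        using yz LIMSEQ_iff by blast
      have small: "\<bar>X n \<bullet> (y k - z)\<bar> < e / 3" for n
      proof -
        have "\<bar>X n \<bullet> (y k - z)\<bar> \<le> (B + 1) * norm (y k - z)"
          using CS[of n "y k - z"] norm_ge_zero[of "y k - z"] unfolding distrib_right by linarith
        also have "\<dots> < (B + 1) * (e / (3 * (B + 1)))"
          using k B0 by (intro mult_strict_left_mono) auto
        also have "\<dots> = e / 3" using B0 by (simp add: field_simps)
        finally show ?thesis .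
      qed
      have "Cauchy (\<lambda>n. X (r n) \<bullet> y k)" using y by (simp add: Y_def convergent_Cauchy)
      then obtain M where M: "\<And>m n. m \<ge> M \<Longrightarrow> n \<ge> M \<Longrightarrow> dist (X (r m) \<bullet> y k) (X (r n) \<bullet> y k) < e / 3"
        using e metric_CauchyD[of _ "e/3"] by (metis zero_less_divide_iff zero_less_numeral)
      have "dist (X (r m) \<bullet> z) (X (r n) \<bullet> z) < e" if "m \<ge> M" "n \<ge> M" for m n
        using M[OF that] small[of "r m"] small[of "r n"]
        by (auto simp: dist_real_def inner_diff_right abs_if split: if_splits)
      then show "\<exists>M. \<forall>m\<ge>M. \<forall>n\<ge>M. dist (X (r m) \<bullet> z) (X (r n) \<bullet> z) < e" by blast
    qed
    then show "z \<in> Y" by (simp add: Y_def Cauchy_convergent)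
  qed
  ultimately have "y \<in> Y" for y
  proof -
    obtain p where p: "p \<in> Y" "\<And>v. v \<in> Y \<Longrightarrow> (y - p) \<bullet> v = 0"
      by (rule orthogonal_projection_exists[OF \<open>subspace Y\<close> \<open>closed Y\<close>, of y]) blast
    have "X m \<in> Y" for m using l by (auto simp: Y_def convergent_def)
    then have "X m \<bullet> (y - p) = 0" for m using p(2) by (metis inner_commute)
    then have "y - p \<in> Y" by (simp add: Y_def convergent_const)
    then have "(y - p) + p \<in> Y" using p(1) \<open>subspace Y\<close> subspace_add by blast
    then show ?thesis by simp
  qed
  then have lim: "(\<lambda>n. X (r n) \<bullet> y) \<longlonglongrightarrow> lim (\<lambda>n. X (r n) \<bullet> y)" for y
    by (simp add: Y_def convergent_LIMSEQ_iff)
  \<comment> \<open>The limit functional inherits the bound \<open>B\<close>; its Riesz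
    representative is the weak limit.\<close>
  have "bounded_linear (\<lambda>y. lim (\<lambda>n. X (r n) \<bullet> y))"
  proof (rule bounded_linear_intro)
    fix y z c
    show "lim (\<lambda>n. X (r n) \<bullet> (y + z)) = lim (\<lambda>n. X (r n) \<bullet> y) + lim (\<lambda>n. X (r n) \<bullet> z)"
      unfolding inner_add_right by (intro limI tendsto_intros lim)
    show "lim (\<lambda>n. X (r n) \<bullet> (c *\<^sub>R y)) = c *\<^sub>R lim (\<lambda>n. X (r n) \<bullet> y)"
      unfolding inner_scaleR_right real_scaleR_def by (intro limI tendsto_intros lim)
    show "norm (lim (\<lambda>n. X (r n) \<bullet> y)) \<le> norm y * B"
      by (rule LIMSEQ_le_const2[OF tendsto_norm[OF lim]]) (use CS in \<open>simp add: mult.commute\<close>)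
  qed
  from riesz_representation[OF this] obtain x where "\<And>y. lim (\<lambda>n. X (r n) \<bullet> y) = x \<bullet> y"
    by blast
  then show ?thesis using that[OF r, of x] lim by simp
qed

section \<open>Coercive variational problems\<close>

text \<open>Since \<open>T\<close> may be nonsymmetric, minimisation is replaced by Banach's fixed
  point theorem for \<open>P (w - \<rho> *\<^sub>R (T w - b))\<close>, with \<open>P\<close> the
  orthogonal projection onto \<open>W\<close>. At a fixed point the residual \<open>T w - b\<close>
  is orthogonal to \<open>W\<close>.\<close>

lemma lax_milgram_subspace:
  fixes W :: "'a::{real_inner, complete_space} set"
  assumes W: "subspace W" "closed W" and T: "bounded_linear T" and c: "0 < c"
    and coercive: "\<And>w. w \<in> W \<Longrightarrow> c * (norm w)\<^sup>2 \<le> w \<bullet> T w"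
  obtains w where "w \<in> W" "\<And>v. v \<in> W \<Longrightarrow> v \<bullet> T w = v \<bullet> b"
proof -
  interpret bounded_linear T by fact
  have "\<exists>p. p \<in> W \<and> (\<forall>v\<in>W. (x - p) \<bullet> v = 0)" for x
    by (rule orthogonal_projection_exists[OF W, of x]) blast
  then obtain P where P: "\<And>x. P x \<in> W" "\<And>x v. v \<in> W \<Longrightarrow> (x - P x) \<bullet> v = 0"
    by metis
  obtain K0 where K0: "\<And>x. norm (T x) \<le> norm x * K0" using bounded by blast
  \<comment> \<open>The maximum with \<open>c\<close> gives \<open>0 < K\<close> and
    \<open>c / K \<le> 1\<close>, as \<open>\<rho>\<close> and the square root in \<open>q\<close>
    require.\<close>
  define K where "K = max K0 c"
  have K: "norm (T x) \<le> norm x * K" "c \<le> K" for x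
    using order_trans[OF K0[of x] mult_left_mono[of K0 "max K0 c" "norm x"]] by (auto simp: K_def)
  have K_pos: "0 < K" using K c by linarith
  \<comment> \<open>This \<rho> minimises
    \<open>1 - 2 * \<rho> * c + \<rho>\<^sup>2 * K\<^sup>2\<close>, which bounds the squared
    contraction factor; the minimum is \<open>1 - (c / K)\<^sup>2\<close>.\<close>
  define \<rho> where "\<rho> = c / K\<^sup>2"
  define \<Phi> where "\<Phi> w = P (w - \<rho> *\<^sub>R (T w - b))" for w
  define q where "q = sqrt (1 - (c / K)\<^sup>2)"
  have cK: "(c / K)\<^sup>2 \<le> 1" "0 < (c/K)\<^sup>2" using K c K_pos by (auto simp: power_le_one)
  have "\<exists>!w\<in>W. \<Phi> w = w"
  proof (rule Banach_fix)
    show "complete W" using W(2) by (simp add: complete_eq_closed)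
    show "W \<noteq> {}" using W(1) subspace_0 by auto
    show "0 \<le> q" "q < 1" using cK by (auto simp: q_def)
    show "\<Phi> ` W \<subseteq> W" using P by (auto simp: \<Phi>_def)
    fix x y assume xy: "x \<in> W" "y \<in> W"
    define d where "d = x - y"
    have dW: "d \<in> W" using xy W(1) by (simp add: d_def subspace_diff)
    define e where "e = \<Phi> x - \<Phi> y"
    have eW: "e \<in> W" using P W(1) by (simp add: e_def \<Phi>_def subspace_diff)
    \<comment> \<open>Orthogonality of both projection errors to \<open>e\<close> takes the place of
      linearity and nonexpansiveness of \<open>P\<close>, which was obtained by mere choice.\<close>
    have "(x - \<rho> *\<^sub>R (T x - b) - \<Phi> x) \<bullet> e = 0" "(y - \<rho> *\<^sub>R (T y - b) - \<Phi> y) \<bullet> e = 0"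
      using P(2)[OF eW] by (simp_all add: \<Phi>_def)
    then have "((x - \<rho> *\<^sub>R (T x - b) - \<Phi> x) - (y - \<rho> *\<^sub>R (T y - b) - \<Phi> y)) \<bullet> e = 0"
      unfolding inner_diff_left[of "x - \<rho> *\<^sub>R (T x - b) - \<Phi> x"] by simp
    also have "(x - \<rho> *\<^sub>R (T x - b) - \<Phi> x) - (y - \<rho> *\<^sub>R (T y - b) - \<Phi> y) = (d - \<rho> *\<^sub>R T d) - e"
      by (simp add: d_def e_def diff algebra_simps)
    finally have Te: "(d - \<rho> *\<^sub>R T d) \<bullet> e = e \<bullet> e"
      by (simp add: inner_diff_left)
    have "norm e * norm e \<le> norm (d - \<rho> *\<^sub>R T d) * norm e"
      using norm_cauchy_schwarz[of "d - \<rho> *\<^sub>R T d" e] Te by (simp add: norm_eq_square flip: power2_norm_eq_inner power2_eq_square)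
    then have "norm e \<le> norm (d - \<rho> *\<^sub>R T d)"
      by (cases "e = 0") auto
    moreover have "(norm (d - \<rho> *\<^sub>R T d))\<^sup>2 \<le> (q * norm d)\<^sup>2"
    proof -
      have "(norm (d - \<rho> *\<^sub>R T d))\<^sup>2 = (norm d)\<^sup>2 - 2 * \<rho> * (d \<bullet> T d) + \<rho>\<^sup>2 * (norm (T d))\<^sup>2"
        unfolding power2_norm_eq_inner
        by (simp add: inner_diff_left inner_diff_right inner_commute power2_eq_square algebra_simps)
      also have "\<dots> \<le> (norm d)\<^sup>2 - 2 * \<rho> * (c * (norm d)\<^sup>2) + \<rho>\<^sup>2 * (norm d * K)\<^sup>2"
        using coercive[OF dW] K(1)[of d] c K_pos
        by (intro add_mono diff_mono mult_left_mono power_mono) (auto simp: \<rho>_def)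
      also have "\<dots> = (1 - (c / K)\<^sup>2) * (norm d)\<^sup>2"
        using K_pos by (simp add: \<rho>_def power2_eq_square field_simps)
      also have "\<dots> = (q * norm d)\<^sup>2" using cK by (simp add: q_def power_mult_distrib)
      finally show ?thesis .
    qed
    ultimately have "norm e \<le> q * norm d"
      using \<open>0 \<le> q\<close> by (meson norm_ge_zero order_trans power2_le_imp_le zero_le_mult_iff)
    then show "dist (\<Phi> x) (\<Phi> y) \<le> q * dist x y" by (simp add: e_def d_def dist_norm)
  qed
  then obtain w where w: "w \<in> W" "\<Phi> w = w" by blast
  have "v \<bullet> T w = v \<bullet> b" if "v \<in> W" for v
  proof -
    have "(w - \<rho> *\<^sub>R (T w - b) - w) \<bullet> v = 0"
      using P(2)[OF that, of "w - \<rho> *\<^sub>R (T w - b)"] w(2) by (simp add: \<Phi>_def)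
    then have "\<rho> * ((T w - b) \<bullet> v) = 0" by (simp add: inner_simps)
    then have "T w \<bullet> v = b \<bullet> v" using c K_pos by (simp add: \<rho>_def inner_diff_left)
    then show ?thesis by (metis inner_commute)
  qed
  then show ?thesis using that w(1) by blast
qed

text \<open>Both equations are tested with \<open>w' - w\<close>, and coercivity is taken from
  \<open>T'\<close>. The operators are compared only at \<open>w\<close>; with \<open>w\<close> as
  the limit solution, strong convergence of operators is enough.\<close>

lemma variational_solution_stable:
  fixes W :: "'a::real_inner set"
  assumes W: "subspace W" and T: "bounded_linear T'"
    and coercive: "\<And>w. w \<in> W \<Longrightarrow> c * (norm w)\<^sup>2 \<le> w \<bullet> T' w"
    and w: "w \<in> W" "\<And>v. v \<in> W \<Longrightarrow> v \<bullet> T w = v \<bullet> b"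
    and w': "w' \<in> W" "\<And>v. v \<in> W \<Longrightarrow> v \<bullet> T' w' = v \<bullet> b'"
  shows "c * norm (w' - w) \<le> norm (b' - b) + norm (T' w - T w)"
proof -
  interpret bounded_linear T' by fact
  define d where "d = w' - w"
  have dW: "d \<in> W" using w w' W by (simp add: d_def subspace_diff)
  have "c * (norm d)\<^sup>2 \<le> d \<bullet> T' d" by (rule coercive[OF dW])
  also have "\<dots> = d \<bullet> (b' - b) - d \<bullet> (T' w - T w)"
    using w(2)[OF dW] w'(2)[OF dW] by (simp add: d_def diff inner_simps)
  also have "\<dots> \<le> norm d * norm (b' - b) + norm d * norm (T' w - T w)"
    using Cauchy_Schwarz_ineq2[of d "b' - b"] Cauchy_Schwarz_ineq2[of d "T' w - T w"] by linarith
  finally have "norm d * (c * norm d) \<le> norm d * (norm (b' - b) + norm (T' w - T w))"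
    by (simp add: power2_eq_square algebra_simps)
  then show ?thesis
    by (cases "d = 0") (auto simp: d_def)
qed

section \<open>Schauder's fixed point theorem\<close>

text \<open>A finite \<epsilon>-net \<open>y\<close> of the image replaces \<open>K\<close> by a
  cube of weights \<open>c\<close>. The map sends \<open>c\<close> to the normalised hat weights of
  \<open>G (\<Phi> c)\<close> with respect to the net, and Brouwer's theorem gives weights that
  reproduce themselves.\<close>

lemma approximate_schauder:
  fixes K :: "'a::real_inner set"
  assumes K: "convex K" "0 \<in> K"
    and GK: "\<And>x. x \<in> K \<Longrightarrow> G x \<in> K"
    and cont: "\<And>X x. \<lbrakk>\<And>n. X n \<in> K; x \<in> K; X \<longlonglongrightarrow> x\<rbrakk> \<Longrightarrow> (\<lambda>n. G (X n)) \<longlonglongrightarrow> G x"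
    and "seq_compact (G ` K)" and "0 < \<epsilon>"
  obtains x where "x \<in> K" "norm (G x - x) \<le> \<epsilon>"
proof -
  obtain D where D: "finite D" "D \<subseteq> G ` K" "G ` K \<subseteq> (\<Union>x\<in>D. ball x \<epsilon>)"
    using seq_compact_imp_totally_bounded[OF assms(5), rule_format, OF \<open>0 < \<epsilon>\<close>] by auto
  obtain y :: "nat \<Rightarrow> 'a" and N where y: "D = y ` {..<N}"
    using D(1) by (metis finite_imp_nat_seg_image_inj_on lessThan_def)
  have yK: "y i \<in> K" if "i < N" for i using D(2) GK that by (auto simp: y)
  \<comment> \<open>Brouwer's theorem is stated for cubes, not simplices. Dividing by at least 1
    turns every point of the cube into weights of sum at most 1 and leaves weights of sum 1
    unchanged.\<close>
  define t where "t c i = c i / max 1 (\<Sum>j<N. c j)" for c :: "nat \<Rightarrow> real" and i :: nat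
  define \<Phi> where "\<Phi> c = (\<Sum>i<N. t c i *\<^sub>R y i)" for c
  have \<Phi>K: "\<Phi> c \<in> K" if c: "\<forall>i<N. c i \<in> {0..1}" for c
  proof -
    have t0: "0 \<le> t c i" if "i < N" for i
      using c that by (simp add: t_def)
    have "(\<Sum>i<N. t c i) = (\<Sum>i<N. c i) / max 1 (\<Sum>j<N. c j)"
      by (simp add: t_def sum_divide_distrib)
    also have "\<dots> \<le> 1" by (simp add: divide_le_eq)
    finally have t1: "(\<Sum>i<N. t c i) \<le> 1" .
    \<comment> \<open>The missing weight is put on the point \<open>0 \<in> K\<close>, under the
      additional index \<open>N\<close>.\<close>
    have "(\<Sum>i\<in>insert N {..<N}. (if i = N then 1 - (\<Sum>i<N. t c i) else t c i) *\<^sub>R (if i = N then 0 else y i)) \<in> K"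
      by (rule convex_sum[OF _ K(1)]) (use t0 t1 yK K(2) in auto)
    also have "(\<Sum>i\<in>insert N {..<N}. (if i = N then 1 - (\<Sum>i<N. t c i) else t c i) *\<^sub>R (if i = N then 0 else y i)) = \<Phi> c"
      by (auto simp: \<Phi>_def intro!: sum.cong)
    finally show ?thesis .
  qed
  define wt where "wt z i = max 0 (\<epsilon> - dist z (y i))" for z :: 'a and i
  define tot where "tot z = (\<Sum>i<N. wt z i)" for z
  have wt0: "0 \<le> wt z i" for z i by (simp add: wt_def)
  have tot_pos: "0 < tot z" if z: "z \<in> G ` K" for z
  proof -
    obtain i where "i < N" "dist z (y i) < \<epsilon>" using subsetD[OF D(3) z] by (auto simp: y dist_commute)
    then show ?thesis unfolding tot_def
      by (intro sum_pos2[of _ i]) (auto simp: wt_def)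
  qed
  define f where "f c i = wt (G (\<Phi> c)) i / tot (G (\<Phi> c))" for c i
  obtain c where c: "\<forall>i<N. c i \<in> {0..1}" "\<forall>i<N. f c i = c i"
  proof (rule brouwer_nat_cube[of N f])
    fix X x assume X: "\<And>k i. i < N \<Longrightarrow> X k i \<in> {0..1::real}" "\<And>i. i < N \<Longrightarrow> (\<lambda>k. X k i) \<longlonglongrightarrow> x i"
    have x: "\<forall>i<N. x i \<in> {0..1}"
    proof (intro allI impI)
      fix i assume i: "i < N"
      show "x i \<in> {0..1}"
        using closed_sequentially[OF _ _ X(2)[OF i], of "{0..1}"] X(1)[OF i] by auto
    qed
    have "(\<lambda>k. \<Phi> (X k)) \<longlonglongrightarrow> \<Phi> x"
      unfolding \<Phi>_def t_def by (intro tendsto_intros X) auto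
    then have G: "(\<lambda>k. G (\<Phi> (X k))) \<longlonglongrightarrow> G (\<Phi> x)"
      using \<Phi>K X(1) x by (intro cont) auto
    have "0 < tot (G (\<Phi> x))" using tot_pos \<Phi>K x by blast
    then have "tot (G (\<Phi> x)) \<noteq> 0" by simp
    then show "\<forall>i<N. (\<lambda>k. f (X k) i) \<longlonglongrightarrow> f x i"
      unfolding f_def tot_def wt_def by (intro allI impI tendsto_intros G)
  next
    fix x assume "\<forall>i<N. x i \<in> {0..1::real}"
    then have "0 < tot (G (\<Phi> x))" using tot_pos \<Phi>K by blast
    moreover have "wt (G (\<Phi> x)) i \<le> tot (G (\<Phi> x))" if "i < N" for i
      unfolding tot_def using that wt0 by (intro member_le_sum) auto
    ultimately show "\<forall>i<N. f x i \<in> {0..1}" using wt0 by (auto simp: f_def)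
  qed auto
  define z where "z = G (\<Phi> c)"
  have z: "z \<in> G ` K" using \<Phi>K c by (simp add: z_def)
  have ci: "c i = wt z i / tot z" if "i < N" for i using c(2) that by (simp add: f_def z_def)
  then have "(\<Sum>i<N. c i) = (\<Sum>i<N. wt z i / tot z)" by simp
  also have "\<dots> = 1" using tot_pos[OF z] by (simp add: tot_def flip: sum_divide_distrib)
  \<comment> \<open>At the fixed point the normalisation is the identity, so \<open>\<Phi> c\<close>
    is a convex combination of net points. Only those within \<epsilon> of \<open>z\<close> carry
    weight, whence the final estimate.\<close>
  finally have c1: "(\<Sum>i<N. c i) = 1" .
  then have \<Phi>c: "\<Phi> c = (\<Sum>i<N. c i *\<^sub>R y i)" by (simp add: \<Phi>_def t_def)
  have "z - \<Phi> c = (\<Sum>i<N. c i *\<^sub>R (z - y i))"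
    using c1 by (simp add: \<Phi>c scaleR_diff_right sum_subtractf flip: scaleR_left.sum)
  also have "norm \<dots> \<le> (\<Sum>i<N. c i * \<epsilon>)"
  proof (rule sum_norm_le)
    fix i assume i: "i \<in> {..<N}"
    show "norm (c i *\<^sub>R (z - y i)) \<le> c i * \<epsilon>"
    proof (cases "dist z (y i) < \<epsilon>")
      case True
      then show ?thesis using c(1) i by (simp add: dist_norm mult_left_mono)
    next
      case False
      then have "c i = 0" using ci i by (simp add: wt_def)
      then show ?thesis by simp
    qed
  qed
  also have "\<dots> = \<epsilon>" using c1 by (simp flip: sum_distrib_right)
  finally show ?thesis using that[OF \<Phi>K[OF c(1)]] by (simp add: z_def)
qed

lemma weak_schauder:
  fixes K :: "'a::{real_inner, complete_space} set"
  assumes K: "convex K" "closed K" "bounded K" "0 \<in> K"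
    and GK: "\<And>x. x \<in> K \<Longrightarrow> G x \<in> K"
    and cont: "\<And>X x. \<lbrakk>\<And>n. X n \<in> K; x \<in> K; \<And>y. (\<lambda>n. X n \<bullet> y) \<longlonglongrightarrow> x \<bullet> y\<rbrakk> \<Longrightarrow> (\<lambda>n. G (X n)) \<longlonglongrightarrow> G x"
  obtains x where "x \<in> K" "G x = x"
proof -
  obtain B where B: "\<And>x. x \<in> K \<Longrightarrow> norm x \<le> B" using K(3) by (auto simp: bounded_iff)
  have sub: "\<exists>r x. strict_mono r \<and> x \<in> K \<and> (\<forall>y. (\<lambda>n. X (r n) \<bullet> y) \<longlonglongrightarrow> x \<bullet> y) \<and> (\<lambda>n. G (X (r n))) \<longlonglongrightarrow> G x"
    if X: "\<And>n. X n \<in> K" for X :: "nat \<Rightarrow> 'a"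
  proof -
    obtain r x where r: "strict_mono r" and x: "\<And>y. (\<lambda>n. X (r n) \<bullet> y) \<longlonglongrightarrow> x \<bullet> y"
      by (rule bounded_weakly_convergent_subsequence[of X B]) (use B X in blast)+
    have "x \<in> K"
      by (rule convex_closed_weakly_closed[OF K(2,1), of "\<lambda>n. X (r n)"]) (use X x in auto)
    moreover from this have "(\<lambda>n. G (X (r n))) \<longlonglongrightarrow> G x" using X x by (intro cont) auto
    ultimately show ?thesis using r x by (intro exI[of _ r] exI[of _ x]) auto
  qed
  have sc: "seq_compact (G ` K)"
    unfolding seq_compact_def
  proof (intro allI impI)
    fix f :: "nat \<Rightarrow> 'a" assume "\<forall>n. f n \<in> G ` K"
    then have "\<exists>x. x \<in> K \<and> f n = G x" for n by blast
    then obtain X where X: "\<And>n. X n \<in> K" "\<And>n. f n = G (X n)" by metis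
    from sub[of X, OF X(1)] obtain r x where "strict_mono r" "x \<in> K" "(\<lambda>n. G (X (r n))) \<longlonglongrightarrow> G x"
      by auto
    then show "\<exists>l\<in>G ` K. \<exists>r. strict_mono r \<and> (f \<circ> r) \<longlonglongrightarrow> l"
      by (intro bexI[of _ "G x"] exI[of _ r]) (auto simp: comp_def X(2))
  qed
  \<comment> \<open>Norm convergence implies weak convergence, so \<open>G\<close> is also
    continuous in the sense of \<open>approximate_schauder\<close>.\<close>
  have "\<exists>x\<in>K. norm (G x - x) \<le> 1 / Suc n" for n
    by (rule approximate_schauder[OF K(1,4) GK _ sc, of "1 / Suc n"])
       (auto intro!: cont tendsto_intros)
  then obtain X where X: "\<And>n. X n \<in> K" "\<And>n. norm (G (X n) - X n) \<le> 1 / Suc n" by metis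
  obtain r x where r: "strict_mono r" "x \<in> K" "\<And>y. (\<lambda>n. X (r n) \<bullet> y) \<longlonglongrightarrow> x \<bullet> y"
    and G: "(\<lambda>n. G (X (r n))) \<longlonglongrightarrow> G x" using sub[of X, OF X(1)] by auto
  have "(\<lambda>n. 1 / real (Suc (r n))) \<longlonglongrightarrow> 0"
    using LIMSEQ_subseq_LIMSEQ[OF LIMSEQ_inverse_real_of_nat r(1)] by (simp add: comp_def inverse_eq_divide)
  then have "(\<lambda>n. G (X (r n)) - X (r n)) \<longlonglongrightarrow> 0"
    by (rule Lim_null_comparison[rotated]) (use X in auto)
  from tendsto_diff[OF G this] have "(\<lambda>n. X (r n)) \<longlonglongrightarrow> G x" by simp
  \<comment> \<open>The norm limit \<open>G x\<close> and the weak limit \<open>x\<close> are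
    compared by testing with their difference.\<close>
  then have "(\<lambda>n. X (r n) \<bullet> (x - G x)) \<longlonglongrightarrow> G x \<bullet> (x - G x)" by (intro tendsto_intros)
  then have "x \<bullet> (x - G x) = G x \<bullet> (x - G x)" using r(3) LIMSEQ_unique by blast
  then have "(x - G x) \<bullet> (x - G x) = 0" by (simp add: inner_diff_left)
  then have "G x = x" by simp
  then show ?thesis using that r(2) by blast
qed

section \<open>The Hilbert space of square integrable functions\<close>

text \<open>The domain is the whole space, so that arguments may be reflected and translated freely;
  \<Omega> enters later through extension by zero.\<close>

definition square_integrable :: "('a::euclidean_space \<Rightarrow> 'b::euclidean_space) set" where
  "square_integrable = {u. u \<in> borel_measurable lebesgue \<and> integrable lebesgue (\<lambda>x. (norm (u x))\<^sup>2)}"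

lemma square_integrableI:
  "u \<in> borel_measurable lebesgue \<Longrightarrow> integrable lebesgue (\<lambda>x. (norm (u x))\<^sup>2) \<Longrightarrow> u \<in> square_integrable"
  by (simp add: square_integrable_def)

lemma square_integrable_measurable [measurable_dest]:
  "u \<in> square_integrable \<Longrightarrow> u \<in> borel_measurable lebesgue"
  by (simp add: square_integrable_def)

lemma square_integrable_norm2:
  "u \<in> square_integrable \<Longrightarrow> integrable lebesgue (\<lambda>x. (norm (u x))\<^sup>2)"
  by (simp add: square_integrable_def)

lemma square_integrable_bound:
  assumes v: "v \<in> square_integrable" and u: "u \<in> borel_measurable lebesgue"
    and le: "AE x in lebesgue. norm (u x) \<le> norm (v x)"
  shows "u \<in> square_integrable"
proof (rule square_integrableI[OF u])
  show "integrable lebesgue (\<lambda>x. (norm (u x))\<^sup>2)"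
  proof (rule Bochner_Integration.integrable_bound[OF square_integrable_norm2[OF v]])
    show "AE x in lebesgue. norm ((norm (u x))\<^sup>2) \<le> norm ((norm (v x))\<^sup>2)"
      using le by eventually_elim (simp add: power_mono)
  qed (use u in measurable)
qed

lemma integrable_norm_mult:
  assumes [measurable]: "u \<in> square_integrable" "v \<in> square_integrable"
  shows "integrable lebesgue (\<lambda>x. norm (u x) * norm (v x))"
proof (rule Bochner_Integration.integrable_bound)
  show "integrable lebesgue (\<lambda>x. (norm (u x))\<^sup>2 + (norm (v x))\<^sup>2)"
    using assms by (simp add: square_integrable_norm2)
  have "norm (u x) * norm (v x) \<le> (norm (u x))\<^sup>2 + (norm (v x))\<^sup>2" for x
    using sum_squares_bound[of "norm (u x)" "norm (v x)"]
      mult_nonneg_nonneg[OF norm_ge_zero[of "u x"] norm_ge_zero[of "v x"]] by linarith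
  then show "AE x in lebesgue. norm (norm (u x) * norm (v x)) \<le> norm ((norm (u x))\<^sup>2 + (norm (v x))\<^sup>2)"
    by simp
qed measurable

lemma integrable_inner:
  assumes [measurable]: "u \<in> square_integrable" "v \<in> square_integrable"
  shows "integrable lebesgue (\<lambda>x. u x \<bullet> v x)"
  by (rule Bochner_Integration.integrable_bound[OF integrable_norm_mult[OF assms]])
     (auto simp: Cauchy_Schwarz_ineq2)

lemma square_integrable_add:
  assumes [measurable]: "u \<in> square_integrable" "v \<in> square_integrable"
  shows "(\<lambda>x. u x + v x) \<in> square_integrable"
proof (rule square_integrableI)
  have "(norm (u x + v x))\<^sup>2 = (norm (u x))\<^sup>2 + 2 * (u x \<bullet> v x) + (norm (v x))\<^sup>2" for x
    by (simp add: power2_norm_eq_inner inner_add_left inner_add_right inner_commute)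
  then show "integrable lebesgue (\<lambda>x. (norm (u x + v x))\<^sup>2)"
    using assms by (simp add: square_integrable_norm2 integrable_inner)
qed measurable

lemma square_integrable_bounded_linear:
  assumes "bounded_linear L" and u: "u \<in> square_integrable"
  shows "(\<lambda>x. L (u x)) \<in> square_integrable"
proof (rule square_integrableI)
  interpret bounded_linear L by fact
  have [measurable]: "L \<in> borel_measurable borel"
    by (intro borel_measurable_continuous_onI linear_continuous_on assms)
  note u [measurable]
  show "(\<lambda>x. L (u x)) \<in> borel_measurable lebesgue" by measurable
  obtain K where K: "\<And>x. norm (L x) \<le> norm x * K" using bounded by blast
  show "integrable lebesgue (\<lambda>x. (norm (L (u x)))\<^sup>2)"
  proof (rule Bochner_Integration.integrable_bound)
    show "integrable lebesgue (\<lambda>x. (norm (u x))\<^sup>2 * K\<^sup>2)"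
      using square_integrable_norm2[OF u] by simp
    show "AE x in lebesgue. norm ((norm (L (u x)))\<^sup>2) \<le> norm ((norm (u x))\<^sup>2 * K\<^sup>2)"
      using K by (auto simp flip: power_mult_distrib intro!: power_mono)
  qed measurable
qed

lemma square_integrable_scaleR: "u \<in> square_integrable \<Longrightarrow> (\<lambda>x. c *\<^sub>R u x) \<in> square_integrable"
  by (rule square_integrable_bounded_linear[OF bounded_linear_scaleR_right])

lemma square_integrable_minus: "u \<in> square_integrable \<Longrightarrow> (\<lambda>x. - u x) \<in> square_integrable"
  using square_integrable_scaleR[of u "-1"] by simp

lemma square_integrable_diff:
  "u \<in> square_integrable \<Longrightarrow> v \<in> square_integrable \<Longrightarrow> (\<lambda>x. u x - v x) \<in> square_integrable"
  using square_integrable_add[of u "\<lambda>x. - v x"] by (simp add: square_integrable_minus)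

lemma square_integrable_zero: "(\<lambda>x. 0) \<in> square_integrable"
  by (simp add: square_integrable_def)

lemma square_integrable_norm: "u \<in> square_integrable \<Longrightarrow> (\<lambda>x. norm (u x)) \<in> square_integrable"
  by (auto simp: square_integrable_def)

definition L2rel :: "('a::euclidean_space \<Rightarrow> 'b::euclidean_space) \<Rightarrow> ('a \<Rightarrow> 'b) \<Rightarrow> bool" where
  "L2rel u v \<longleftrightarrow> u \<in> square_integrable \<and> v \<in> square_integrable \<and> (AE x in lebesgue. u x = v x)"

lemma part_equivp_L2rel: "part_equivp (L2rel :: ('a::euclidean_space \<Rightarrow> 'b::euclidean_space) \<Rightarrow> _)"
proof (rule part_equivpI)
  show "\<exists>u::'a \<Rightarrow> 'b. L2rel u u" using square_integrable_zero by (auto simp: L2rel_def)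
  show "symp (L2rel :: ('a \<Rightarrow> 'b) \<Rightarrow> _)"
    by (rule sympI) (auto simp: L2rel_def elim: eventually_mono)
  show "transp (L2rel :: ('a \<Rightarrow> 'b) \<Rightarrow> _)"
    by (rule transpI) (auto simp: L2rel_def elim: eventually_elim2)
qed

\<comment> \<open>Classes modulo null sets are needed as a type to instantiate
  \<open>real_inner\<close> and \<open>complete_space\<close>. Complex values are treated as real
  Euclidean vectors, so the inner product below is the real part of the complex one.\<close>
quotient_type (overloaded) ('a, 'b) L2 = "'a::euclidean_space \<Rightarrow> 'b::euclidean_space" / partial: L2rel
  by (rule part_equivp_L2rel)

lemma rep_L2_square_integrable: "rep_L2 U \<in> square_integrable"
  using Quotient_rep_reflp[OF Quotient_L2, of U] by (simp add: L2rel_def)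

lemma abs_L2_rep: "abs_L2 (rep_L2 U) = U"
  by (rule Quotient_abs_rep[OF Quotient_L2])

lemma abs_L2_eq_iff:
  assumes "u \<in> square_integrable" "v \<in> square_integrable"
  shows "abs_L2 u = abs_L2 v \<longleftrightarrow> (AE x in lebesgue. u x = v x)"
  using Quotient_rel[OF Quotient_L2, of u v] assms by (auto simp: L2rel_def)

lemma rep_abs_L2:
  assumes "u \<in> square_integrable"
  shows "AE x in lebesgue. rep_L2 (abs_L2 u) x = u x"
  using abs_L2_eq_iff[OF rep_L2_square_integrable assms, of "abs_L2 u"] by (simp add: abs_L2_rep)

instantiation L2 :: (euclidean_space, euclidean_space) real_inner
begin

lift_definition zero_L2 :: "('a, 'b) L2" is "\<lambda>x. 0"
  by (simp add: L2rel_def square_integrable_zero)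

lift_definition plus_L2 :: "('a, 'b) L2 \<Rightarrow> ('a, 'b) L2 \<Rightarrow> ('a, 'b) L2" is "\<lambda>u v x. u x + v x"
  unfolding L2rel_def by (auto simp: square_integrable_add)

lift_definition uminus_L2 :: "('a, 'b) L2 \<Rightarrow> ('a, 'b) L2" is "\<lambda>u x. - u x"
  unfolding L2rel_def by (auto simp: square_integrable_minus)

lift_definition minus_L2 :: "('a, 'b) L2 \<Rightarrow> ('a, 'b) L2 \<Rightarrow> ('a, 'b) L2" is "\<lambda>u v x. u x - v x"
  unfolding L2rel_def by (auto simp: square_integrable_diff)

lift_definition scaleR_L2 :: "real \<Rightarrow> ('a, 'b) L2 \<Rightarrow> ('a, 'b) L2" is "\<lambda>c u x. c *\<^sub>R u x"
  unfolding L2rel_def by (auto simp: square_integrable_scaleR)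

lift_definition inner_L2 :: "('a, 'b) L2 \<Rightarrow> ('a, 'b) L2 \<Rightarrow> real" is "\<lambda>u v. LINT x|lebesgue. u x \<bullet> v x"
proof -
  fix u v u' v' :: "'a \<Rightarrow> 'b" assume "L2rel u v" "L2rel u' v'"
  then show "(LINT x|lebesgue. u x \<bullet> u' x) = (LINT x|lebesgue. v x \<bullet> v' x)"
    unfolding L2rel_def by (intro integral_cong_AE) (auto simp: square_integrable_measurable)
qed

definition "norm (u :: ('a, 'b) L2) = sqrt (u \<bullet> u)"
definition "dist (u :: ('a, 'b) L2) v = norm (u - v)"
definition "sgn (u :: ('a, 'b) L2) = inverse (norm u) *\<^sub>R u"
definition "(uniformity :: (('a, 'b) L2 \<times> ('a, 'b) L2) filter) = (INF e\<in>{0 <..}. principal {(x, y). dist x y < e})"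
definition "open (U :: ('a, 'b) L2 set) \<longleftrightarrow> (\<forall>x\<in>U. \<forall>\<^sub>F (x', y) in uniformity. x' = x \<longrightarrow> y \<in> U)"

instance
proof
  fix u v w :: "('a, 'b) L2" and c d :: real
  show "u + v + w = u + (v + w)" by transfer (auto simp: L2rel_def algebra_simps square_integrable_add)
  show "u + v = v + u" by transfer (auto simp: L2rel_def algebra_simps square_integrable_add)
  show "0 + u = u" by transfer (auto simp: L2rel_def)
  show "- u + u = 0" by transfer (auto simp: L2rel_def square_integrable_zero)
  show "u - v = u + - v" by transfer (auto simp: L2rel_def square_integrable_diff)
  show "c *\<^sub>R (u + v) = c *\<^sub>R u + c *\<^sub>R v"
    by transfer (auto simp: L2rel_def algebra_simps intro!: square_integrable_add square_integrable_scaleR)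
  show "(c + d) *\<^sub>R u = c *\<^sub>R u + d *\<^sub>R u"
    by transfer (auto simp: L2rel_def algebra_simps intro!: square_integrable_add square_integrable_scaleR)
  show "c *\<^sub>R d *\<^sub>R u = (c * d) *\<^sub>R u"
    by transfer (auto simp: L2rel_def algebra_simps intro!: square_integrable_scaleR)
  show "1 *\<^sub>R u = u" by transfer (auto simp: L2rel_def)
  show "dist u v = norm (u - v)" by (rule dist_L2_def)
  show "sgn u = inverse (norm u) *\<^sub>R u" by (rule sgn_L2_def)
  show "(uniformity :: (('a, 'b) L2 \<times> ('a, 'b) L2) filter) = (INF e\<in>{0 <..}. principal {(x, y). dist x y < e})"
    by (rule uniformity_L2_def)
  show "open (U :: ('a, 'b) L2 set) \<longleftrightarrow> (\<forall>x\<in>U. \<forall>\<^sub>F (x', y) in uniformity. x' = x \<longrightarrow> y \<in> U)" for U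
    by (rule open_L2_def)
  show "u \<bullet> v = v \<bullet> u" by transfer (simp add: inner_commute)
  show "(u + v) \<bullet> w = u \<bullet> w + v \<bullet> w"
    by transfer (auto simp: L2rel_def inner_add_left integrable_inner)
  show "(c *\<^sub>R u) \<bullet> v = c * (u \<bullet> v)" by transfer simp
  show "0 \<le> u \<bullet> u" by transfer simp
  show "u \<bullet> u = 0 \<longleftrightarrow> u = 0"
  proof transfer
    fix u :: "'a \<Rightarrow> 'b" assume "L2rel u u"
    then have u: "u \<in> square_integrable" by (simp add: L2rel_def)
    have "(LINT x|lebesgue. u x \<bullet> u x) = 0 \<longleftrightarrow> (AE x in lebesgue. u x \<bullet> u x = 0)"
      using integral_nonneg_eq_0_iff_AE[OF integrable_inner[OF u u]] by simp
    then show "(LINT x|lebesgue. u x \<bullet> u x) = 0 \<longleftrightarrow> L2rel u (\<lambda>x. 0)"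
      using u by (simp add: L2rel_def square_integrable_zero)
  qed
  show "norm u = sqrt (u \<bullet> u)" by (rule norm_L2_def)
qed

end

lemma abs_L2_add:
  "u \<in> square_integrable \<Longrightarrow> v \<in> square_integrable \<Longrightarrow> abs_L2 (\<lambda>x. u x + v x) = abs_L2 u + abs_L2 v"
  by (rule plus_L2.abs_eq[symmetric]) (auto simp: L2rel_def)

lemma abs_L2_diff:
  "u \<in> square_integrable \<Longrightarrow> v \<in> square_integrable \<Longrightarrow> abs_L2 (\<lambda>x. u x - v x) = abs_L2 u - abs_L2 v"
  by (rule minus_L2.abs_eq[symmetric]) (auto simp: L2rel_def)

lemma abs_L2_scaleR: "u \<in> square_integrable \<Longrightarrow> abs_L2 (\<lambda>x. c *\<^sub>R u x) = c *\<^sub>R abs_L2 u"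
  by (rule scaleR_L2.abs_eq[symmetric]) (auto simp: L2rel_def)

lemma inner_abs_L2:
  "u \<in> square_integrable \<Longrightarrow> v \<in> square_integrable \<Longrightarrow> abs_L2 u \<bullet> abs_L2 v = (LINT x|lebesgue. u x \<bullet> v x)"
  by (rule inner_L2.abs_eq) (auto simp: L2rel_def)

lemma norm_abs_L2:
  "u \<in> square_integrable \<Longrightarrow> norm (abs_L2 u) = sqrt (LINT x|lebesgue. (norm (u x))\<^sup>2)"
  by (simp add: norm_eq_sqrt_inner inner_abs_L2 power2_norm_eq_inner)

lemma power2_norm_abs_L2:
  "u \<in> square_integrable \<Longrightarrow> (norm (abs_L2 u))\<^sup>2 = (LINT x|lebesgue. (norm (u x))\<^sup>2)"
  by (simp add: norm_abs_L2)

lemma nn_integral_norm2: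
  assumes "u \<in> square_integrable"
  shows "(\<integral>\<^sup>+x. ennreal ((norm (u x))\<^sup>2) \<partial>lebesgue) = ennreal ((norm (abs_L2 u))\<^sup>2)"
  using assms by (simp add: nn_integral_eq_integral square_integrable_norm2 power2_norm_abs_L2)

text \<open>The Riesz-Fischer argument. The summable rate delivers convergence in norm and almost
  everywhere at once; the latter is what pointwise bounds and the nonlinearity need.\<close>

lemma L2_fast_Cauchy_converges:
  fixes X :: "nat \<Rightarrow> ('a::euclidean_space, 'b::euclidean_space) L2"
  assumes fast: "\<And>n m. n \<le> m \<Longrightarrow> norm (X m - X n) \<le> (1/2)^n"
  obtains V where "X \<longlonglongrightarrow> V" "AE x in lebesgue. (\<lambda>n. rep_L2 (X n) x) \<longlonglongrightarrow> rep_L2 V x"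
proof -
  define u where "u n = rep_L2 (X n)" for n
  have u: "u n \<in> square_integrable" and X: "X n = abs_L2 (u n)" for n
    by (simp_all add: u_def rep_L2_square_integrable abs_L2_rep)
  note u [measurable]
  have ud: "(\<lambda>x. u m x - u n x) \<in> square_integrable" "abs_L2 (\<lambda>x. u m x - u n x) = X m - X n" for m n
    by (auto simp: X u square_integrable_diff abs_L2_diff)
  define g where "g n x = norm (u (Suc n) x - u n x)" for n x
  have g: "g n \<in> square_integrable" and ng: "norm (abs_L2 (g n)) \<le> (1/2)^n" for n
  proof -
    show "g n \<in> square_integrable"
      unfolding g_def using square_integrable_norm[OF ud(1)] .
    then have "norm (abs_L2 (g n)) = norm (abs_L2 (\<lambda>x. u (Suc n) x - u n x))"
      using norm_abs_L2[OF ud(1)[of "Suc n" n]] by (simp add: norm_abs_L2 g_def)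
    then show "norm (abs_L2 (g n)) \<le> (1/2)^n"
      using fast[of n "Suc n"] by (simp add: ud)
  qed
  have S: "(\<lambda>x. \<Sum>n<N. g n x) \<in> square_integrable \<and> norm (abs_L2 (\<lambda>x. \<Sum>n<N. g n x)) \<le> (\<Sum>n<N. (1/2)^n)" for N
  proof (induction N)
    case 0
    have "abs_L2 (\<lambda>x::'a. 0::real) = 0" by (simp add: zero_L2.abs_eq)
    then show ?case by (simp add: square_integrable_zero)
  next
    case (Suc N)
    then show ?case
      using norm_triangle_ineq[of "abs_L2 (\<lambda>x. \<Sum>n<N. g n x)" "abs_L2 (g N)"] ng[of N]
      by (simp add: square_integrable_add g abs_L2_add)
  qed
  have geo: "(\<Sum>n<N. (1/2)^n) \<le> (2::real)" for N
    by (simp add: geometric_sum)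
  \<comment> \<open>By monotone convergence the series of the increments \<open>g n\<close> has
    squared norm at most \<open>2\<^sup>2 = 4\<close>, hence is finite almost everywhere, and the
    sequence \<open>u n x\<close> telescopes.\<close>
  have "(\<integral>\<^sup>+x. (SUP N. ennreal ((\<Sum>n<N. g n x)\<^sup>2)) \<partial>lebesgue) = (SUP N. \<integral>\<^sup>+x. ennreal ((\<Sum>n<N. g n x)\<^sup>2) \<partial>lebesgue)"
  proof (rule nn_integral_monotone_convergence_SUP)
    show "incseq (\<lambda>N x. ennreal ((\<Sum>n<N. g n x)\<^sup>2))"
      by (auto simp: incseq_def le_fun_def g_def intro!: power_mono sum_mono2 sum_nonneg ennreal_leI)
  qed (simp add: g_def)
  also have "\<dots> \<le> ennreal 4"
  proof (rule SUP_least)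
    fix N
    have "(norm (abs_L2 (\<lambda>x. \<Sum>n<N. g n x)))\<^sup>2 \<le> 2\<^sup>2"
      using S[of N] geo[of N] by (intro power_mono) auto
    then have "ennreal ((norm (abs_L2 (\<lambda>x. \<Sum>n<N. g n x)))\<^sup>2) \<le> ennreal 4"
      by (intro ennreal_leI) simp
    then show "(\<integral>\<^sup>+x. ennreal ((\<Sum>n<N. g n x)\<^sup>2) \<partial>lebesgue) \<le> ennreal 4"
      using nn_integral_norm2[of "\<lambda>x. \<Sum>n<N. g n x"] S[of N] by simp
  qed
  finally have "(\<integral>\<^sup>+x. (SUP N. ennreal ((\<Sum>n<N. g n x)\<^sup>2)) \<partial>lebesgue) \<noteq> \<infinity>"
    by (auto simp: top_unique)
  then have "AE x in lebesgue. (SUP N. ennreal ((\<Sum>n<N. g n x)\<^sup>2)) \<noteq> \<infinity>"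
    by (intro nn_integral_PInf_AE) (simp_all add: g_def)
  then have conv: "AE x in lebesgue. convergent (\<lambda>n. u n x)"
  proof eventually_elim
    fix x assume "(SUP N. ennreal ((\<Sum>n<N. g n x)\<^sup>2)) \<noteq> \<infinity>"
    then obtain B where B: "0 \<le> B" "(SUP N. ennreal ((\<Sum>n<N. g n x)\<^sup>2)) = ennreal B"
      by (cases "SUP N. ennreal ((\<Sum>n<N. g n x)\<^sup>2)") auto
    have "(\<Sum>n<N. g n x) \<le> sqrt B" for N
    proof -
      have "ennreal ((\<Sum>n<N. g n x)\<^sup>2) \<le> ennreal B"
        unfolding B(2)[symmetric] by (rule SUP_upper) simp
      then have "(\<Sum>n<N. g n x)\<^sup>2 \<le> B" using B(1) by (simp add: ennreal_le_iff)
      then show ?thesis using real_le_rsqrt by blast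
    qed
    then have "summable (\<lambda>n. g n x)"
      by (intro summableI_nonneg_bounded) (auto simp: g_def)
    then have "summable (\<lambda>n. u (Suc n) x - u n x)"
      unfolding g_def by (rule summable_norm_cancel)
    then have "convergent (\<lambda>N. \<Sum>n<N. u (Suc n) x - u n x)"
      by (simp add: summable_iff_convergent)
    then have "convergent (\<lambda>N. (\<Sum>n<N. u (Suc n) x - u n x) + u 0 x)"
      by (intro convergent_add convergent_const)
    then have "convergent (\<lambda>N. (u N x - u 0 x) + u 0 x)"
      unfolding sum_lessThan_telescope[of "\<lambda>n. u n x"] .
    then show "convergent (\<lambda>n. u n x)" by simp
  qed
  define v where "v x = lim (\<lambda>n. u n x)" for x
  have [measurable]: "v \<in> borel_measurable lebesgue"
    unfolding v_def by (rule borel_measurable_lim_metric) simp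
  have lim: "AE x in lebesgue. (\<lambda>n. u n x) \<longlonglongrightarrow> v x"
    using conv by eventually_elim (simp add: v_def convergent_LIMSEQ_iff)
  \<comment> \<open>Letting \<open>m\<close> tend to infinity in the bound for
    \<open>u m - u n\<close> gives both the square integrability of \<open>v\<close> and the rate of
    convergence.\<close>
  have Fatou: "(\<integral>\<^sup>+x. ennreal ((norm (v x - u n x))\<^sup>2) \<partial>lebesgue) \<le> ennreal (((1/2)^n)\<^sup>2)" for n
  proof -
    have "(\<integral>\<^sup>+x. ennreal ((norm (v x - u n x))\<^sup>2) \<partial>lebesgue)
        = (\<integral>\<^sup>+x. liminf (\<lambda>m. ennreal ((norm (u m x - u n x))\<^sup>2)) \<partial>lebesgue)"
    proof (rule nn_integral_cong_AE)
      show "AE x in lebesgue. ennreal ((norm (v x - u n x))\<^sup>2) = liminf (\<lambda>m. ennreal ((norm (u m x - u n x))\<^sup>2))"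
        using lim
      proof eventually_elim
        fix x assume "(\<lambda>n. u n x) \<longlonglongrightarrow> v x"
        then have "(\<lambda>m. ennreal ((norm (u m x - u n x))\<^sup>2)) \<longlonglongrightarrow> ennreal ((norm (v x - u n x))\<^sup>2)"
          by (intro tendsto_intros)
        then show "ennreal ((norm (v x - u n x))\<^sup>2) = liminf (\<lambda>m. ennreal ((norm (u m x - u n x))\<^sup>2))"
          using lim_imp_Liminf[OF sequentially_bot] by metis
      qed
    qed
    also have "\<dots> \<le> liminf (\<lambda>m. \<integral>\<^sup>+x. ennreal ((norm (u m x - u n x))\<^sup>2) \<partial>lebesgue)"
      by (rule nn_integral_liminf) simp
    also have "\<dots> \<le> ennreal (((1/2)^n)\<^sup>2)"
    proof -
      have "\<forall>\<^sub>F m in sequentially. (\<integral>\<^sup>+x. ennreal ((norm (u m x - u n x))\<^sup>2) \<partial>lebesgue) \<le> ennreal (((1/2)^n)\<^sup>2)"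
        using eventually_ge_at_top[of n]
      proof eventually_elim
        fix m assume "n \<le> m"
        then show "(\<integral>\<^sup>+x. ennreal ((norm (u m x - u n x))\<^sup>2) \<partial>lebesgue) \<le> ennreal (((1/2)^n)\<^sup>2)"
          using nn_integral_norm2[OF ud(1)[of m n]] fast by (auto simp: ud(2) intro!: ennreal_leI power_mono)
      qed
      from Liminf_mono[OF this] show ?thesis by (simp add: Liminf_const)
    qed
    finally show ?thesis .
  qed
  have vd: "(\<lambda>x. v x - u n x) \<in> square_integrable" for n
  proof (rule square_integrableI)
    show "integrable lebesgue (\<lambda>x. (norm (v x - u n x))\<^sup>2)"
      using Fatou[of n] by (intro integrableI_bounded) (auto simp: top_unique less_top[symmetric])
  qed measurable
  have v: "v \<in> square_integrable"
    using square_integrable_add[OF vd[of 0] u[of 0]] by simp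
  have "norm (X n - abs_L2 v) \<le> (1/2)^n" for n
  proof -
    have "ennreal ((norm (abs_L2 (\<lambda>x. v x - u n x)))\<^sup>2) \<le> ennreal (((1/2)^n)\<^sup>2)"
      using Fatou[of n] nn_integral_norm2[OF vd[of n]] by simp
    then have "(norm (abs_L2 (\<lambda>x. v x - u n x)))\<^sup>2 \<le> ((1/2)^n)\<^sup>2"
      by (simp add: ennreal_le_iff)
    then have "norm (abs_L2 (\<lambda>x. v x - u n x)) \<le> (1/2)^n"
      by (rule power2_le_imp_le) simp
    then show ?thesis using v u by (simp add: X abs_L2_diff norm_minus_commute)
  qed
  moreover have "(\<lambda>n. (1/2::real)^n) \<longlonglongrightarrow> 0"
    by (rule LIMSEQ_realpow_zero) auto
  ultimately have "(\<lambda>n. X n - abs_L2 v) \<longlonglongrightarrow> 0"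
    by (intro Lim_null_comparison[of "\<lambda>n. X n - abs_L2 v" "\<lambda>n. (1/2)^n"]) auto
  then have "X \<longlonglongrightarrow> abs_L2 v" by (simp add: LIM_zero_iff)
  moreover have "AE x in lebesgue. (\<lambda>n. rep_L2 (X n) x) \<longlonglongrightarrow> rep_L2 (abs_L2 v) x"
    using lim rep_abs_L2[OF v] by eventually_elim (simp add: u_def)
  ultimately show ?thesis using that by blast
qed

lemma Cauchy_fast_subsequence:
  fixes X :: "nat \<Rightarrow> 'a::real_normed_vector"
  assumes "Cauchy X"
  obtains r :: "nat \<Rightarrow> nat" where "strict_mono r" "\<And>n m. n \<le> m \<Longrightarrow> norm (X (r m) - X (r n)) \<le> (1/2)^n"
proof -
  have "\<exists>N. \<forall>m\<ge>N. \<forall>n\<ge>N. norm (X m - X n) < (1/2)^k" for k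
    using CauchyD[OF assms, of "(1/2)^k"] by simp
  then obtain N where N: "\<And>k m n. N k \<le> m \<Longrightarrow> N k \<le> n \<Longrightarrow> norm (X m - X n) < (1/2)^k"
    by metis
  \<comment> \<open>The sum dominates \<open>N n\<close>, and the summand \<open>n\<close> makes
    \<open>r\<close> strictly increasing.\<close>
  define r where "r n = n + (\<Sum>i\<le>n. N i)" for n
  have r: "strict_mono r" by (simp add: strict_mono_Suc_iff r_def)
  have "N n \<le> r n" for n by (simp add: r_def member_le_sum trans_le_add2)
  moreover have "r n \<le> r m" if "n \<le> m" for n m using r that by (simp add: strict_mono_less_eq)
  ultimately have "norm (X (r m) - X (r n)) \<le> (1/2)^n" if "n \<le> m" for n m
    using N[of n "r m" "r n"] that by (meson less_imp_le order_trans)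
  then show ?thesis using that r by blast
qed

instance L2 :: (euclidean_space, euclidean_space) complete_space
proof
  fix X :: "nat \<Rightarrow> ('a, 'b) L2" assume X: "Cauchy X"
  then obtain r where r: "strict_mono r" and fast: "\<And>n m. n \<le> m \<Longrightarrow> norm (X (r m) - X (r n)) \<le> (1/2)^n"
    by (rule Cauchy_fast_subsequence) blast
  obtain V where "(\<lambda>n. X (r n)) \<longlonglongrightarrow> V"
    by (rule L2_fast_Cauchy_converges[of "\<lambda>n. X (r n)", OF fast]) blast
  then have "X \<longlonglongrightarrow> V"
    using Cauchy_converges_subseq[OF X r] by (simp add: comp_def)
  then show "convergent X" by (auto simp: convergent_def)
qed

lemma L2_convergent_AE_subsequence:
  fixes X :: "nat \<Rightarrow> ('a::euclidean_space, 'b::euclidean_space) L2"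
  assumes X: "X \<longlonglongrightarrow> U"
  obtains r :: "nat \<Rightarrow> nat" where "strict_mono r" "AE x in lebesgue. (\<lambda>n. rep_L2 (X (r n)) x) \<longlonglongrightarrow> rep_L2 U x"
proof -
  have "Cauchy X" using X LIMSEQ_imp_Cauchy by blast
  then obtain r where r: "strict_mono r" and fast: "\<And>n m. n \<le> m \<Longrightarrow> norm (X (r m) - X (r n)) \<le> (1/2)^n"
    by (rule Cauchy_fast_subsequence) blast
  obtain V where V: "(\<lambda>n. X (r n)) \<longlonglongrightarrow> V" "AE x in lebesgue. (\<lambda>n. rep_L2 (X (r n)) x) \<longlonglongrightarrow> rep_L2 V x"
    by (rule L2_fast_Cauchy_converges[of "\<lambda>n. X (r n)", OF fast]) blast
  have "V = U"
    using LIMSEQ_unique[OF V(1)] LIMSEQ_subseq_LIMSEQ[OF X r] by (simp add: comp_def)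
  then show ?thesis using that[OF r] V(2) by simp
qed

text \<open>Norm convergence yields convergence almost everywhere only along subsequences; this
  principle recovers a statement about the full sequence.\<close>

lemma tendsto_if_subsequences_have_convergent_subsequences:
  fixes X :: "nat \<Rightarrow> 'a::topological_space"
  assumes "\<And>r :: nat \<Rightarrow> nat. strict_mono r \<Longrightarrow> \<exists>s :: nat \<Rightarrow> nat. strict_mono s \<and> (\<lambda>n. X (r (s n))) \<longlonglongrightarrow> l"
  shows "X \<longlonglongrightarrow> l"
proof (rule ccontr)
  assume "\<not> X \<longlonglongrightarrow> l"
  then obtain S where S: "open S" "l \<in> S" "\<not> (\<forall>\<^sub>F n in sequentially. X n \<in> S)"
    by (auto simp: tendsto_def)
  then have "infinite {n. X n \<notin> S}"
    by (simp add: eventually_sequentially infinite_nat_iff_unbounded_le)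
  then obtain r :: "nat \<Rightarrow> nat" where r: "strict_mono r" "\<And>n. X (r n) \<notin> S"
    using infinite_enumerate by (metis mem_Collect_eq)
  then obtain s :: "nat \<Rightarrow> nat" where "(\<lambda>n. X (r (s n))) \<longlonglongrightarrow> l" using assms by blast
  then have "\<forall>\<^sub>F n in sequentially. X (r (s n)) \<in> S" using S(1,2) by (simp add: tendsto_def)
  then show False using r(2) by (auto simp: eventually_sequentially)
qed

lemma L2_dominated_convergence:
  fixes U :: "nat \<Rightarrow> ('a::euclidean_space, 'b::euclidean_space) L2"
  assumes lim: "AE x in lebesgue. (\<lambda>n. rep_L2 (U n) x) \<longlonglongrightarrow> rep_L2 V x"
    and w: "w \<in> square_integrable" and bound: "\<And>n. AE x in lebesgue. norm (rep_L2 (U n) x) \<le> norm (w x)"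
  shows "U \<longlonglongrightarrow> V"
proof -
  note rep_L2_square_integrable [measurable] w [measurable]
  have bound': "AE x in lebesgue. norm (rep_L2 V x) \<le> norm (w x)"
  proof -
    have "AE x in lebesgue. \<forall>n. norm (rep_L2 (U n) x) \<le> norm (w x)"
      using bound by (simp add: AE_all_countable)
    with lim show ?thesis
    proof eventually_elim
      fix x assume "(\<lambda>n. rep_L2 (U n) x) \<longlonglongrightarrow> rep_L2 V x" "\<forall>n. norm (rep_L2 (U n) x) \<le> norm (w x)"
      then show "norm (rep_L2 V x) \<le> norm (w x)"
        by (intro LIMSEQ_le_const2[OF tendsto_norm]) auto
    qed
  qed
  have "(\<lambda>n. LINT x|lebesgue. (norm (rep_L2 (U n) x - rep_L2 V x))\<^sup>2) \<longlonglongrightarrow> integral\<^sup>L lebesgue (\<lambda>x::'a. 0::real)"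
  proof (rule integral_dominated_convergence)
    \<comment> \<open>Sequence and limit are both dominated by \<open>w\<close>, so their difference
      is at most \<open>2 * norm (w x)\<close>.\<close>
    show "integrable lebesgue (\<lambda>x. 4 * (norm (w x))\<^sup>2)"
      using square_integrable_norm2[OF w] by simp
    show "AE x in lebesgue. (\<lambda>n. (norm (rep_L2 (U n) x - rep_L2 V x))\<^sup>2) \<longlonglongrightarrow> 0"
      using lim
    proof eventually_elim
      fix x assume "(\<lambda>n. rep_L2 (U n) x) \<longlonglongrightarrow> rep_L2 V x"
      then have "(\<lambda>n. (norm (rep_L2 (U n) x - rep_L2 V x))\<^sup>2) \<longlonglongrightarrow> (norm (rep_L2 V x - rep_L2 V x))\<^sup>2"
        by (intro tendsto_intros)
      then show "(\<lambda>n. (norm (rep_L2 (U n) x - rep_L2 V x))\<^sup>2) \<longlonglongrightarrow> 0" by simp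
    qed
    show "AE x in lebesgue. norm ((norm (rep_L2 (U n) x - rep_L2 V x))\<^sup>2) \<le> 4 * (norm (w x))\<^sup>2" for n
      using bound[of n] bound'
    proof eventually_elim
      fix x assume "norm (rep_L2 (U n) x) \<le> norm (w x)" "norm (rep_L2 V x) \<le> norm (w x)"
      then have "norm (rep_L2 (U n) x - rep_L2 V x) \<le> 2 * norm (w x)"
        using norm_triangle_ineq4[of "rep_L2 (U n) x" "rep_L2 V x"] by simp
      then have "(norm (rep_L2 (U n) x - rep_L2 V x))\<^sup>2 \<le> (2 * norm (w x))\<^sup>2"
        by (rule power_mono) simp
      then show "norm ((norm (rep_L2 (U n) x - rep_L2 V x))\<^sup>2) \<le> 4 * (norm (w x))\<^sup>2"
        by (simp add: power_mult_distrib)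
    qed
  qed measurable
  then have "(\<lambda>n. sqrt (LINT x|lebesgue. (norm (rep_L2 (U n) x - rep_L2 V x))\<^sup>2)) \<longlonglongrightarrow> sqrt 0"
    by (intro tendsto_real_sqrt) simp
  moreover have "norm (U n - V) = sqrt (LINT x|lebesgue. (norm (rep_L2 (U n) x - rep_L2 V x))\<^sup>2)" for n
    using norm_abs_L2[OF square_integrable_diff[OF rep_L2_square_integrable rep_L2_square_integrable], of "U n" V]
    by (simp add: abs_L2_diff rep_L2_square_integrable abs_L2_rep)
  ultimately have "(\<lambda>n. U n - V) \<longlonglongrightarrow> 0"
    using tendsto_norm_zero_iff[of "\<lambda>n. U n - V" sequentially] by simp
  then show ?thesis by (simp add: LIM_zero_iff)
qed

section \<open>Restriction to a domain\<close>

definition restr :: "'a set \<Rightarrow> ('a \<Rightarrow> 'b::real_vector) \<Rightarrow> 'a \<Rightarrow> 'b" where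
  "restr \<Omega> u x = (if x \<in> \<Omega> then u x else 0)"

lemma restr_eq_indicator: "restr \<Omega> u = (\<lambda>x. indicator \<Omega> x *\<^sub>R u x)"
  by (auto simp: restr_def)

lemma restr_measurable_iff:
  fixes u :: "'a::euclidean_space \<Rightarrow> 'b::euclidean_space"
  assumes "\<Omega> \<in> sets lebesgue"
  shows "restr \<Omega> u \<in> borel_measurable lebesgue \<longleftrightarrow> u \<in> borel_measurable (lebesgue_on \<Omega>)"
  unfolding restr_eq_indicator using assms by (simp add: borel_measurable_restrict_space_iff)

lemma AE_lebesgue_on_iff:
  assumes "\<Omega> \<in> sets lebesgue"
  shows "(AE x in lebesgue_on \<Omega>. P x) \<longleftrightarrow> (AE x in lebesgue. x \<in> \<Omega> \<longrightarrow> P x)"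
  using assms by (simp add: AE_restrict_space_iff)

lemma integral_lebesgue_on:
  fixes u :: "'a::euclidean_space \<Rightarrow> 'b::euclidean_space"
  assumes "\<Omega> \<in> sets lebesgue"
  shows "(LINT x|lebesgue_on \<Omega>. u x) = (LINT x|lebesgue. restr \<Omega> u x)"
  unfolding restr_eq_indicator using assms by (simp add: integral_restrict_space)

lemma L2_space_iff:
  assumes "\<Omega> \<in> sets lebesgue"
  shows "u \<in> L2_space \<Omega> \<longleftrightarrow> restr \<Omega> u \<in> square_integrable"
proof -
  have "integrable (lebesgue_on \<Omega>) (\<lambda>x. (norm (u x))\<^sup>2) \<longleftrightarrow>
      integrable lebesgue (\<lambda>x. indicator \<Omega> x *\<^sub>R (norm (u x))\<^sup>2)"
    using assms by (simp add: integrable_restrict_space)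
  also have "(\<lambda>x. indicator \<Omega> x *\<^sub>R (norm (u x))\<^sup>2) = (\<lambda>x. (norm (restr \<Omega> u x))\<^sup>2)"
    by (auto simp: restr_def)
  finally show ?thesis
    using restr_measurable_iff[OF assms, of u] by (simp add: L2_space_def square_integrable_def)
qed

lemma restr_square_integrable:
  assumes "\<Omega> \<in> sets lebesgue" "u \<in> square_integrable"
  shows "restr \<Omega> u \<in> square_integrable"
proof (rule square_integrable_bound[OF assms(2)])
  show "restr \<Omega> u \<in> borel_measurable lebesgue"
    unfolding restr_eq_indicator using assms by measurable
qed (simp add: restr_def)

lemma power2_norm_L2: "(norm U)\<^sup>2 = (LINT x|lebesgue. (norm (rep_L2 U x))\<^sup>2)"
  using power2_norm_abs_L2[OF rep_L2_square_integrable, of U] by (simp add: abs_L2_rep)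

lemma rep_L2_add: "AE x in lebesgue. rep_L2 (U + V) x = rep_L2 U x + rep_L2 V x"
  using rep_abs_L2[OF square_integrable_add[OF rep_L2_square_integrable rep_L2_square_integrable], of U V]
  by (simp add: abs_L2_add rep_L2_square_integrable abs_L2_rep)

lemma rep_L2_scaleR: "AE x in lebesgue. rep_L2 (c *\<^sub>R U) x = c *\<^sub>R rep_L2 U x"
  using rep_abs_L2[OF square_integrable_scaleR[OF rep_L2_square_integrable], of c U]
  by (simp add: abs_L2_scaleR rep_L2_square_integrable abs_L2_rep)

text \<open>Cutting off the irrelevant values outside \<Omega> embeds L2 of \<Omega> isometrically
  into L2 of the whole space. The image consists of the \<open>U\<close> with
  \<open>emb \<Omega> (rep_L2 U) = U\<close>.\<close>

definition emb :: "(real^3) set \<Rightarrow> (real^3 \<Rightarrow> 'b::euclidean_space) \<Rightarrow> (real^3, 'b) L2" where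
  "emb \<Omega> u = abs_L2 (restr \<Omega> u)"

lemma square_integrable_L2_space:
  "\<Omega> \<in> sets lebesgue \<Longrightarrow> u \<in> square_integrable \<Longrightarrow> u \<in> L2_space \<Omega>"
  by (simp add: L2_space_iff restr_square_integrable)

lemma restr_add: "restr \<Omega> (\<lambda>x. u x + v x) = (\<lambda>x. restr \<Omega> u x + restr \<Omega> v x)"
  by (auto simp: restr_def)

lemma restr_diff: "restr \<Omega> (\<lambda>x. u x - v x) = (\<lambda>x. restr \<Omega> u x - restr \<Omega> v x)"
  by (auto simp: restr_def)

lemma restr_scaleR: "restr \<Omega> (\<lambda>x. c *\<^sub>R u x) = (\<lambda>x. c *\<^sub>R restr \<Omega> u x)"
  by (auto simp: restr_def)

context
  fixes \<Omega> :: "(real^3) set"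
  assumes meas: "\<Omega> \<in> sets lebesgue"
begin

lemma L2_space_add: "u \<in> L2_space \<Omega> \<Longrightarrow> v \<in> L2_space \<Omega> \<Longrightarrow> (\<lambda>x. u x + v x) \<in> L2_space \<Omega>"
  by (simp add: L2_space_iff[OF meas] restr_add square_integrable_add)

lemma L2_space_diff: "u \<in> L2_space \<Omega> \<Longrightarrow> v \<in> L2_space \<Omega> \<Longrightarrow> (\<lambda>x. u x - v x) \<in> L2_space \<Omega>"
  by (simp add: L2_space_iff[OF meas] restr_diff square_integrable_diff)

lemma L2_space_bounded_linear:
  assumes "bounded_linear L" "u \<in> L2_space \<Omega>"
  shows "(\<lambda>x. L (u x)) \<in> L2_space \<Omega>"
proof -
  interpret bounded_linear L by fact
  have "restr \<Omega> (\<lambda>x. L (u x)) = (\<lambda>x. L (restr \<Omega> u x))" by (auto simp: restr_def zero)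
  then show ?thesis
    using assms by (simp add: L2_space_iff[OF meas] square_integrable_bounded_linear)
qed

lemma L2_space_scaleR: "u \<in> L2_space \<Omega> \<Longrightarrow> (\<lambda>x. c *\<^sub>R u x) \<in> L2_space \<Omega>"
  by (rule L2_space_bounded_linear[OF bounded_linear_scaleR_right])

lemma emb_add: "u \<in> L2_space \<Omega> \<Longrightarrow> v \<in> L2_space \<Omega> \<Longrightarrow> emb \<Omega> (\<lambda>x. u x + v x) = emb \<Omega> u + emb \<Omega> v"
  by (simp add: emb_def L2_space_iff[OF meas] restr_add abs_L2_add)

lemma emb_diff: "u \<in> L2_space \<Omega> \<Longrightarrow> v \<in> L2_space \<Omega> \<Longrightarrow> emb \<Omega> (\<lambda>x. u x - v x) = emb \<Omega> u - emb \<Omega> v"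
  by (simp add: emb_def L2_space_iff[OF meas] restr_diff abs_L2_diff)

lemma emb_scaleR: "u \<in> L2_space \<Omega> \<Longrightarrow> emb \<Omega> (\<lambda>x. c *\<^sub>R u x) = c *\<^sub>R emb \<Omega> u"
  by (simp add: emb_def L2_space_iff[OF meas] restr_scaleR abs_L2_scaleR)

lemma emb_eq_iff:
  "u \<in> L2_space \<Omega> \<Longrightarrow> v \<in> L2_space \<Omega> \<Longrightarrow> emb \<Omega> u = emb \<Omega> v \<longleftrightarrow> L2_eq \<Omega> u v"
  by (simp add: emb_def L2_space_iff[OF meas] abs_L2_eq_iff L2_eq_def AE_lebesgue_on_iff[OF meas] restr_def if_split_eq1
      cong: AE_cong)

lemma rep_emb:
  assumes "u \<in> L2_space \<Omega>"
  shows "AE x in lebesgue. rep_L2 (emb \<Omega> u) x = restr \<Omega> u x"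
  using assms by (simp add: emb_def L2_space_iff[OF meas] rep_abs_L2)

lemma emb_rep_emb: "u \<in> L2_space \<Omega> \<Longrightarrow> emb \<Omega> (rep_L2 (emb \<Omega> u)) = emb \<Omega> u"
  using rep_emb[of u]
  by (subst emb_eq_iff)
     (auto simp: L2_eq_def AE_lebesgue_on_iff[OF meas] restr_def rep_L2_square_integrable
        square_integrable_L2_space[OF meas] elim: eventually_mono)

lemma rep_L2_space: "rep_L2 U \<in> L2_space \<Omega>"
  by (simp add: rep_L2_square_integrable square_integrable_L2_space[OF meas])

lemma inner_emb:
  assumes "u \<in> L2_space \<Omega>" "v \<in> L2_space \<Omega>"
  shows "emb \<Omega> u \<bullet> emb \<Omega> v = (LINT x|lebesgue_on \<Omega>. u x \<bullet> v x)"
proof -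
  have "restr \<Omega> (\<lambda>x. u x \<bullet> v x) = (\<lambda>x. restr \<Omega> u x \<bullet> restr \<Omega> v x)" by (auto simp: restr_def)
  then show ?thesis
    using assms by (simp add: emb_def L2_space_iff[OF meas] inner_abs_L2 integral_lebesgue_on[OF meas])
qed

lemma norm_emb: "u \<in> L2_space \<Omega> \<Longrightarrow> norm (emb \<Omega> u) = L2_norm \<Omega> u"
  by (simp add: norm_eq_sqrt_inner[of "emb \<Omega> u"] inner_emb L2_norm_def power2_norm_eq_inner)

lemma norm_emb_rep_le: "norm (emb \<Omega> (rep_L2 U)) \<le> norm U"
proof -
  have "(norm (emb \<Omega> (rep_L2 U)))\<^sup>2 \<le> (norm U)\<^sup>2"
    unfolding emb_def power2_norm_abs_L2[OF restr_square_integrable[OF meas rep_L2_square_integrable]] power2_norm_L2[of U]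
    using rep_L2_square_integrable
    by (intro integral_mono square_integrable_norm2 restr_square_integrable meas)
       (auto simp: restr_def)
  then show ?thesis by (rule power2_le_imp_le) simp
qed

lemma L2_eq_rep_add: "L2_eq \<Omega> (rep_L2 (U + V)) (\<lambda>x. rep_L2 U x + rep_L2 V x)"
  using rep_L2_add[of U V] by (auto simp: L2_eq_def AE_lebesgue_on_iff[OF meas] elim: eventually_mono)

lemma L2_eq_rep_scaleR: "L2_eq \<Omega> (rep_L2 (c *\<^sub>R U)) (\<lambda>x. c *\<^sub>R rep_L2 U x)"
  using rep_L2_scaleR[of c U] by (auto simp: L2_eq_def AE_lebesgue_on_iff[OF meas] elim: eventually_mono)

text \<open>This is the orthogonal projection onto the functions vanishing outside \<Omega>; its
  continuity carries that property over to limits.\<close>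

lemma bounded_linear_emb_rep:
  "bounded_linear (\<lambda>U :: (real^3, 'b::euclidean_space) L2. emb \<Omega> (rep_L2 U))"
proof (rule bounded_linear_intro)
  fix U V :: "(real^3, 'b) L2" and c
  have "emb \<Omega> (rep_L2 (U + V)) = emb \<Omega> (\<lambda>x. rep_L2 U x + rep_L2 V x)"
    by (subst emb_eq_iff) (auto intro!: L2_space_add rep_L2_space L2_eq_rep_add)
  then show "emb \<Omega> (rep_L2 (U + V)) = emb \<Omega> (rep_L2 U) + emb \<Omega> (rep_L2 V)"
    by (simp add: emb_add rep_L2_space)
  have "emb \<Omega> (rep_L2 (c *\<^sub>R U)) = emb \<Omega> (\<lambda>x. c *\<^sub>R rep_L2 U x)"
    by (subst emb_eq_iff) (auto intro!: L2_space_scaleR rep_L2_space L2_eq_rep_scaleR)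
  then show "emb \<Omega> (rep_L2 (c *\<^sub>R U)) = c *\<^sub>R emb \<Omega> (rep_L2 U)"
    by (simp add: emb_scaleR rep_L2_space)
  show "norm (emb \<Omega> (rep_L2 U)) \<le> norm U * 1" using norm_emb_rep_le by simp
qed

end

section \<open>Convolution\<close>

lemma
  fixes x :: "'a::euclidean_space"
  shows measurable_reflect: "(\<lambda>y. x - y) \<in> lebesgue \<rightarrow>\<^sub>M lebesgue"
    and distr_reflect: "distr lebesgue lebesgue (\<lambda>y. x - y) = lebesgue"
proof -
  \<comment> \<open>The reflection is written as an affine map with all diagonal entries
    \<open>-1\<close>, whose determinant has modulus 1.\<close>
  have T: "(\<lambda>y. x + (\<Sum>j\<in>Basis. (- 1 * (y \<bullet> j)) *\<^sub>R j)) = (\<lambda>y. x - y)"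
    by (simp add: sum_negf euclidean_representation)
  show "(\<lambda>y. x - y) \<in> lebesgue \<rightarrow>\<^sub>M lebesgue"
    using lebesgue_affine_measurable[of "\<lambda>_. - 1" x] unfolding T by simp
  show "distr lebesgue lebesgue (\<lambda>y. x - y) = lebesgue"
    using lebesgue_affine_euclidean[of "\<lambda>_. - 1" x] unfolding T by (simp add: density_1)
qed

lemma AE_reflect:
  fixes x :: "'a::euclidean_space"
  assumes "AE y in lebesgue. P y"
  shows "AE y in lebesgue. P (x - y)"
proof -
  obtain N where N: "\<And>y. y \<in> space lebesgue - N \<Longrightarrow> P y" "N \<in> null_sets lebesgue"
    by (rule AE_E3[OF assms]) blast
  have "AE y in distr lebesgue lebesgue (\<lambda>y. x - y). y \<notin> N"
    unfolding distr_reflect using N(2) by (rule AE_not_in)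
  then have "AE y in lebesgue. x - y \<notin> N"
    by (rule AE_distrD[OF measurable_reflect])
  then show ?thesis using N(1) by (auto elim: eventually_mono)
qed

lemma integral_reflect:
  fixes u :: "'a::euclidean_space \<Rightarrow> 'b::euclidean_space"
  assumes "u \<in> borel_measurable lebesgue"
  shows "(LINT y|lebesgue. u (x - y)) = (LINT y|lebesgue. u y)"
  using integral_distr[OF measurable_reflect[of x] assms] by (simp add: distr_reflect)

lemma square_integrable_reflect:
  fixes u :: "'a::euclidean_space \<Rightarrow> 'b::euclidean_space"
  assumes u: "u \<in> square_integrable"
  shows "(\<lambda>y. u (x - y)) \<in> square_integrable"
proof (rule square_integrableI)
  have [measurable]: "u \<in> borel_measurable lebesgue" using u by (rule square_integrable_measurable)
  show "(\<lambda>y. u (x - y)) \<in> borel_measurable lebesgue"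
    by (rule measurable_compose[OF measurable_reflect]) simp
  have "integrable (distr lebesgue lebesgue (\<lambda>y. x - y)) (\<lambda>y. (norm (u y))\<^sup>2)"
    unfolding distr_reflect by (rule square_integrable_norm2[OF u])
  then show "integrable lebesgue (\<lambda>y. (norm (u (x - y)))\<^sup>2)"
    by (subst (asm) integrable_distr_eq[OF measurable_reflect]) auto
qed

text \<open>The integrand of a convolution must be measurable in both variables jointly. For Borel
  functions this is immediate from composition, so Lebesgue measurable ones are first changed on a
  null set.\<close>

lemma lebesgue_measurable_ex_borel:
  fixes u :: "'a::euclidean_space \<Rightarrow> 'b::euclidean_space"
  assumes "u \<in> borel_measurable lebesgue"
  obtains v where "v \<in> borel_measurable borel" "AE x in lebesgue. u x = v x"
proof -
  have "\<exists>v\<in>borel_measurable lborel. AE x in lborel. u x \<bullet> b = v x" for b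
    using assms by (intro completion_ex_borel_measurable_real) simp
  then obtain v where v: "\<And>b. v b \<in> borel_measurable lborel" "\<And>b. AE x in lborel. u x \<bullet> b = v b x"
    by metis
  have "AE x in lebesgue. \<forall>b\<in>Basis. u x \<bullet> b = v b x"
    using v(2) by (intro AE_finite_allI finite_Basis AE_completion)
  then have "AE x in lebesgue. u x = (\<Sum>b\<in>Basis. v b x *\<^sub>R b)"
  proof eventually_elim
    fix x assume "\<forall>b\<in>Basis. u x \<bullet> b = v b x"
    then have "(\<Sum>b\<in>Basis. v b x *\<^sub>R b) = (\<Sum>b\<in>Basis. (u x \<bullet> b) *\<^sub>R b)" by simp
    then show "u x = (\<Sum>b\<in>Basis. v b x *\<^sub>R b)" by (simp add: euclidean_representation)
  qed
  moreover have "(\<lambda>x. \<Sum>b\<in>Basis. v b x *\<^sub>R b) \<in> borel_measurable borel"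
    using v(1) by simp
  ultimately show ?thesis using that by blast
qed

lemma norm_vector_smult: "norm (c *s v) = norm c * norm (v :: complex^'n)"
  by (simp add: norm_vec_def norm_mult L2_set_right_distrib)

lemma bounded_bilinear_smult: "bounded_bilinear (\<lambda>c (v :: complex^'n). c *s v)"
proof
  fix r :: real and c :: complex and v :: "complex^'n"
  show "(r *\<^sub>R c) *s v = r *\<^sub>R (c *s v)" "c *s (r *\<^sub>R v) = r *\<^sub>R (c *s v)"
    by (simp_all add: vec_eq_iff)
  show "\<exists>K. \<forall>c (v :: complex^'n). norm (c *s v) \<le> norm c * norm v * K"
    by (rule exI[of _ 1]) (simp add: norm_vector_smult)
qed (simp_all add: vec_eq_iff algebra_simps)

lemma borel_measurable_smult [measurable]:
  fixes h :: "'a \<Rightarrow> complex^'n"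
  assumes [measurable]: "\<phi> \<in> borel_measurable M" "h \<in> borel_measurable M"
  shows "(\<lambda>x. \<phi> x *s h x) \<in> borel_measurable M"
proof (rule borel_measurable_continuous_Pair[of \<phi> M h "\<lambda>c v. c *s v"])
  show "continuous_on UNIV (\<lambda>x. fst x *s (snd x :: complex^'n))"
    by (intro bounded_bilinear.continuous_on[OF bounded_bilinear_smult] continuous_intros)
qed (use assms in auto)

text \<open>The Hermitian product with its conjugated entry in the second argument. It is made so
  that the scalar factor in \<open>(c *s v) \<bullet> b\<close> can be isolated as
  \<open>c \<bullet> cdot b v\<close>.\<close>

definition cdot :: "complex^'n \<Rightarrow> complex^'n \<Rightarrow> complex" where
  "cdot b v = (\<Sum>i\<in>UNIV. cnj (v $ i) * b $ i)"

lemma inner_smult_cdot: "(c *s v) \<bullet> b = c \<bullet> cdot b v"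
proof -
  have "(c * v $ i) \<bullet> b $ i = c \<bullet> (cnj (v $ i) * b $ i)" for i
    by (simp add: inner_complex_def algebra_simps)
  then show ?thesis by (simp add: cdot_def inner_vec_def inner_sum_right)
qed

lemma bounded_linear_cdot: "bounded_linear (cdot b :: complex^'n \<Rightarrow> complex)"
  unfolding cdot_def
  by (intro bounded_linear_sum bounded_linear_mult_const bounded_linear_compose[OF bounded_linear_cnj] bounded_linear_vec_nth)

context
  fixes \<Omega> :: "(real^3) set"
  assumes meas: "\<Omega> \<in> sets lebesgue"
begin

lemma convolve_eq: "convolve \<Omega> \<phi> h x = (LINT y|lebesgue. \<phi> (x - y) *s restr \<Omega> h y)"
proof -
  have "restr \<Omega> (\<lambda>y. \<phi> (x - y) *s h y) = (\<lambda>y. \<phi> (x - y) *s restr \<Omega> h y)"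
    by (auto simp: restr_def)
  then show ?thesis unfolding convolve_def by (simp add: integral_lebesgue_on[OF meas])
qed

lemma convolve_cong_AE:
  assumes "\<phi> \<in> borel_measurable lebesgue" "\<phi>' \<in> borel_measurable lebesgue" "AE x in lebesgue. \<phi> x = \<phi>' x"
    and "restr \<Omega> h \<in> borel_measurable lebesgue" "restr \<Omega> h' \<in> borel_measurable lebesgue"
    and "AE x in lebesgue. restr \<Omega> h x = restr \<Omega> h' x"
  shows "convolve \<Omega> \<phi> h x = convolve \<Omega> \<phi>' h' x"
  unfolding convolve_eq
proof (rule integral_cong_AE)
  have [measurable]: "(\<lambda>y. \<phi> (x - y)) \<in> borel_measurable lebesgue" "(\<lambda>y. \<phi>' (x - y)) \<in> borel_measurable lebesgue"
    using assms by (auto intro: measurable_compose[OF measurable_reflect])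
  note assms(4,5)[measurable]
  show "(\<lambda>y. \<phi> (x - y) *s restr \<Omega> h y) \<in> borel_measurable lebesgue"
    "(\<lambda>y. \<phi>' (x - y) *s restr \<Omega> h' y) \<in> borel_measurable lebesgue" by measurable
  show "AE y in lebesgue. \<phi> (x - y) *s restr \<Omega> h y = \<phi>' (x - y) *s restr \<Omega> h' y"
    using AE_reflect[OF assms(3), of x] assms(6) by eventually_elim simp
qed

text \<open>Kernel and field are replaced by Borel versions. Reflections preserve null sets, so the
  integral is unchanged for every \<open>x\<close>, and the parameter integral of a jointly Borel
  function is Borel.\<close>

lemma convolve_measurable:
  assumes "\<phi> \<in> borel_measurable lebesgue" "restr \<Omega> h \<in> borel_measurable lebesgue"
  shows "convolve \<Omega> \<phi> h \<in> borel_measurable lebesgue"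
proof -
  obtain \<psi> where [measurable]: "\<psi> \<in> borel_measurable borel" and \<psi>: "AE x in lebesgue. \<phi> x = \<psi> x"
    by (rule lebesgue_measurable_ex_borel[OF assms(1)]) blast
  obtain k where [measurable]: "k \<in> borel_measurable borel" and k: "AE x in lebesgue. restr \<Omega> h x = k x"
    by (rule lebesgue_measurable_ex_borel[OF assms(2)]) blast
  have "convolve \<Omega> \<phi> h x = (LINT y|lborel. \<psi> (x - y) *s k y)" for x
  proof -
    note assms[measurable]
    have [measurable]: "(\<lambda>y. \<phi> (x - y)) \<in> borel_measurable lebesgue"
      using assms by (auto intro: measurable_compose[OF measurable_reflect])
    have [measurable]: "(\<lambda>y. \<psi> (x - y) *s k y) \<in> borel_measurable lborel" by simp
    have "(LINT y|lebesgue. \<phi> (x - y) *s restr \<Omega> h y) = (LINT y|lebesgue. \<psi> (x - y) *s k y)"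
    proof (rule integral_cong_AE)
      show "AE y in lebesgue. \<phi> (x - y) *s restr \<Omega> h y = \<psi> (x - y) *s k y"
        using AE_reflect[OF \<psi>, of x] k by eventually_elim simp
      show "(\<lambda>y. \<psi> (x - y) *s k y) \<in> borel_measurable lebesgue"
        by (rule measurable_completion) simp
    qed measurable
    also have "\<dots> = (LINT y|lborel. \<psi> (x - y) *s k y)"
      by (rule integral_completion) simp
    finally show ?thesis by (simp add: convolve_eq)
  qed
  then have "convolve \<Omega> \<phi> h = (\<lambda>x. LINT y|lborel. \<psi> (x - y) *s k y)" by auto
  moreover have "(\<lambda>x. LINT y|lborel. \<psi> (x - y) *s k y) \<in> borel_measurable lborel"
    by (rule lborel.borel_measurable_lebesgue_integral) simp
  ultimately show ?thesis using measurable_completion by metis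
qed

lemma convolve_integrable:
  fixes \<phi> :: "real^3 \<Rightarrow> complex" and h :: "real^3 \<Rightarrow> complex^3"
  assumes "\<phi> \<in> square_integrable" "h \<in> L2_space \<Omega>"
  shows "integrable lebesgue (\<lambda>y. \<phi> (x - y) *s restr \<Omega> h y)"
proof (rule Bochner_Integration.integrable_bound)
  have s: "(\<lambda>y. \<phi> (x - y)) \<in> square_integrable" "restr \<Omega> h \<in> square_integrable"
    using assms by (auto simp: square_integrable_reflect L2_space_iff[OF meas])
  show "integrable lebesgue (\<lambda>y. norm (\<phi> (x - y)) * norm (restr \<Omega> h y))"
    by (rule integrable_norm_mult[OF s])
  show "(\<lambda>y. \<phi> (x - y) *s restr \<Omega> h y) \<in> borel_measurable lebesgue"
    using borel_measurable_smult[OF s[THEN square_integrable_measurable]] .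
qed (simp add: norm_vector_smult)

text \<open>Each real component of the convolution at a fixed point is an inner product of the
  kernel with a fixed function. Thus weak convergence of kernels means pointwise convergence of
  convolutions, at every \<open>x\<close>.\<close>

lemma inner_convolve:
  assumes \<phi>: "\<phi> \<in> square_integrable" and h: "h \<in> L2_space \<Omega>"
  shows "convolve \<Omega> \<phi> h x \<bullet> b = abs_L2 \<phi> \<bullet> abs_L2 (\<lambda>z. cdot b (restr \<Omega> h (x - z)))"
proof -
  have s: "(\<lambda>z. cdot b (restr \<Omega> h (x - z))) \<in> square_integrable"
    using h by (intro square_integrable_bounded_linear[OF bounded_linear_cdot] square_integrable_reflect)
      (simp add: L2_space_iff[OF meas])
  have "convolve \<Omega> \<phi> h x \<bullet> b = (LINT y|lebesgue. (\<phi> (x - y) *s restr \<Omega> h y) \<bullet> b)"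
    unfolding convolve_eq by (rule integral_inner_left[symmetric]) (intro convolve_integrable \<phi> h)
  \<comment> \<open>Writing \<open>y\<close> as \<open>x - (x - y)\<close> makes the whole integrand
    a function of \<open>x - y\<close>, to which \<open>integral_reflect\<close> applies.\<close>
  also have "\<dots> = (LINT y|lebesgue. \<phi> (x - y) \<bullet> cdot b (restr \<Omega> h (x - (x - y))))"
    by (simp add: inner_smult_cdot)
  also have "\<dots> = (LINT z|lebesgue. \<phi> z \<bullet> cdot b (restr \<Omega> h (x - z)))"
    by (rule integral_reflect[of "\<lambda>z. \<phi> z \<bullet> cdot b (restr \<Omega> h (x - z))"])
       (use integrable_inner[OF \<phi> s] in simp)
  finally show ?thesis by (simp add: inner_abs_L2[OF \<phi> s])
qed

end

section \<open>The convolution operator with bounded kernels\<close>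

text \<open>The bound is in the supremum norm because that is what controls the convolution; the
  finite measure of \<Omega> turns it into boundedness in L2.\<close>

definition kernels :: "(real^3) set \<Rightarrow> real \<Rightarrow> (real^3, complex) L2 set" where
  "kernels \<Omega> M = {\<Phi>. AE x in lebesgue. norm (rep_L2 \<Phi> x) \<le> M * indicator \<Omega> x}"

definition conv_op :: "(real^3) set \<Rightarrow> (real^3, complex) L2 \<Rightarrow> (real^3, complex^3) L2 \<Rightarrow> (real^3, complex^3) L2" where
  "conv_op \<Omega> \<Phi> H = emb \<Omega> (convolve \<Omega> (rep_L2 \<Phi>) (rep_L2 H))"

context
  fixes \<Omega> :: "(real^3) set" and M :: real
  assumes lm: "\<Omega> \<in> lmeasurable" and M: "0 \<le> M"
begin

lemma domain_measurable: "\<Omega> \<in> sets lebesgue"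
  using lm by auto

lemma const_indicator_square_integrable: "(\<lambda>x. c * indicator \<Omega> x :: real) \<in> square_integrable"
proof (rule square_integrableI)
  show "(\<lambda>x. c * indicator \<Omega> x) \<in> borel_measurable lebesgue" using domain_measurable by simp
  have "(\<lambda>x. (norm (c * indicator \<Omega> x))\<^sup>2) = (\<lambda>x. c\<^sup>2 * indicator \<Omega> x)"
    by (auto simp: indicator_def)
  moreover have "integrable lebesgue (indicator \<Omega> :: _ \<Rightarrow> real)"
    using lm by (simp only: lmeasurable_iff_integrable)
  ultimately show "integrable lebesgue (\<lambda>x. (norm (c * indicator \<Omega> x :: real))\<^sup>2)"
    by simp
qed

lemma norm_const_indicator:
  assumes "0 \<le> c"
  shows "norm (abs_L2 (\<lambda>x. c * indicator \<Omega> x :: real)) = c * sqrt (measure lebesgue \<Omega>)"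
proof -
  have "(\<lambda>x. (norm (c * indicator \<Omega> x :: real))\<^sup>2) = (\<lambda>x. c\<^sup>2 * indicator \<Omega> x)"
    by (auto simp: indicator_def)
  then have "norm (abs_L2 (\<lambda>x. c * indicator \<Omega> x :: real)) = sqrt (c\<^sup>2 * measure lebesgue \<Omega>)"
    using domain_measurable by (simp add: norm_abs_L2[OF const_indicator_square_integrable])
  then show ?thesis using assms by (simp add: real_sqrt_mult)
qed

lemma norm_L2_le_if_bounded:
  fixes U :: "(real^3, 'b::euclidean_space) L2"
  assumes "0 \<le> c" "AE x in lebesgue. norm (rep_L2 U x) \<le> c * indicator \<Omega> x"
  shows "norm U \<le> c * sqrt (measure lebesgue \<Omega>)"
proof -
  have "(norm U)\<^sup>2 \<le> (norm (abs_L2 (\<lambda>x. c * indicator \<Omega> x :: real)))\<^sup>2"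
    unfolding power2_norm_abs_L2[OF const_indicator_square_integrable] power2_norm_L2[of U]
  proof (intro integral_mono_AE square_integrable_norm2 rep_L2_square_integrable const_indicator_square_integrable)
    show "AE x in lebesgue. (norm (rep_L2 U x))\<^sup>2 \<le> (norm (c * indicator \<Omega> x :: real))\<^sup>2"
      using assms(2) by eventually_elim (auto intro!: power_mono)
  qed
  then have "norm U \<le> norm (abs_L2 (\<lambda>x. c * indicator \<Omega> x :: real))"
    by (rule power2_le_imp_le) simp
  then show ?thesis using norm_const_indicator[OF assms(1)] by simp
qed

lemma kernels_convex: "convex (kernels \<Omega> M)"
proof (rule convexI)
  fix \<Phi> \<Psi> :: "(real^3, complex) L2" and s t :: real
  assume K: "\<Phi> \<in> kernels \<Omega> M" "\<Psi> \<in> kernels \<Omega> M" and st: "0 \<le> s" "0 \<le> t" "s + t = 1"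
  have "s *\<^sub>R \<Phi> + t *\<^sub>R \<Psi> = abs_L2 (\<lambda>x. s *\<^sub>R rep_L2 \<Phi> x + t *\<^sub>R rep_L2 \<Psi> x)"
    by (simp add: abs_L2_add square_integrable_scaleR rep_L2_square_integrable abs_L2_scaleR abs_L2_rep)
  then have "AE x in lebesgue. rep_L2 (s *\<^sub>R \<Phi> + t *\<^sub>R \<Psi>) x = s *\<^sub>R rep_L2 \<Phi> x + t *\<^sub>R rep_L2 \<Psi> x"
    by (simp add: rep_abs_L2 square_integrable_add square_integrable_scaleR rep_L2_square_integrable)
  moreover have "AE x in lebesgue. norm (rep_L2 \<Phi> x) \<le> M * indicator \<Omega> x" "AE x in lebesgue. norm (rep_L2 \<Psi> x) \<le> M * indicator \<Omega> x"
    using K by (auto simp: kernels_def)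
  ultimately have "AE x in lebesgue. norm (rep_L2 (s *\<^sub>R \<Phi> + t *\<^sub>R \<Psi>) x) \<le> M * indicator \<Omega> x"
  proof eventually_elim
    fix x assume eq: "rep_L2 (s *\<^sub>R \<Phi> + t *\<^sub>R \<Psi>) x = s *\<^sub>R rep_L2 \<Phi> x + t *\<^sub>R rep_L2 \<Psi> x"
      and le: "norm (rep_L2 \<Phi> x) \<le> M * indicator \<Omega> x" "norm (rep_L2 \<Psi> x) \<le> M * indicator \<Omega> x"
    have "norm (rep_L2 (s *\<^sub>R \<Phi> + t *\<^sub>R \<Psi>) x) \<le> s * norm (rep_L2 \<Phi> x) + t * norm (rep_L2 \<Psi> x)"
      unfolding eq using norm_triangle_ineq[of "s *\<^sub>R rep_L2 \<Phi> x" "t *\<^sub>R rep_L2 \<Psi> x"] st by simp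
    also have "\<dots> \<le> s * (M * indicator \<Omega> x) + t * (M * indicator \<Omega> x)"
      using st le by (intro add_mono mult_left_mono) auto
    also have "\<dots> = M * indicator \<Omega> x"
      using st(3) by (simp flip: distrib_right)
    finally show "norm (rep_L2 (s *\<^sub>R \<Phi> + t *\<^sub>R \<Psi>) x) \<le> M * indicator \<Omega> x" .
  qed
  then show "s *\<^sub>R \<Phi> + t *\<^sub>R \<Psi> \<in> kernels \<Omega> M" by (simp add: kernels_def)
qed

text \<open>A norm limit is an almost everywhere limit along a subsequence, and the defining bound
  is pointwise.\<close>

lemma kernels_closed: "closed (kernels \<Omega> M)"
  unfolding closed_sequential_limits
proof safe
  fix X \<Phi> assume X: "\<forall>n. X n \<in> kernels \<Omega> M" and "X \<longlonglongrightarrow> \<Phi>"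
  then obtain r where r: "AE x in lebesgue. (\<lambda>n. rep_L2 (X (r n)) x) \<longlonglongrightarrow> rep_L2 \<Phi> x"
    by (auto elim: L2_convergent_AE_subsequence)
  have "AE x in lebesgue. \<forall>n. norm (rep_L2 (X (r n)) x) \<le> M * indicator \<Omega> x"
    using X by (simp add: AE_all_countable kernels_def)
  with r have "AE x in lebesgue. norm (rep_L2 \<Phi> x) \<le> M * indicator \<Omega> x"
  proof eventually_elim
    fix x assume "(\<lambda>n. rep_L2 (X (r n)) x) \<longlonglongrightarrow> rep_L2 \<Phi> x" "\<forall>n. norm (rep_L2 (X (r n)) x) \<le> M * indicator \<Omega> x"
    then show "norm (rep_L2 \<Phi> x) \<le> M * indicator \<Omega> x"
      by (intro LIMSEQ_le_const2[OF tendsto_norm]) auto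
  qed
  then show "\<Phi> \<in> kernels \<Omega> M" by (simp add: kernels_def)
qed

lemma kernels_bounded: "bounded (kernels \<Omega> M)"
  unfolding bounded_iff using norm_L2_le_if_bounded[OF M] by (auto simp: kernels_def)

lemma kernels_zero: "0 \<in> kernels \<Omega> M"
proof -
  have eq: "0 = abs_L2 (\<lambda>x::real^3. 0::complex)" by (simp add: zero_L2.abs_eq)
  have "AE x in lebesgue. rep_L2 (0 :: (real^3, complex) L2) x = 0"
    by (subst eq) (rule rep_abs_L2[OF square_integrable_zero])
  then show ?thesis using M by (auto simp: kernels_def elim: eventually_mono)
qed

text \<open>The kernel is bounded by \<open>M\<close>, and the integral of \<open>H\<close> over
  \<Omega> is estimated by Cauchy-Schwarz against the indicator. The bound is uniform in
  \<open>x\<close>; taking the norm over \<Omega> contributes the second factor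
  \<open>sqrt (measure lebesgue \<Omega>)\<close>.\<close>

lemma norm_convolve_le:
  assumes "\<Phi> \<in> kernels \<Omega> M"
  shows "norm (convolve \<Omega> (rep_L2 \<Phi>) (rep_L2 H) x) \<le> M * sqrt (measure lebesgue \<Omega>) * norm H"
proof -
  let ?h = "\<lambda>y. norm (rep_L2 H y)" and ?i = "\<lambda>y. M * indicator \<Omega> y :: real"
  have h: "?h \<in> square_integrable" by (intro square_integrable_norm rep_L2_square_integrable)
  have i: "?i \<in> square_integrable" by (rule const_indicator_square_integrable)
  have "norm (convolve \<Omega> (rep_L2 \<Phi>) (rep_L2 H) x) \<le> (LINT y|lebesgue. norm (rep_L2 \<Phi> (x - y) *s restr \<Omega> (rep_L2 H) y))"
    unfolding convolve_eq[OF domain_measurable] by (rule integral_norm_bound)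
  also have "\<dots> \<le> (LINT y|lebesgue. ?i y \<bullet> ?h y)"
  proof (rule integral_mono_AE)
    show "integrable lebesgue (\<lambda>y. norm (rep_L2 \<Phi> (x - y) *s restr \<Omega> (rep_L2 H) y))"
      by (intro integrable_norm convolve_integrable[OF domain_measurable] rep_L2_square_integrable rep_L2_space[OF domain_measurable])
    show "integrable lebesgue (\<lambda>y. ?i y \<bullet> ?h y)" by (rule integrable_inner[OF i h])
    \<comment> \<open>After reflection the support of the kernel is no longer \<Omega>, so only the
      constant \<open>M\<close> is kept; the indicator in the majorant comes from
      \<open>restr \<Omega>\<close> applied to the field.\<close>
    have "AE y in lebesgue. norm (rep_L2 \<Phi> y) \<le> M"
    proof -
      have "AE y in lebesgue. norm (rep_L2 \<Phi> y) \<le> M * indicator \<Omega> y" using assms by (simp add: kernels_def)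
      then show ?thesis
        by eventually_elim (use M in \<open>auto split: split_indicator_asm\<close>)
    qed
    from AE_reflect[OF this, of x]
    show "AE y in lebesgue. norm (rep_L2 \<Phi> (x - y) *s restr \<Omega> (rep_L2 H) y) \<le> ?i y \<bullet> ?h y"
      by eventually_elim (auto simp: norm_vector_smult restr_def indicator_def intro: mult_right_mono)
  qed
  also have "\<dots> = abs_L2 ?i \<bullet> abs_L2 ?h" by (rule inner_abs_L2[OF i h, symmetric])
  also have "\<dots> \<le> norm (abs_L2 ?i) * norm (abs_L2 ?h)" by (rule norm_cauchy_schwarz)
  also have "norm (abs_L2 ?h) = norm (abs_L2 (rep_L2 H))"
    by (simp add: norm_abs_L2 h rep_L2_square_integrable del: abs_L2_rep)
  finally show ?thesis by (simp add: norm_const_indicator[OF M] abs_L2_rep)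
qed

lemma convolve_L2_space:
  assumes "\<Phi> \<in> kernels \<Omega> M"
  shows "convolve \<Omega> (rep_L2 \<Phi>) (rep_L2 H) \<in> L2_space \<Omega>"
  unfolding L2_space_iff[OF domain_measurable]
proof (rule square_integrable_bound[OF const_indicator_square_integrable])
  have "convolve \<Omega> (rep_L2 \<Phi>) (rep_L2 H) \<in> borel_measurable lebesgue"
    by (intro convolve_measurable[OF domain_measurable] square_integrable_measurable rep_L2_square_integrable restr_square_integrable domain_measurable)
  then show "restr \<Omega> (convolve \<Omega> (rep_L2 \<Phi>) (rep_L2 H)) \<in> borel_measurable lebesgue"
    unfolding restr_eq_indicator using domain_measurable by measurable
  show "AE x in lebesgue. norm (restr \<Omega> (convolve \<Omega> (rep_L2 \<Phi>) (rep_L2 H)) x)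
      \<le> norm ((M * sqrt (measure lebesgue \<Omega>) * norm H) * indicator \<Omega> x :: real)"
    using norm_convolve_le[OF assms] M by (intro AE_I2) (auto simp: restr_def)
qed

lemma norm_conv_op_le:
  assumes "\<Phi> \<in> kernels \<Omega> M"
  shows "norm (conv_op \<Omega> \<Phi> H) \<le> M * measure lebesgue \<Omega> * norm H"
proof -
  have "norm (conv_op \<Omega> \<Phi> H) \<le> (M * sqrt (measure lebesgue \<Omega>) * norm H) * sqrt (measure lebesgue \<Omega>)"
  proof (rule norm_L2_le_if_bounded)
    show "AE x in lebesgue. norm (rep_L2 (conv_op \<Omega> \<Phi> H) x) \<le> M * sqrt (measure lebesgue \<Omega>) * norm H * indicator \<Omega> x"
      unfolding conv_op_def using rep_emb[OF domain_measurable convolve_L2_space[OF assms, of H]]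
      by eventually_elim (use norm_convolve_le[OF assms] in \<open>auto simp: restr_def\<close>)
  qed (use M in simp)
  also have "\<dots> = M * (sqrt (measure lebesgue \<Omega>) * sqrt (measure lebesgue \<Omega>)) * norm H" by simp
  finally show ?thesis by simp
qed

lemma bounded_linear_conv_op:
  assumes K: "\<Phi> \<in> kernels \<Omega> M"
  shows "bounded_linear (conv_op \<Omega> \<Phi>)"
proof (rule bounded_linear_intro)
  fix U V :: "(real^3, complex^3) L2" and c
  let ?f = "rep_L2 \<Phi>"
  have f: "?f \<in> borel_measurable lebesgue" by (intro square_integrable_measurable rep_L2_square_integrable)
  have m: "u \<in> L2_space \<Omega> \<Longrightarrow> restr \<Omega> u \<in> borel_measurable lebesgue" for u :: "real^3 \<Rightarrow> complex^3"
    by (simp add: L2_space_iff[OF domain_measurable] square_integrable_measurable)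
  note I = convolve_integrable[OF domain_measurable rep_L2_square_integrable rep_L2_space[OF domain_measurable]]
  have "convolve \<Omega> ?f (rep_L2 (U + V)) = convolve \<Omega> ?f (\<lambda>x. rep_L2 U x + rep_L2 V x)"
  proof (rule ext, rule convolve_cong_AE[OF domain_measurable f f])
    show "AE x in lebesgue. restr \<Omega> (rep_L2 (U + V)) x = restr \<Omega> (\<lambda>x. rep_L2 U x + rep_L2 V x) x"
      using rep_L2_add[of U V] by (auto simp: restr_def elim: eventually_mono)
  qed (auto intro!: m L2_space_add[OF domain_measurable] rep_L2_space[OF domain_measurable])
  also have "\<dots> = (\<lambda>x. convolve \<Omega> ?f (rep_L2 U) x + convolve \<Omega> ?f (rep_L2 V) x)"
    unfolding convolve_eq[OF domain_measurable] restr_add bounded_bilinear.add_right[OF bounded_bilinear_smult]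
    by (intro ext Bochner_Integration.integral_add I)
  finally show "conv_op \<Omega> \<Phi> (U + V) = conv_op \<Omega> \<Phi> U + conv_op \<Omega> \<Phi> V"
    unfolding conv_op_def by (simp add: emb_add[OF domain_measurable] convolve_L2_space[OF K])
  have "convolve \<Omega> ?f (rep_L2 (c *\<^sub>R U)) = convolve \<Omega> ?f (\<lambda>x. c *\<^sub>R rep_L2 U x)"
  proof (rule ext, rule convolve_cong_AE[OF domain_measurable f f])
    show "AE x in lebesgue. restr \<Omega> (rep_L2 (c *\<^sub>R U)) x = restr \<Omega> (\<lambda>x. c *\<^sub>R rep_L2 U x) x"
      using rep_L2_scaleR[of c U] by (auto simp: restr_def elim: eventually_mono)
  qed (auto intro!: m L2_space_scaleR[OF domain_measurable] rep_L2_space[OF domain_measurable])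
  also have "\<dots> = (\<lambda>x. c *\<^sub>R convolve \<Omega> ?f (rep_L2 U) x)"
    unfolding convolve_eq[OF domain_measurable] restr_scaleR bounded_bilinear.scaleR_right[OF bounded_bilinear_smult]
    by (intro ext integral_scaleR_right)
  finally show "conv_op \<Omega> \<Phi> (c *\<^sub>R U) = c *\<^sub>R conv_op \<Omega> \<Phi> U"
    unfolding conv_op_def by (simp add: emb_scaleR[OF domain_measurable] convolve_L2_space[OF K])
  show "norm (conv_op \<Omega> \<Phi> U) \<le> norm U * (M * measure lebesgue \<Omega>)"
    using norm_conv_op_le[OF K, of U] by (simp add: mult.commute)
qed

text \<open>Convergence in operator norm may fail, for instance for oscillating kernels.\<close>

lemma conv_op_weakly_continuous:
  assumes K: "\<And>n. \<Phi> n \<in> kernels \<Omega> M" "\<Psi> \<in> kernels \<Omega> M"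
    and weak: "\<And>V. (\<lambda>n. \<Phi> n \<bullet> V) \<longlonglongrightarrow> \<Psi> \<bullet> V"
  shows "(\<lambda>n. conv_op \<Omega> (\<Phi> n) H) \<longlonglongrightarrow> conv_op \<Omega> \<Psi> H"
proof (rule L2_dominated_convergence)
  have ptw: "(\<lambda>n. convolve \<Omega> (rep_L2 (\<Phi> n)) (rep_L2 H) x) \<longlonglongrightarrow> convolve \<Omega> (rep_L2 \<Psi>) (rep_L2 H) x" for x
  proof (subst tendsto_componentwise_iff, intro ballI)
    fix b :: "complex^3"
    show "(\<lambda>n. convolve \<Omega> (rep_L2 (\<Phi> n)) (rep_L2 H) x \<bullet> b) \<longlonglongrightarrow> convolve \<Omega> (rep_L2 \<Psi>) (rep_L2 H) x \<bullet> b"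
      unfolding inner_convolve[OF domain_measurable rep_L2_square_integrable rep_L2_space[OF domain_measurable]] abs_L2_rep by (rule weak)
  qed
  have "AE x in lebesgue. \<forall>n. rep_L2 (conv_op \<Omega> (\<Phi> n) H) x = restr \<Omega> (convolve \<Omega> (rep_L2 (\<Phi> n)) (rep_L2 H)) x"
    unfolding AE_all_countable conv_op_def using rep_emb[OF domain_measurable convolve_L2_space[OF K(1)]] by blast
  moreover have "AE x in lebesgue. rep_L2 (conv_op \<Omega> \<Psi> H) x = restr \<Omega> (convolve \<Omega> (rep_L2 \<Psi>) (rep_L2 H)) x"
    unfolding conv_op_def by (rule rep_emb[OF domain_measurable convolve_L2_space[OF K(2)]])
  ultimately show "AE x in lebesgue. (\<lambda>n. rep_L2 (conv_op \<Omega> (\<Phi> n) H) x) \<longlonglongrightarrow> rep_L2 (conv_op \<Omega> \<Psi> H) x"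
    by eventually_elim (use ptw in \<open>simp add: restr_def\<close>)
  \<comment> \<open>The uniform bound of \<open>norm_convolve_le\<close> is the majorant; it is
    square integrable as \<Omega> has finite measure.\<close>
  show "(\<lambda>x. (M * sqrt (measure lebesgue \<Omega>) * norm H) * indicator \<Omega> x :: real) \<in> square_integrable"
    by (rule const_indicator_square_integrable)
  show "AE x in lebesgue. norm (rep_L2 (conv_op \<Omega> (\<Phi> n) H) x)
      \<le> norm ((M * sqrt (measure lebesgue \<Omega>) * norm H) * indicator \<Omega> x :: real)" for n
    unfolding conv_op_def using rep_emb[OF domain_measurable convolve_L2_space[OF K(1)[of n], of H]]
    by eventually_elim (use norm_convolve_le[OF K(1)[of n]] M in \<open>auto simp: restr_def\<close>)
qed

end

section \<open>Calculus of test functions\<close>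

lemma DERIV_along_line:
  fixes g :: "'a::real_normed_vector \<Rightarrow> real"
  assumes "\<And>y. (g has_derivative G y) (at y)"
  shows "((\<lambda>s. g (p + s *\<^sub>R u)) has_real_derivative G (p + s *\<^sub>R u) u) (at s)"
proof -
  have "((\<lambda>s. p + s *\<^sub>R u) has_derivative (\<lambda>s. s *\<^sub>R u)) (at s)"
    by (auto intro!: derivative_eq_intros)
  from has_derivative_compose[OF this assms]
  have "((\<lambda>s. g (p + s *\<^sub>R u)) has_derivative (\<lambda>t. G (p + s *\<^sub>R u) (t *\<^sub>R u))) (at s)" .
  moreover have "(\<lambda>t. G (p + s *\<^sub>R u) (t *\<^sub>R u)) = (*) (G (p + s *\<^sub>R u) u)"
    using linear_scale[OF has_derivative_linear[OF assms]] by (auto simp: mult.commute)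
  ultimately show ?thesis by (simp add: has_field_derivative_def)
qed

text \<open>The mean value theorem is applied twice: along \<open>u\<close> to the increment of
  \<open>g\<close> in direction \<open>v\<close>, then along \<open>v\<close> to the derivative in
  direction \<open>u\<close>.\<close>

lemma second_difference_mean_value:
  fixes g :: "'a::real_normed_vector \<Rightarrow> real"
  assumes g: "\<And>y. (g has_derivative G y) (at y)"
    and Gu: "\<And>y. ((\<lambda>y. G y u) has_derivative H y) (at y)"
    and h: "0 < h"
  shows "\<exists>\<xi> \<eta>. 0 < \<xi> \<and> \<xi> < h \<and> 0 < \<eta> \<and> \<eta> < h \<and>
    g (x + h *\<^sub>R u + h *\<^sub>R v) - g (x + h *\<^sub>R u) - g (x + h *\<^sub>R v) + g x = h\<^sup>2 * H (x + \<xi> *\<^sub>R u + \<eta> *\<^sub>R v) v"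
proof -
  have 1: "((\<lambda>s. g ((x + h *\<^sub>R v) + s *\<^sub>R u) - g (x + s *\<^sub>R u)) has_real_derivative
      G ((x + h *\<^sub>R v) + s *\<^sub>R u) u - G (x + s *\<^sub>R u) u) (at s)" for s
    by (intro DERIV_diff DERIV_along_line g)
  obtain \<xi> where \<xi>: "0 < \<xi>" "\<xi> < h"
    "(g ((x + h *\<^sub>R v) + h *\<^sub>R u) - g (x + h *\<^sub>R u)) - (g ((x + h *\<^sub>R v) + 0 *\<^sub>R u) - g (x + 0 *\<^sub>R u))
      = (h - 0) * (G ((x + h *\<^sub>R v) + \<xi> *\<^sub>R u) u - G (x + \<xi> *\<^sub>R u) u)"
    using MVT2[OF h 1] by blast
  have 2: "((\<lambda>t. G ((x + \<xi> *\<^sub>R u) + t *\<^sub>R v) u) has_real_derivative H ((x + \<xi> *\<^sub>R u) + t *\<^sub>R v) v) (at t)" for t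
    by (rule DERIV_along_line[OF Gu])
  obtain \<eta> where \<eta>: "0 < \<eta>" "\<eta> < h"
    "G ((x + \<xi> *\<^sub>R u) + h *\<^sub>R v) u - G ((x + \<xi> *\<^sub>R u) + 0 *\<^sub>R v) u = (h - 0) * H ((x + \<xi> *\<^sub>R u) + \<eta> *\<^sub>R v) v"
    using MVT2[OF h 2] by blast
  have "x + h *\<^sub>R v + h *\<^sub>R u = x + h *\<^sub>R u + h *\<^sub>R v" "x + h *\<^sub>R v + \<xi> *\<^sub>R u = x + \<xi> *\<^sub>R u + h *\<^sub>R v"
    by (simp_all add: algebra_simps)
  with \<xi>(3) \<eta>(3) have "g (x + h *\<^sub>R u + h *\<^sub>R v) - g (x + h *\<^sub>R u) - g (x + h *\<^sub>R v) + g x = h\<^sup>2 * H (x + \<xi> *\<^sub>R u + \<eta> *\<^sub>R v) v"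
    by (simp add: power2_eq_square)
  with \<xi> \<eta> show ?thesis by blast
qed

text \<open>The second difference is symmetric in \<open>u\<close> and \<open>v\<close>. Expressed
  by either mixed derivative at points tending to \<open>x\<close>, it identifies the two
  limits.\<close>

lemma mixed_derivatives_commute:
  fixes g :: "'a::real_normed_vector \<Rightarrow> real"
  assumes g: "\<And>y. (g has_derivative G y) (at y)"
    and Gu: "\<And>y. ((\<lambda>y. G y u) has_derivative Hu y) (at y)" and Gv: "\<And>y. ((\<lambda>y. G y v) has_derivative Hv y) (at y)"
    and cont: "isCont (\<lambda>y. Hu y v) x" "isCont (\<lambda>y. Hv y u) x"
  shows "Hu x v = Hv x u"
proof -
  define h where "h n = 1 / real (Suc n)" for n
  have h: "0 < h n" for n by (simp add: h_def)
  have h0: "h \<longlonglongrightarrow> 0"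
    unfolding h_def using LIMSEQ_inverse_real_of_nat by (simp add: inverse_eq_divide)
  define D where "D n = g (x + h n *\<^sub>R u + h n *\<^sub>R v) - g (x + h n *\<^sub>R u) - g (x + h n *\<^sub>R v) + g x" for n
  have "\<exists>\<xi> \<eta>. 0 < \<xi> \<and> \<xi> < h n \<and> 0 < \<eta> \<and> \<eta> < h n \<and> D n = (h n)\<^sup>2 * Hu (x + \<xi> *\<^sub>R u + \<eta> *\<^sub>R v) v" for n
    unfolding D_def by (rule second_difference_mean_value[OF g Gu h])
  then obtain \<xi> \<eta> where 1: "\<And>n. 0 < \<xi> n \<and> \<xi> n < h n \<and> 0 < \<eta> n \<and> \<eta> n < h n"
    "\<And>n. D n = (h n)\<^sup>2 * Hu (x + \<xi> n *\<^sub>R u + \<eta> n *\<^sub>R v) v" by metis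
  have D': "D n = g (x + h n *\<^sub>R v + h n *\<^sub>R u) - g (x + h n *\<^sub>R v) - g (x + h n *\<^sub>R u) + g x" for n
    by (simp add: D_def add.commute add.left_commute)
  have "\<exists>\<xi> \<eta>. 0 < \<xi> \<and> \<xi> < h n \<and> 0 < \<eta> \<and> \<eta> < h n \<and> D n = (h n)\<^sup>2 * Hv (x + \<xi> *\<^sub>R v + \<eta> *\<^sub>R u) u" for n
    unfolding D' by (rule second_difference_mean_value[OF g Gv h])
  then obtain \<zeta> \<theta> where 2: "\<And>n. 0 < \<zeta> n \<and> \<zeta> n < h n \<and> 0 < \<theta> n \<and> \<theta> n < h n"
    "\<And>n. D n = (h n)\<^sup>2 * Hv (x + \<zeta> n *\<^sub>R v + \<theta> n *\<^sub>R u) u" by metis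
  have lim: "s \<longlonglongrightarrow> 0" if "\<And>n. 0 < s n \<and> s n < h n" for s
  proof (rule tendsto_sandwich[OF _ _ tendsto_const h0])
    have "0 \<le> s n" "s n \<le> h n" for n using that[of n] by auto
    then show "\<forall>\<^sub>F n in sequentially. 0 \<le> s n" "\<forall>\<^sub>F n in sequentially. s n \<le> h n" by simp_all
  qed
  have "(\<lambda>n. x + \<xi> n *\<^sub>R u + \<eta> n *\<^sub>R v) \<longlonglongrightarrow> x + 0 *\<^sub>R u + 0 *\<^sub>R v"
    by (intro tendsto_intros lim) (use 1 in auto)
  then have A: "(\<lambda>n. Hu (x + \<xi> n *\<^sub>R u + \<eta> n *\<^sub>R v) v) \<longlonglongrightarrow> Hu x v"
    using isCont_tendsto_compose[OF cont(1)] by simp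
  have "(\<lambda>n. x + \<zeta> n *\<^sub>R v + \<theta> n *\<^sub>R u) \<longlonglongrightarrow> x + 0 *\<^sub>R v + 0 *\<^sub>R u"
    by (intro tendsto_intros lim) (use 2 in auto)
  then have B: "(\<lambda>n. Hv (x + \<zeta> n *\<^sub>R v + \<theta> n *\<^sub>R u) u) \<longlonglongrightarrow> Hv x u"
    using isCont_tendsto_compose[OF cont(2)] by simp
  have "Hu (x + \<xi> n *\<^sub>R u + \<eta> n *\<^sub>R v) v = Hv (x + \<zeta> n *\<^sub>R v + \<theta> n *\<^sub>R u) u" for n
    using 1(2)[of n] 2(2)[of n] h[of n] by simp
  with A B show ?thesis by (simp add: LIMSEQ_unique)
qed

section \<open>Smooth functions and test functions\<close>

definition smooth :: "(real^3 \<Rightarrow> 'b::real_normed_vector) \<Rightarrow> bool" where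
  "smooth f \<longleftrightarrow> (\<forall>n. times_cont_differentiable n f)"

lemma smooth_continuous: "smooth f \<Longrightarrow> continuous_on UNIV f"
  using times_cont_differentiable.simps(1) unfolding smooth_def by blast

lemma smooth_differentiable: "smooth f \<Longrightarrow> f differentiable (at x)"
  unfolding smooth_def using times_cont_differentiable.simps(2) by blast

lemma smooth_has_derivative: "smooth f \<Longrightarrow> (f has_derivative frechet_derivative f (at x)) (at x)"
  using smooth_differentiable frechet_derivative_works by blast

lemma smooth_frechet_derivative: "smooth f \<Longrightarrow> smooth (\<lambda>x. frechet_derivative f (at x) v)"
  unfolding smooth_def using times_cont_differentiable.simps(2) by blast

lemma frechet_derivative_add:
  assumes "f differentiable (at x)" "g differentiable (at x)"
  shows "frechet_derivative (\<lambda>x. f x + g x) (at x) v = frechet_derivative f (at x) v + frechet_derivative g (at x) v"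
  using frechet_derivative_at[OF has_derivative_add[OF assms[unfolded frechet_derivative_works]]] by metis

lemma frechet_derivative_bounded_linear:
  assumes "bounded_linear L" "f differentiable (at x)"
  shows "frechet_derivative (\<lambda>x. L (f x)) (at x) v = L (frechet_derivative f (at x) v)"
  using frechet_derivative_at[OF bounded_linear.has_derivative[OF assms(1) assms(2)[unfolded frechet_derivative_works]]]
  by metis

lemma times_cont_differentiable_add:
  "times_cont_differentiable n f \<Longrightarrow> times_cont_differentiable n g \<Longrightarrow> times_cont_differentiable n (\<lambda>x. f x + g x)"
proof (induction n arbitrary: f g)
  case 0
  then show ?case by (auto intro: continuous_intros)
next
  case (Suc n)
  then show ?case by (auto simp: frechet_derivative_add)
qed

lemma times_cont_differentiable_bounded_linear:
  assumes L: "bounded_linear L"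
  shows "times_cont_differentiable n f \<Longrightarrow> times_cont_differentiable n (\<lambda>x. L (f x))"
proof (induction n arbitrary: f)
  case 0
  then show ?case by (auto intro: bounded_linear.continuous_on[OF L])
next
  case (Suc n)
  then have "(\<lambda>x. L (f x)) differentiable (at x)" for x
    using bounded_linear.has_derivative[OF L] unfolding times_cont_differentiable.simps differentiable_def by blast
  with Suc show ?case by (auto simp: frechet_derivative_bounded_linear[OF L])
qed

lemma smooth_add: "smooth f \<Longrightarrow> smooth g \<Longrightarrow> smooth (\<lambda>x. f x + g x)"
  by (simp add: smooth_def times_cont_differentiable_add)

lemma smooth_bounded_linear: "bounded_linear L \<Longrightarrow> smooth f \<Longrightarrow> smooth (\<lambda>x. L (f x))"
  by (simp add: smooth_def times_cont_differentiable_bounded_linear)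

text \<open>Any compact set containing the support may serve as witness, which spares computing
  closures for sums and images.\<close>

lemma test_functions_iff:
  "\<phi> \<in> test_functions \<Omega> \<longleftrightarrow> smooth \<phi> \<and> (\<exists>S. compact S \<and> S \<subseteq> \<Omega> \<and> {x. \<phi> x \<noteq> 0} \<subseteq> S)"
proof
  show "\<phi> \<in> test_functions \<Omega> \<Longrightarrow> smooth \<phi> \<and> (\<exists>S. compact S \<and> S \<subseteq> \<Omega> \<and> {x. \<phi> x \<noteq> 0} \<subseteq> S)"
    by (auto simp: test_functions_def smooth_def intro!: exI[of _ "closure {x. \<phi> x \<noteq> 0}"] closure_subset)
  assume R: "smooth \<phi> \<and> (\<exists>S. compact S \<and> S \<subseteq> \<Omega> \<and> {x. \<phi> x \<noteq> 0} \<subseteq> S)"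
  then obtain S where S: "compact S" "S \<subseteq> \<Omega>" "{x. \<phi> x \<noteq> 0} \<subseteq> S" by blast
  have "closure {x. \<phi> x \<noteq> 0} \<subseteq> S"
    using S by (simp add: closure_minimal compact_imp_closed)
  moreover from this have "compact (closure {x. \<phi> x \<noteq> 0})"
    using S(1) by (meson bounded_subset closed_closure compact_eq_bounded_closed)
  ultimately show "\<phi> \<in> test_functions \<Omega>" using R S(2) by (auto simp: test_functions_def smooth_def)
qed

lemma test_functions_smooth: "\<phi> \<in> test_functions \<Omega> \<Longrightarrow> smooth \<phi>"
  by (simp add: test_functions_iff)

lemma test_functions_add:
  assumes "\<phi> \<in> test_functions \<Omega>" "\<psi> \<in> test_functions \<Omega>"
  shows "(\<lambda>x. \<phi> x + \<psi> x) \<in> test_functions \<Omega>"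
proof -
  obtain S T where S: "compact S" "S \<subseteq> \<Omega>" "{x. \<phi> x \<noteq> 0} \<subseteq> S" and T: "compact T" "T \<subseteq> \<Omega>" "{x. \<psi> x \<noteq> 0} \<subseteq> T"
    using assms unfolding test_functions_iff by metis
  have "{x. \<phi> x + \<psi> x \<noteq> 0} \<subseteq> S \<union> T"
  proof (rule subsetI, rule ccontr)
    fix x assume x: "x \<in> {x. \<phi> x + \<psi> x \<noteq> 0}" "x \<notin> S \<union> T"
    then have "\<phi> x = 0" "\<psi> x = 0" using S(3) T(3) by blast+
    then show False using x by simp
  qed
  then show ?thesis
    unfolding test_functions_iff using S T assms
    by (intro conjI exI[of _ "S \<union> T"] smooth_add compact_Un) (auto simp: test_functions_iff)
qed

lemma test_functions_bounded_linear:
  assumes "bounded_linear L" "\<phi> \<in> test_functions \<Omega>"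
  shows "(\<lambda>x. L (\<phi> x)) \<in> test_functions \<Omega>"
proof -
  obtain S where S: "compact S" "S \<subseteq> \<Omega>" "{x. \<phi> x \<noteq> 0} \<subseteq> S"
    using assms unfolding test_functions_iff by metis
  have "{x. L (\<phi> x) \<noteq> 0} \<subseteq> S" using S(3) linear_0[OF bounded_linear.linear[OF assms(1)]] by auto
  then show ?thesis
    unfolding test_functions_iff using S(1,2) smooth_bounded_linear[OF assms(1) test_functions_smooth[OF assms(2)]] by blast
qed

lemma test_functions_zero: "(\<lambda>x. 0) \<in> test_functions \<Omega>"
proof -
  have "times_cont_differentiable n (\<lambda>x. 0 :: 'a)" for n
    by (induction n) (auto simp: frechet_derivative_const)
  then show ?thesis by (simp add: test_functions_def)
qed

lemma test_functions_frechet_derivative: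
  assumes "\<phi> \<in> test_functions \<Omega>"
  shows "(\<lambda>x. frechet_derivative \<phi> (at x) v) \<in> test_functions \<Omega>"
proof -
  let ?S = "closure {x. \<phi> x \<noteq> 0}"
  have S: "compact ?S" "?S \<subseteq> \<Omega>" using assms by (auto simp: test_functions_def)
  have "frechet_derivative \<phi> (at x) v = 0" if "x \<notin> ?S" for x
  proof -
    have "((\<lambda>x. 0) has_derivative (\<lambda>x. 0)) (at x)" by simp
    then have "(\<phi> has_derivative (\<lambda>x. 0)) (at x)"
    proof (rule has_derivative_transform_within_open)
      show "open (- ?S)" "x \<in> - ?S" using that by auto
      show "0 = \<phi> y" if "y \<in> - ?S" for y
      proof -
        have "y \<notin> {x. \<phi> x \<noteq> 0}" using that closure_subset[of "{x. \<phi> x \<noteq> 0}"] by blast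
        then show ?thesis by simp
      qed
    qed
    from fun_cong[OF frechet_derivative_at[OF this], of v] show ?thesis by simp
  qed
  then have "{x. frechet_derivative \<phi> (at x) v \<noteq> 0} \<subseteq> ?S" by blast
  then show ?thesis
    unfolding test_functions_iff using S smooth_frechet_derivative[OF test_functions_smooth[OF assms]]
    by (intro conjI exI[of _ ?S]) auto
qed

lemma test_functions_partial: "\<phi> \<in> test_functions \<Omega> \<Longrightarrow> partial i \<phi> \<in> test_functions \<Omega>"
  unfolding partial_def[abs_def] by (rule test_functions_frechet_derivative)

lemma bounded_linear_axis: "bounded_linear (axis i :: 'b::real_normed_vector \<Rightarrow> 'b^'n)"
proof (rule bounded_linear_intro[where K=1])
  fix c d :: 'b and r :: real
  show "axis i (c + d) = axis i c + (axis i d :: 'b^'n)" "axis i (r *\<^sub>R c) = r *\<^sub>R (axis i c :: 'b^'n)"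
    by (simp_all add: vec_eq_iff axis_def)
  have "norm (axis i c :: 'b^'n) \<le> (\<Sum>j\<in>UNIV. norm ((axis i c :: 'b^'n) $ j))"
    unfolding norm_vec_def by (rule L2_set_le_sum) simp
  also have "\<dots> = (\<Sum>j\<in>UNIV. if j = i then norm c else 0)" by (rule sum.cong) (auto simp: axis_def)
  finally show "norm (axis i c :: 'b^'n) \<le> norm c * 1" by simp
qed

text \<open>In this form the closure of test functions under sums and bounded linear maps applies to
  gradients.\<close>

lemma grad_eq_sum: "grad \<phi> x = axis 1 (partial 1 \<phi> x) + axis 2 (partial 2 \<phi> x) + axis 3 (partial 3 \<phi> x)"
  by (simp add: grad_def vec_eq_iff axis_def forall_3)

lemma test_functions_grad: "\<phi> \<in> test_functions \<Omega> \<Longrightarrow> grad \<phi> \<in> test_functions \<Omega>"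
  unfolding grad_eq_sum[abs_def]
  by (intro test_functions_add test_functions_bounded_linear[OF bounded_linear_axis] test_functions_partial)

lemma partial_add: "smooth f \<Longrightarrow> smooth g \<Longrightarrow> partial i (\<lambda>x. f x + g x) x = partial i f x + partial i g x"
  by (simp add: partial_def frechet_derivative_add smooth_differentiable)

lemma partial_bounded_linear: "bounded_linear L \<Longrightarrow> smooth f \<Longrightarrow> partial i (\<lambda>x. L (f x)) x = L (partial i f x)"
  by (simp add: partial_def frechet_derivative_bounded_linear smooth_differentiable)

lemma grad_add: "smooth f \<Longrightarrow> smooth g \<Longrightarrow> grad (\<lambda>x. f x + g x) = (\<lambda>x. grad f x + grad g x)"
  by (simp add: grad_def vec_eq_iff partial_add fun_eq_iff)

lemma grad_mult: "smooth f \<Longrightarrow> grad (\<lambda>x. c * f x) = (\<lambda>x. c *s grad f x)"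
  using partial_bounded_linear[OF bounded_linear_mult_right] by (simp add: grad_def vec_eq_iff fun_eq_iff)

lemma grad_scaleR: "smooth f \<Longrightarrow> grad (\<lambda>x. c *\<^sub>R f x) = (\<lambda>x. c *\<^sub>R grad f x)"
  using partial_bounded_linear[OF bounded_linear_scaleR_right] by (simp add: grad_def vec_eq_iff fun_eq_iff)

lemma smooth_component: "smooth f \<Longrightarrow> smooth (\<lambda>x. f x $ i)"
  by (rule smooth_bounded_linear[OF bounded_linear_vec_nth])

lemma curl_add:
  assumes "smooth f" "smooth g"
  shows "curl (\<lambda>x. f x + g x) = (\<lambda>x. curl f x + curl g x)"
  by (simp add: curl_def vec_eq_iff fun_eq_iff forall_3 partial_add smooth_component assms)

text \<open>The mean value theorem behind \<open>mixed_derivatives_commute\<close> is real, so real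
  and imaginary parts are treated separately; both are bounded linear and commute with
  derivatives.\<close>

lemma partial_commute:
  assumes "smooth f"
  shows "partial i (partial j f) x = partial j (partial i f) x"
proof -
  have real: "frechet_derivative (\<lambda>x. frechet_derivative g (at x) u) (at x) v
     = frechet_derivative (\<lambda>x. frechet_derivative g (at x) v) (at x) u" if "smooth g" for g :: "real^3 \<Rightarrow> real" and u v
  proof -
    have 1: "(g has_derivative frechet_derivative g (at y)) (at y)" for y
      by (rule smooth_has_derivative[OF that])
    have 2: "((\<lambda>x. frechet_derivative g (at x) w) has_derivative
        frechet_derivative (\<lambda>x. frechet_derivative g (at x) w) (at y)) (at y)" for y w
      by (intro smooth_has_derivative smooth_frechet_derivative that)
    have 3: "isCont (\<lambda>y. frechet_derivative (\<lambda>x. frechet_derivative g (at x) w) (at y) w') x" for w w'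
      using smooth_continuous[OF smooth_frechet_derivative[OF smooth_frechet_derivative[OF that]], of w w']
      by (simp add: continuous_on_eq_continuous_at)
    show ?thesis by (rule mixed_derivatives_commute[OF 1 2 2 3 3])
  qed
  have comp: "L (partial i (partial j f) x) = frechet_derivative (\<lambda>x. frechet_derivative (\<lambda>x. L (f x)) (at x) (axis j 1)) (at x) (axis i 1)"
    if L: "bounded_linear L" for L :: "complex \<Rightarrow> real" and i j
    using assms unfolding partial_def
    by (simp add: frechet_derivative_bounded_linear[OF L] smooth_differentiable smooth_frechet_derivative)
  show ?thesis
  proof (rule complex_eqI)
    show "Re (partial i (partial j f) x) = Re (partial j (partial i f) x)"
      unfolding comp[OF bounded_linear_Re] by (rule real) (rule smooth_bounded_linear[OF bounded_linear_Re assms])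
    show "Im (partial i (partial j f) x) = Im (partial j (partial i f) x)"
      unfolding comp[OF bounded_linear_Im] by (rule real) (rule smooth_bounded_linear[OF bounded_linear_Im assms])
  qed
qed

lemma curl_grad: "smooth \<phi> \<Longrightarrow> curl (grad \<phi>) = (\<lambda>x. 0)"
  using partial_commute[of \<phi>] by (auto simp: curl_def grad_def fun_eq_iff vec_eq_iff forall_3)

section \<open>Poincare's inequality\<close>

lemma compact_support_bounded:
  fixes f :: "real^3 \<Rightarrow> 'b::real_normed_vector"
  assumes "continuous_on UNIV f" "compact S" "{x. f x \<noteq> 0} \<subseteq> S"
  obtains B where "0 \<le> B" "\<And>x. norm (f x) \<le> B * indicator S x"
proof -
  have "bounded (f ` S)"
    using assms(1,2) by (intro compact_imp_bounded compact_continuous_image) (auto intro: continuous_on_subset)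
  then obtain B where B: "\<And>x. x \<in> S \<Longrightarrow> norm (f x) \<le> B" by (auto simp: bounded_iff)
  have "norm (f x) \<le> max 0 B * indicator S x" for x
    using B[of x] assms(3) by (cases "x \<in> S") auto
  then show ?thesis using that[of "max 0 B"] by simp
qed

lemma continuous_on_borel_measurable_lebesgue:
  fixes u :: "'a::euclidean_space \<Rightarrow> 'b::euclidean_space"
  assumes "continuous_on UNIV u"
  shows "u \<in> borel_measurable lebesgue"
  by (rule measurable_completion) (simp add: borel_measurable_continuous_onI assms)

lemma compact_support_square_integrable:
  fixes f :: "real^3 \<Rightarrow> 'b::euclidean_space"
  assumes f: "continuous_on UNIV f" "compact S" "{x. f x \<noteq> 0} \<subseteq> S"
  shows "f \<in> square_integrable"
proof -
  obtain B where B: "0 \<le> B" "\<And>x. norm (f x) \<le> B * indicator S x" by (rule compact_support_bounded[OF f]) blast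
  have "(\<lambda>x. B * indicator S x :: real) \<in> square_integrable"
    using lmeasurable_compact[OF f(2)] by (rule const_indicator_square_integrable[of S 0]) simp
  then show ?thesis
  proof (rule square_integrable_bound)
    show "f \<in> borel_measurable lebesgue"
      by (rule continuous_on_borel_measurable_lebesgue[OF f(1)])
  qed (use B in simp)
qed

lemma test_functions_square_integrable:
  fixes \<phi> :: "real^3 \<Rightarrow> 'b::euclidean_space"
  shows "\<phi> \<in> test_functions \<Omega> \<Longrightarrow> \<phi> \<in> square_integrable"
  using compact_support_square_integrable smooth_continuous unfolding test_functions_iff by blast

lemma restr_test_function: "\<phi> \<in> test_functions \<Omega> \<Longrightarrow> restr \<Omega> \<phi> = \<phi>"
  unfolding test_functions_iff by (auto simp: restr_def fun_eq_iff)

text \<open>A translation is the composition of two reflections.\<close>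

lemma integral_translate:
  fixes u :: "'a::euclidean_space \<Rightarrow> 'b::euclidean_space"
  assumes "u \<in> borel_measurable lebesgue"
  shows "(LINT x|lebesgue. u (w + x)) = (LINT x|lebesgue. u x)"
proof -
  have "(\<lambda>y. u (w - y)) \<in> borel_measurable lebesgue"
    by (rule measurable_compose[OF measurable_reflect assms])
  from integral_reflect[OF this, of 0] integral_reflect[OF assms, of w] show ?thesis by simp
qed

text \<open>Translation invariance says that the integral of the difference quotients vanishes.\<close>

lemma integral_directional_derivative_eq_0:
  fixes \<psi> :: "real^3 \<Rightarrow> real"
  assumes \<psi>: "\<And>x. (\<psi> has_derivative \<psi>' x) (at x)"
    and cont: "continuous_on UNIV (\<lambda>x. \<psi>' x v)"
    and supp: "\<And>x. r < norm x \<Longrightarrow> \<psi> x = 0" "\<And>x. r < norm x \<Longrightarrow> \<psi>' x v = 0"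
  shows "(LINT x|lebesgue. \<psi>' x v) = 0"
proof -
  \<comment> \<open>Steps of length at most 1 keep the supports of all difference quotients in the
    ball of radius \<open>r + norm v\<close>, which gives one integrable majorant.\<close>
  define t where "t n = 1 / real (Suc n)" for n
  have t: "0 < t n" "t n \<le> 1" for n by (simp_all add: t_def)
  have t0: "t \<longlonglongrightarrow> 0"
    unfolding t_def using LIMSEQ_inverse_real_of_nat by (simp add: inverse_eq_divide)
  define s where "s n x = (\<psi> (t n *\<^sub>R v + x) - \<psi> x) / t n" for n x
  have cont\<psi>: "continuous_on UNIV \<psi>"
    by (simp add: continuous_on_eq_continuous_at has_derivative_continuous[OF \<psi>])
  note meas = continuous_on_borel_measurable_lebesgue
  have cs: "compact (cball (0::real^3) r)" by simp
  have supp\<psi>: "{x. \<psi> x \<noteq> 0} \<subseteq> cball 0 r" "{x. \<psi>' x v \<noteq> 0} \<subseteq> cball 0 r"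
    using supp by (auto simp: not_less[symmetric])
  obtain B where B: "0 \<le> B" "\<And>x. norm (\<psi>' x v) \<le> B * indicator (cball 0 r) x"
    by (rule compact_support_bounded[OF cont cs supp\<psi>(2)]) blast
  have B': "norm (\<psi>' x v) \<le> B" for x
    using B(2)[of x] B(1) by (auto split: split_indicator_asm)
  obtain C where C: "0 \<le> C" "\<And>x. norm (\<psi> x) \<le> C * indicator (cball 0 r) x"
    by (rule compact_support_bounded[OF cont\<psi> cs supp\<psi>(1)]) blast
  have ind: "integrable lebesgue (\<lambda>x. c * indicator (cball (0::real^3) q) x :: real)" for c q
    using lmeasurable_iff_integrable[of "cball (0::real^3) q"] by simp
  have int\<psi>: "integrable lebesgue \<psi>"
    by (rule Bochner_Integration.integrable_bound[OF ind[of C r] meas[OF cont\<psi>]])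
       (use C in \<open>auto intro!: AE_I2\<close>)
  have int\<psi>t: "integrable lebesgue (\<lambda>x. \<psi> (w + x))" for w
  proof (rule Bochner_Integration.integrable_bound[OF ind[of C "r + norm w"]])
    show "(\<lambda>x. \<psi> (w + x)) \<in> borel_measurable lebesgue"
      by (intro meas continuous_on_compose2[OF cont\<psi>] continuous_intros) auto
    have "norm (\<psi> (w + x)) \<le> C * indicator (cball 0 (r + norm w)) x" for x
    proof (cases "w + x \<in> cball 0 r")
      case True
      then have "x \<in> cball 0 (r + norm w)"
        using norm_triangle_ineq4[of "w + x" w] by simp
      then show ?thesis using C(2)[of "w + x"] True by simp
    next
      case False
      then show ?thesis using C(2)[of "w + x"] C(1) by simp
    qed
    then show "AE x in lebesgue. norm (\<psi> (w + x)) \<le> norm (C * indicator (cball 0 (r + norm w)) x :: real)"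
      using C(1) by (intro AE_I2) simp
  qed
  have s0: "(LINT x|lebesgue. s n x) = 0" for n
    using integral_translate[OF meas[OF cont\<psi>], of "t n *\<^sub>R v"] int\<psi> int\<psi>t by (simp add: s_def)
  have "(\<lambda>n. LINT x|lebesgue. s n x) \<longlonglongrightarrow> (LINT x|lebesgue. \<psi>' x v)"
  proof (rule integral_dominated_convergence)
    show "(\<lambda>x. \<psi>' x v) \<in> borel_measurable lebesgue" by (rule meas[OF cont])
    show "s n \<in> borel_measurable lebesgue" for n
      unfolding s_def using t(1)[of n]
      by (intro meas continuous_intros continuous_on_compose2[OF cont\<psi>]) auto
    show "integrable lebesgue (\<lambda>x. B * indicator (cball (0::real^3) (r + norm v)) x :: real)" by (rule ind)
    show "AE x in lebesgue. (\<lambda>n. s n x) \<longlonglongrightarrow> \<psi>' x v"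
    proof (rule AE_I2)
      fix x
      have "((\<lambda>h. (\<psi> (x + h *\<^sub>R v) - \<psi> x) / h) \<longlongrightarrow> \<psi>' x v) (at 0)"
        using DERIV_along_line[of \<psi> \<psi>' x v 0, OF \<psi>] by (simp add: DERIV_def)
      moreover have "filterlim t (at 0) sequentially"
        using t0 t(1) by (simp add: filterlim_at less_imp_neq[symmetric] eventually_sequentially)
      ultimately have "(\<lambda>n. (\<psi> (x + t n *\<^sub>R v) - \<psi> x) / t n) \<longlonglongrightarrow> \<psi>' x v"
        by (rule filterlim_compose)
      then show "(\<lambda>n. s n x) \<longlonglongrightarrow> \<psi>' x v" by (simp add: s_def add.commute)
    qed
    show "AE x in lebesgue. norm (s n x) \<le> B * indicator (cball 0 (r + norm v)) x" for n
    proof (rule AE_I2)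
      fix x :: "real^3"
      show "norm (s n x) \<le> B * indicator (cball 0 (r + norm v)) x"
      proof (cases "x \<in> cball 0 (r + norm v)")
        case True
        \<comment> \<open>By the mean value theorem a difference quotient is a value of the
          derivative and therefore bounded by \<open>B\<close>.\<close>
        obtain z where "\<psi> (x + t n *\<^sub>R v) - \<psi> (x + 0 *\<^sub>R v) = (t n - 0) * \<psi>' (x + z *\<^sub>R v) v"
          using MVT2[OF t(1)[of n] DERIV_along_line[of \<psi> \<psi>' x v, OF \<psi>]] by blast
        then have "s n x = \<psi>' (x + z *\<^sub>R v) v" using t(1)[of n] by (simp add: s_def add.commute)
        then show ?thesis using B'[of "x + z *\<^sub>R v"] True by simp
      next
        case False
        then have x: "r + norm v < norm x" by simp
        moreover have "norm (t n *\<^sub>R v) \<le> norm v" using t[of n] by (simp add: mult_left_le_one_le)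
        moreover have "norm x \<le> norm (t n *\<^sub>R v + x) + norm (t n *\<^sub>R v)"
          using norm_triangle_ineq4[of "t n *\<^sub>R v + x" "t n *\<^sub>R v"] by simp
        ultimately have "r < norm (t n *\<^sub>R v + x)" "r < norm x" using norm_ge_zero[of v] by linarith+
        then show ?thesis using supp(1) B(1) by (simp add: s_def)
      qed
    qed
  qed
  then show ?thesis by (simp add: s0 LIMSEQ_const_iff)
qed

lemma norm_abs_L2_mono:
  assumes u: "u \<in> square_integrable" and v: "v \<in> square_integrable" and c: "0 \<le> c"
    and le: "\<And>x. norm (u x) \<le> c * norm (v x)"
  shows "norm (abs_L2 u) \<le> c * norm (abs_L2 v)"
proof -
  have "(norm (abs_L2 u))\<^sup>2 \<le> (LINT x|lebesgue. c\<^sup>2 * (norm (v x))\<^sup>2)"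
    unfolding power2_norm_abs_L2[OF u]
  proof (rule integral_mono)
    show "integrable lebesgue (\<lambda>x. c\<^sup>2 * (norm (v x))\<^sup>2)" using square_integrable_norm2[OF v] by simp
    show "(norm (u x))\<^sup>2 \<le> c\<^sup>2 * (norm (v x))\<^sup>2" for x
      using power_mono[OF le[of x], of 2] by (simp add: power_mult_distrib)
  qed (rule square_integrable_norm2[OF u])
  also have "\<dots> = (c * norm (abs_L2 v))\<^sup>2" by (simp add: power_mult_distrib power2_norm_abs_L2[OF v])
  finally show ?thesis by (rule power2_le_imp_le) (use c in simp)
qed

text \<open>Integrate the derivative of \<open>x\<^sub>1 |\<phi>|\<^sup>2\<close> in the direction of the first coordinate.\<close>

lemma poincare:
  assumes \<phi>: "\<phi> \<in> test_functions \<Omega>" and \<Omega>: "\<Omega> \<subseteq> cball 0 r" and r0: "0 \<le> r"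
  shows "norm (abs_L2 \<phi>) \<le> 2 * r * norm (abs_L2 (grad \<phi>))"
proof -
  define e where "e = (axis 1 1 :: real^3)"
  have e: "norm e = 1" by (simp add: e_def)
  define d where "d = partial 1 \<phi>"
  have D: "(\<phi> has_derivative frechet_derivative \<phi> (at x)) (at x)" for x
    by (rule smooth_has_derivative[OF test_functions_smooth[OF \<phi>]])
  have d: "d \<in> test_functions \<Omega>" unfolding d_def by (rule test_functions_partial[OF \<phi>])
  obtain S where S: "compact S" "S \<subseteq> \<Omega>" "{x. \<phi> x \<noteq> 0} \<subseteq> S" using \<phi> by (auto simp: test_functions_iff)
  have sq: "\<phi> \<in> square_integrable" "d \<in> square_integrable" "grad \<phi> \<in> square_integrable"
    by (intro test_functions_square_integrable[of _ \<Omega>] \<phi> d test_functions_grad)+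
  have c\<phi>: "continuous_on UNIV \<phi>" and cd: "continuous_on UNIV d"
    by (intro smooth_continuous test_functions_smooth[of _ \<Omega>] \<phi> d)+
  have xsq: "(\<lambda>x. (x \<bullet> e) *\<^sub>R \<phi> x) \<in> square_integrable"
    by (rule compact_support_square_integrable[OF _ S(1)]) (use S(3) c\<phi> in \<open>auto intro!: continuous_intros\<close>)
  \<comment> \<open>This is the product rule for
    \<open>(x \<bullet> e) * (\<phi> x \<bullet> \<phi> x)\<close>. In the unit direction
    \<open>e\<close> the derivative of the weight is 1, which produces the term
    \<open>\<phi> x \<bullet> \<phi> x\<close>.\<close>
  define \<psi>' where "\<psi>' x v = (x \<bullet> e) * (\<phi> x \<bullet> frechet_derivative \<phi> (at x) v + frechet_derivative \<phi> (at x) v \<bullet> \<phi> x) + (v \<bullet> e) * (\<phi> x \<bullet> \<phi> x)" for x v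
  have zero: "\<phi> x = 0" "d x = 0" if "r < norm x" for x
    using that \<Omega> fun_cong[OF restr_test_function[OF \<phi>], of x] fun_cong[OF restr_test_function[OF d], of x]
    by (auto simp: restr_def split: if_splits)
  have \<psi>'e: "\<psi>' x e = 2 * (((x \<bullet> e) *\<^sub>R \<phi> x) \<bullet> d x) + \<phi> x \<bullet> \<phi> x" for x
    using e by (simp add: \<psi>'_def d_def partial_def e_def[symmetric] inner_commute norm_eq_1)
  have "(LINT x|lebesgue. \<psi>' x e) = 0"
  proof (rule integral_directional_derivative_eq_0)
    show "((\<lambda>x. (x \<bullet> e) * (\<phi> x \<bullet> \<phi> x)) has_derivative \<psi>' x) (at x)" for x
      unfolding \<psi>'_def by (rule derivative_eq_intros D refl | simp)+
    show "continuous_on UNIV (\<lambda>x. \<psi>' x e)"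
      unfolding \<psi>'e by (intro continuous_intros c\<phi> cd)
    show "(x \<bullet> e) * (\<phi> x \<bullet> \<phi> x) = 0" "\<psi>' x e = 0" if "r < norm x" for x
      using zero[OF that] by (auto simp: \<psi>'e)
  qed
  \<comment> \<open>The squared norm of \<phi> is minus twice the inner product of
    \<open>(x \<bullet> e) *\<^sub>R \<phi> x\<close> with the first partial derivative. The weight
    is at most \<open>r\<close> on the support, so Cauchy-Schwarz gives the constant
    \<open>2 * r\<close> after one norm is cancelled.\<close>
  then have "2 * (abs_L2 (\<lambda>x. (x \<bullet> e) *\<^sub>R \<phi> x) \<bullet> abs_L2 d) + abs_L2 \<phi> \<bullet> abs_L2 \<phi> = 0"
    using Bochner_Integration.integral_add[OF integrable_mult_right[OF integrable_inner[OF xsq sq(2)], of 2]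
        integrable_inner[OF sq(1) sq(1)]]
    unfolding \<psi>'e inner_abs_L2[OF xsq sq(2)] inner_abs_L2[OF sq(1) sq(1)] integral_mult_right_zero by simp
  then have "(norm (abs_L2 \<phi>))\<^sup>2 \<le> 2 * \<bar>abs_L2 (\<lambda>x. (x \<bullet> e) *\<^sub>R \<phi> x) \<bullet> abs_L2 d\<bar>"
    by (simp add: power2_norm_eq_inner)
  also have "\<dots> \<le> 2 * (norm (abs_L2 (\<lambda>x. (x \<bullet> e) *\<^sub>R \<phi> x)) * norm (abs_L2 d))"
    using Cauchy_Schwarz_ineq2 by simp
  also have "\<dots> \<le> 2 * ((r * norm (abs_L2 \<phi>)) * (1 * norm (abs_L2 (grad \<phi>))))"
  proof (intro mult_left_mono mult_mono)
    show "norm (abs_L2 (\<lambda>x. (x \<bullet> e) *\<^sub>R \<phi> x)) \<le> r * norm (abs_L2 \<phi>)"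
    proof (rule norm_abs_L2_mono[OF xsq sq(1) r0])
      fix x
      have "\<bar>x \<bullet> e\<bar> \<le> r" if "\<phi> x \<noteq> 0"
        using Cauchy_Schwarz_ineq2[of x e] e zero(1)[of x] that by fastforce
      then show "norm ((x \<bullet> e) *\<^sub>R \<phi> x) \<le> r * norm (\<phi> x)"
        by (cases "\<phi> x = 0") (auto intro: mult_right_mono)
    qed
    show "norm (abs_L2 d) \<le> 1 * norm (abs_L2 (grad \<phi>))"
    proof (rule norm_abs_L2_mono[OF sq(2,3)])
      fix x
      show "norm (d x) \<le> 1 * norm (grad \<phi> x)"
        using Finite_Cartesian_Product.norm_nth_le[of "grad \<phi> x" 1] by (simp add: d_def grad_def)
    qed simp
  qed (use r0 in auto)
  finally have "norm (abs_L2 \<phi>) * norm (abs_L2 \<phi>) \<le> norm (abs_L2 \<phi>) * (2 * r * norm (abs_L2 (grad \<phi>)))"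
    by (simp add: power2_eq_square ac_simps)
  then show ?thesis
    using r0 by (cases "abs_L2 \<phi> = 0") auto
qed

section \<open>The graph space of the gradient\<close>

lemma closure_subspace:
  fixes S :: "'a::real_normed_vector set"
  assumes "subspace S"
  shows "subspace (closure S)"
proof (rule subspaceI)
  show "0 \<in> closure S" using subspace_0[OF assms] closure_subset by blast
next
  fix x y assume "x \<in> closure S" "y \<in> closure S"
  then obtain X Y where XY: "\<And>n. X n \<in> S" "X \<longlonglongrightarrow> x" "\<And>n. Y n \<in> S" "Y \<longlonglongrightarrow> y"
    unfolding closure_sequential by auto
  show "x + y \<in> closure S"
    unfolding closure_sequential
    by (rule exI[of _ "\<lambda>n. X n + Y n"]) (auto intro!: tendsto_add XY subspace_add[OF assms])
next
  fix c x assume "x \<in> closure S"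
  then obtain X where X: "\<And>n. X n \<in> S" "X \<longlonglongrightarrow> x"
    unfolding closure_sequential by auto
  show "c *\<^sub>R x \<in> closure S"
    unfolding closure_sequential
    by (rule exI[of _ "\<lambda>n. c *\<^sub>R X n"]) (auto intro!: tendsto_scaleR tendsto_const X subspace_scale[OF assms])
qed

lemma L2_closure_graph_iff:
  "(u, v) \<in> L2_closure \<Omega> {(\<phi>, D \<phi>) | \<phi>. \<phi> \<in> T} \<longleftrightarrow> u \<in> L2_space \<Omega> \<and> v \<in> L2_space \<Omega> \<and>
    (\<exists>\<phi>. (\<forall>n. \<phi> n \<in> T) \<and> (\<lambda>n. L2_norm \<Omega> (\<lambda>x. \<phi> n x - u x)) \<longlonglongrightarrow> 0 \<and>
      (\<lambda>n. L2_norm \<Omega> (\<lambda>x. D (\<phi> n) x - v x)) \<longlonglongrightarrow> 0)" (is "?L \<longleftrightarrow> ?R")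
proof
  assume ?L
  then obtain p q where uv: "u \<in> L2_space \<Omega>" "v \<in> L2_space \<Omega>"
    and pq: "\<forall>n. (p n, q n) \<in> {(\<phi>, D \<phi>) | \<phi>. \<phi> \<in> T}"
    and lim: "(\<lambda>n. L2_norm \<Omega> (\<lambda>x. p n x - u x)) \<longlonglongrightarrow> 0" "(\<lambda>n. L2_norm \<Omega> (\<lambda>x. q n x - v x)) \<longlonglongrightarrow> 0"
    unfolding L2_closure_def mem_Collect_eq case_prod_conv by (elim conjE exE)
  have "p n \<in> T" "q n = D (p n)" for n using spec[OF pq, of n] by auto
  with uv lim show ?R by (intro conjI exI[of _ p]) auto
next
  assume ?R
  then obtain \<phi> where "u \<in> L2_space \<Omega>" "v \<in> L2_space \<Omega>" "\<forall>n. \<phi> n \<in> T"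
    "(\<lambda>n. L2_norm \<Omega> (\<lambda>x. \<phi> n x - u x)) \<longlonglongrightarrow> 0" "(\<lambda>n. L2_norm \<Omega> (\<lambda>x. D (\<phi> n) x - v x)) \<longlonglongrightarrow> 0"
    by (elim conjE exE)
  then show ?L
    unfolding L2_closure_def mem_Collect_eq case_prod_conv
    by (intro conjI exI[of _ \<phi>] exI[of _ "\<lambda>n. D (\<phi> n)"]) auto
qed

text \<open>The graph of the gradient with zero boundary values, at the level of classes. As a
  closed subspace of the product Hilbert space it is the space on which the linear problems are
  posed.\<close>

definition graph0 :: "(real^3) set \<Rightarrow> ((real^3, complex) L2 \<times> (real^3, complex^3) L2) set" where
  "graph0 \<Omega> = closure ((\<lambda>\<phi>. (emb \<Omega> \<phi>, emb \<Omega> (grad \<phi>))) ` test_functions \<Omega>)"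

lemma closed_graph0: "closed (graph0 \<Omega>)"
  by (simp add: graph0_def)

context
  fixes \<Omega> :: "(real^3) set"
  assumes meas: "\<Omega> \<in> sets lebesgue"
begin

lemma test_functions_L2_space:
  fixes \<phi> :: "real^3 \<Rightarrow> 'b::euclidean_space"
  shows "\<phi> \<in> test_functions \<Omega> \<Longrightarrow> \<phi> \<in> L2_space \<Omega>"
  by (intro square_integrable_L2_space meas test_functions_square_integrable)

lemma subspace_graph0: "subspace (graph0 \<Omega>)"
  unfolding graph0_def
proof (intro closure_subspace subspaceI)
  let ?G = "(\<lambda>\<phi>. (emb \<Omega> \<phi>, emb \<Omega> (grad \<phi>))) ` test_functions \<Omega>"
  note T = test_functions_L2_space test_functions_grad test_functions_smooth
  fix p q assume "p \<in> ?G" "q \<in> ?G"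
  then obtain \<phi> \<psi> where \<phi>: "\<phi> \<in> test_functions \<Omega>" "p = (emb \<Omega> \<phi>, emb \<Omega> (grad \<phi>))"
    and \<psi>: "\<psi> \<in> test_functions \<Omega>" "q = (emb \<Omega> \<psi>, emb \<Omega> (grad \<psi>))" by blast
  have "p + q = (emb \<Omega> (\<lambda>x. \<phi> x + \<psi> x), emb \<Omega> (grad (\<lambda>x. \<phi> x + \<psi> x)))"
    using \<phi> \<psi> by (simp add: grad_add[OF T(3) T(3)] emb_add[OF meas] T)
  then show "p + q \<in> ?G" using test_functions_add[OF \<phi>(1) \<psi>(1)] by blast
next
  let ?G = "(\<lambda>\<phi>. (emb \<Omega> \<phi>, emb \<Omega> (grad \<phi>))) ` test_functions \<Omega>"
  note T = test_functions_L2_space test_functions_grad test_functions_smooth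
  fix c p assume "p \<in> ?G"
  then obtain \<phi> where \<phi>: "\<phi> \<in> test_functions \<Omega>" "p = (emb \<Omega> \<phi>, emb \<Omega> (grad \<phi>))" by blast
  have "c *\<^sub>R p = (emb \<Omega> (\<lambda>x. c *\<^sub>R \<phi> x), emb \<Omega> (grad (\<lambda>x. c *\<^sub>R \<phi> x)))"
    using \<phi> by (simp add: grad_scaleR[OF T(3)] emb_scaleR[OF meas] T)
  then show "c *\<^sub>R p \<in> ?G" using test_functions_bounded_linear[OF bounded_linear_scaleR_right \<phi>(1)] by blast
next
  \<comment> \<open>Zero is written as a scalar multiple by 0, so that the gradient and the class of
    the zero function come from the scaling laws.\<close>
  have "(0, 0) = (emb \<Omega> (\<lambda>x. 0 *\<^sub>R 0 :: complex), emb \<Omega> (grad (\<lambda>x. 0 *\<^sub>R 0)))"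
    using test_functions_zero[of \<Omega>, where 'a=complex]
    by (subst emb_scaleR[OF meas], simp add: test_functions_L2_space,
        subst grad_scaleR[OF test_functions_smooth], assumption,
        subst emb_scaleR[OF meas], simp add: test_functions_L2_space test_functions_grad, simp)
  then show "0 \<in> (\<lambda>\<phi>. (emb \<Omega> \<phi>, emb \<Omega> (grad \<phi>))) ` test_functions \<Omega>"
    using test_functions_zero[of \<Omega>, where 'a=complex] by (auto simp: zero_prod_def)
qed

lemma graph0_approximation:
  assumes "(U, Z) \<in> graph0 \<Omega>"
  obtains \<phi> where "\<And>n. \<phi> n \<in> test_functions \<Omega>" "(\<lambda>n. emb \<Omega> (\<phi> n)) \<longlonglongrightarrow> U" "(\<lambda>n. emb \<Omega> (grad (\<phi> n))) \<longlonglongrightarrow> Z"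
proof -
  obtain X where X: "\<And>n. X n \<in> (\<lambda>\<phi>. (emb \<Omega> \<phi>, emb \<Omega> (grad \<phi>))) ` test_functions \<Omega>" "X \<longlonglongrightarrow> (U, Z)"
    using assms unfolding graph0_def closure_sequential by auto
  have "\<exists>\<phi>. \<phi> \<in> test_functions \<Omega> \<and> X n = (emb \<Omega> \<phi>, emb \<Omega> (grad \<phi>))" for n using X(1)[of n] by blast
  then obtain \<phi> where \<phi>: "\<And>n. \<phi> n \<in> test_functions \<Omega>" "\<And>n. X n = (emb \<Omega> (\<phi> n), emb \<Omega> (grad (\<phi> n)))" by metis
  have "(\<lambda>n. fst (X n)) \<longlonglongrightarrow> fst (U, Z)" "(\<lambda>n. snd (X n)) \<longlonglongrightarrow> snd (U, Z)"
    by (intro tendsto_intros X(2))+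
  then show ?thesis by (intro that[of \<phi>]) (simp_all add: \<phi>)
qed

lemma L2_norm_tendsto_0_iff:
  assumes "\<And>n. p n \<in> L2_space \<Omega>" "u \<in> L2_space \<Omega>"
  shows "(\<lambda>n. L2_norm \<Omega> (\<lambda>x. p n x - u x)) \<longlonglongrightarrow> 0 \<longleftrightarrow> (\<lambda>n. emb \<Omega> (p n)) \<longlonglongrightarrow> emb \<Omega> u"
proof -
  have "L2_norm \<Omega> (\<lambda>x. p n x - u x) = norm (emb \<Omega> (p n) - emb \<Omega> u)" for n
    using assms by (simp add: norm_emb[OF meas, symmetric] L2_space_diff[OF meas] emb_diff[OF meas])
  then show ?thesis by (simp add: tendsto_norm_zero_iff LIM_zero_iff)
qed

text \<open>It lets the variational identity, obtained for classes in \<open>graph0\<close>, be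
  tested with the representatives that occur in \<open>div_op\<close>.\<close>

lemma grad0_graph0:
  assumes "(u, z) \<in> grad0 \<Omega>"
  shows "(emb \<Omega> u, emb \<Omega> z) \<in> graph0 \<Omega>"
proof -
  obtain p where uz: "u \<in> L2_space \<Omega>" "z \<in> L2_space \<Omega>" and p: "\<forall>n. p n \<in> test_functions \<Omega>"
    and lim: "(\<lambda>n. L2_norm \<Omega> (\<lambda>x. p n x - u x)) \<longlonglongrightarrow> 0" "(\<lambda>n. L2_norm \<Omega> (\<lambda>x. grad (p n) x - z x)) \<longlonglongrightarrow> 0"
    using assms unfolding grad0_def L2_closure_graph_iff by (elim conjE exE)
  have "(\<lambda>n. emb \<Omega> (p n)) \<longlonglongrightarrow> emb \<Omega> u"
    using lim(1) L2_norm_tendsto_0_iff[OF test_functions_L2_space[OF spec[OF p]] uz(1)] by simp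
  moreover have "(\<lambda>n. emb \<Omega> (grad (p n))) \<longlonglongrightarrow> emb \<Omega> z"
    using lim(2) L2_norm_tendsto_0_iff[OF test_functions_L2_space[OF test_functions_grad[OF spec[OF p]]] uz(2)] by simp
  ultimately have "(\<lambda>n. (emb \<Omega> (p n), emb \<Omega> (grad (p n)))) \<longlonglongrightarrow> (emb \<Omega> u, emb \<Omega> z)"
    by (rule tendsto_Pair)
  then show ?thesis
    unfolding graph0_def closure_sequential using p by (intro exI[of _ "\<lambda>n. (emb \<Omega> (p n), emb \<Omega> (grad (p n)))"]) auto
qed

text \<open>Gradients of test functions vanish outside \<Omega>, and the cut-off is continuous.
  Hence \<open>Z\<close> may be identified with a field on \<Omega>.\<close>

lemma graph0_supported:
  assumes "(U, Z) \<in> graph0 \<Omega>"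
  shows "emb \<Omega> (rep_L2 Z) = Z"
proof -
  obtain \<phi> where \<phi>: "\<And>n. \<phi> n \<in> test_functions \<Omega>" "(\<lambda>n. emb \<Omega> (grad (\<phi> n))) \<longlonglongrightarrow> Z"
    by (rule graph0_approximation[OF assms]) blast
  have "(\<lambda>n. emb \<Omega> (rep_L2 (emb \<Omega> (grad (\<phi> n))))) \<longlonglongrightarrow> emb \<Omega> (rep_L2 Z)"
    by (rule bounded_linear.tendsto[OF bounded_linear_emb_rep[OF meas] \<phi>(2)])
  moreover have "emb \<Omega> (rep_L2 (emb \<Omega> (grad (\<phi> n)))) = emb \<Omega> (grad (\<phi> n))" for n
    by (intro emb_rep_emb meas test_functions_L2_space test_functions_grad \<phi>(1))
  ultimately show ?thesis using \<phi>(2) LIMSEQ_unique by auto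
qed

lemma graph0_poincare:
  assumes "(U, Z) \<in> graph0 \<Omega>" "\<Omega> \<subseteq> cball 0 r" "0 \<le> r"
  shows "norm U \<le> 2 * r * norm Z"
proof -
  obtain \<phi> where \<phi>: "\<And>n. \<phi> n \<in> test_functions \<Omega>" "(\<lambda>n. emb \<Omega> (\<phi> n)) \<longlonglongrightarrow> U" "(\<lambda>n. emb \<Omega> (grad (\<phi> n))) \<longlonglongrightarrow> Z"
    by (rule graph0_approximation[OF assms(1)]) blast
  have "norm (emb \<Omega> (\<phi> n)) \<le> 2 * r * norm (emb \<Omega> (grad (\<phi> n)))" for n
    using poincare[OF \<phi>(1) assms(2,3)] \<phi>(1) test_functions_grad[OF \<phi>(1)] by (simp add: emb_def restr_test_function)
  then show ?thesis
    by (intro LIMSEQ_le[OF tendsto_norm[OF \<phi>(2)] tendsto_mult[OF tendsto_const tendsto_norm[OF \<phi>(3)]]]) auto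
qed

text \<open>Replacing \<open>u\<close> by \<open>\<i> * u\<close> recovers the imaginary part of an
  identity that the real theory gives only for real parts.\<close>

lemma grad0_mult_i:
  assumes "(u, z) \<in> grad0 \<Omega>"
  shows "(\<lambda>x. \<i> * u x, \<lambda>x. \<i> *s z x) \<in> grad0 \<Omega>"
proof -
  obtain p where uz: "u \<in> L2_space \<Omega>" "z \<in> L2_space \<Omega>" and p: "\<forall>n. p n \<in> test_functions \<Omega>"
    and lim: "(\<lambda>n. L2_norm \<Omega> (\<lambda>x. p n x - u x)) \<longlonglongrightarrow> 0" "(\<lambda>n. L2_norm \<Omega> (\<lambda>x. grad (p n) x - z x)) \<longlonglongrightarrow> 0"
    using assms unfolding grad0_def L2_closure_graph_iff by (elim conjE exE)
  have bl: "bounded_linear ((*) \<i>)" "bounded_linear ((*s) \<i> :: complex^3 \<Rightarrow> _)"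
    by (rule bounded_linear_mult_right, rule bounded_bilinear.bounded_linear_right[OF bounded_bilinear_smult])
  have "L2_norm \<Omega> (\<lambda>x. \<i> * p n x - \<i> * u x) = L2_norm \<Omega> (\<lambda>x. p n x - u x)" for n
    by (simp add: L2_norm_def norm_mult flip: right_diff_distrib)
  moreover have "L2_norm \<Omega> (\<lambda>x. grad (\<lambda>x. \<i> * p n x) x - \<i> *s z x) = L2_norm \<Omega> (\<lambda>x. grad (p n) x - z x)" for n
    unfolding grad_mult[OF test_functions_smooth[OF spec[OF p]]] L2_norm_def norm_vector_smult
      bounded_bilinear.diff_right[OF bounded_bilinear_smult, symmetric] by simp
  moreover have "(\<lambda>x. \<i> * p n x) \<in> test_functions \<Omega>" for n
    by (rule test_functions_bounded_linear[OF bl(1) spec[OF p]])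
  moreover have "(\<lambda>x. \<i> * u x) \<in> L2_space \<Omega>" "(\<lambda>x. \<i> *s z x) \<in> L2_space \<Omega>"
    by (rule L2_space_bounded_linear[OF meas bl(1) uz(1)], rule L2_space_bounded_linear[OF meas bl(2) uz(2)])
  ultimately show ?thesis
    unfolding grad0_def L2_closure_graph_iff using lim by (intro conjI exI[of _ "\<lambda>n x. \<i> * p n x"]) auto
qed

text \<open>Gradients of test functions approximating \<open>Z\<close> are added to the approximants
  of \<open>e\<close>. Their curl is 0, so the curls still converge to \<open>g\<close>.\<close>

lemma curl0_add_graph0:
  assumes eg: "(e, g) \<in> curl0 \<Omega>" and UZ: "(U, Z) \<in> graph0 \<Omega>"
  shows "(\<lambda>x. e x + rep_L2 Z x, g) \<in> curl0 \<Omega>"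
proof -
  obtain p where e: "e \<in> L2_space \<Omega>" "g \<in> L2_space \<Omega>" and p': "\<forall>n. p n \<in> test_functions \<Omega>"
    and lim: "(\<lambda>n. L2_norm \<Omega> (\<lambda>x. p n x - e x)) \<longlonglongrightarrow> 0" "(\<lambda>n. L2_norm \<Omega> (\<lambda>x. curl (p n) x - g x)) \<longlonglongrightarrow> 0"
    using eg unfolding curl0_def L2_closure_graph_iff by (elim conjE exE)
  note p = spec[OF p']
  obtain \<phi> where \<phi>: "\<And>n. \<phi> n \<in> test_functions \<Omega>" "(\<lambda>n. emb \<Omega> (grad (\<phi> n))) \<longlonglongrightarrow> Z"
    by (rule graph0_approximation[OF UZ]) blast
  define P where "P n = (\<lambda>x. p n x + grad (\<phi> n) x)" for n
  have P: "P n \<in> test_functions \<Omega>" for n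
    unfolding P_def by (intro test_functions_add p test_functions_grad \<phi>(1))
  have "curl (P n) = curl (p n)" for n
    using p \<phi>(1) by (simp add: P_def curl_add test_functions_smooth[of _ \<Omega>] test_functions_grad curl_grad)
  then have "(\<lambda>n. L2_norm \<Omega> (\<lambda>x. curl (P n) x - g x)) \<longlonglongrightarrow> 0" using lim(2) by simp
  moreover have eZ: "(\<lambda>x. e x + rep_L2 Z x) \<in> L2_space \<Omega>"
    by (intro L2_space_add[OF meas] e rep_L2_space[OF meas])
  moreover have "(\<lambda>n. L2_norm \<Omega> (\<lambda>x. P n x - (e x + rep_L2 Z x))) \<longlonglongrightarrow> 0"
  proof (subst L2_norm_tendsto_0_iff[OF test_functions_L2_space[OF P] eZ])
    have "(\<lambda>n. emb \<Omega> (p n)) \<longlonglongrightarrow> emb \<Omega> e"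
      using lim(1) L2_norm_tendsto_0_iff[OF test_functions_L2_space[OF p] e(1)] by simp
    then have "(\<lambda>n. emb \<Omega> (p n) + emb \<Omega> (grad (\<phi> n))) \<longlonglongrightarrow> emb \<Omega> e + Z"
      by (intro tendsto_add \<phi>(2))
    moreover have "emb \<Omega> (P n) = emb \<Omega> (p n) + emb \<Omega> (grad (\<phi> n))" for n
      unfolding P_def by (intro emb_add[OF meas] test_functions_L2_space p test_functions_grad \<phi>(1))
    moreover have "emb \<Omega> (\<lambda>x. e x + rep_L2 Z x) = emb \<Omega> e + Z"
      using emb_add[OF meas e(1) rep_L2_space[OF meas], of Z] graph0_supported[OF UZ] by simp
    ultimately show "(\<lambda>n. emb \<Omega> (P n)) \<longlonglongrightarrow> emb \<Omega> (\<lambda>x. e x + rep_L2 Z x)" by simp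
  qed
  ultimately show ?thesis
    unfolding curl0_def L2_closure_graph_iff using e(2) P by (intro conjI exI[of _ P]) auto
qed

section \<open>Scalar products and the material law\<close>

lemma integrable_cnj_mult:
  fixes u v :: "'a::euclidean_space \<Rightarrow> complex"
  assumes u: "u \<in> square_integrable" and v: "v \<in> square_integrable"
  shows "integrable lebesgue (\<lambda>x. cnj (u x) * v x)"
proof (rule Bochner_Integration.integrable_bound[OF integrable_norm_mult[OF u v]])
  show "(\<lambda>x. cnj (u x) * v x) \<in> borel_measurable lebesgue"
    by (intro borel_measurable_times square_integrable_measurable v
        square_integrable_bounded_linear[OF bounded_linear_cnj u])
qed (simp add: norm_mult)

lemma L2_inner_Re:
  assumes "u \<in> L2_space \<Omega>" "v \<in> L2_space \<Omega>"
  shows "Re (L2_inner \<Omega> u v) = emb \<Omega> u \<bullet> emb \<Omega> v"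
proof -
  let ?f = "\<lambda>x. cnj (restr \<Omega> u x) * restr \<Omega> v x"
  have s: "restr \<Omega> u \<in> square_integrable" "restr \<Omega> v \<in> square_integrable"
    using assms by (simp_all add: L2_space_iff[OF meas])
  have I: "integrable lebesgue ?f" by (rule integrable_cnj_mult[OF s])
  have "restr \<Omega> (\<lambda>x. cnj (u x) * v x) = ?f" by (auto simp: restr_def)
  then have "Re (L2_inner \<Omega> u v) = Re (LINT x|lebesgue. ?f x)"
    by (simp add: L2_inner_def integral_lebesgue_on[OF meas])
  also have "\<dots> = (LINT x|lebesgue. Re (?f x))" by (rule integral_Re[OF I, symmetric])
  also have "\<dots> = emb \<Omega> u \<bullet> emb \<Omega> v"
    by (simp add: emb_def inner_abs_L2 s inner_complex_def)
  finally show ?thesis .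
qed

lemma L2_inner3_Re:
  assumes "u \<in> L2_space \<Omega>" "v \<in> L2_space \<Omega>"
  shows "Re (L2_inner3 \<Omega> u v) = emb \<Omega> u \<bullet> emb \<Omega> v"
proof -
  let ?f = "\<lambda>x. (\<Sum>i\<in>UNIV. cnj (restr \<Omega> u x $ i) * restr \<Omega> v x $ i)"
  have s: "restr \<Omega> u \<in> square_integrable" "restr \<Omega> v \<in> square_integrable"
    using assms by (simp_all add: L2_space_iff[OF meas])
  have I: "integrable lebesgue ?f"
  proof (rule Bochner_Integration.integrable_sum)
    show "integrable lebesgue (\<lambda>x. cnj (restr \<Omega> u x $ i) * restr \<Omega> v x $ i)" for i
      by (intro integrable_cnj_mult square_integrable_bounded_linear[OF bounded_linear_vec_nth] s)
  qed
  have "restr \<Omega> (\<lambda>x. \<Sum>i\<in>UNIV. cnj (u x $ i) * v x $ i) = ?f" by (auto simp: restr_def)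
  then have "Re (L2_inner3 \<Omega> u v) = Re (LINT x|lebesgue. ?f x)"
    by (simp add: L2_inner3_def integral_lebesgue_on[OF meas])
  also have "\<dots> = (LINT x|lebesgue. Re (?f x))" by (rule integral_Re[OF I, symmetric])
  also have "\<dots> = emb \<Omega> u \<bullet> emb \<Omega> v"
    by (simp add: emb_def inner_abs_L2 s inner_complex_def inner_vec_def)
  finally show ?thesis .
qed

text \<open>Conjugate linearity in the first argument turns \<open>\<i>\<close> into
  \<open>- \<i>\<close>, and the real part of \<open>- \<i> * z\<close> is the imaginary part of
  \<open>z\<close>.\<close>

lemma L2_inner_mult_i: "Re (L2_inner \<Omega> (\<lambda>x. \<i> * u x) v) = Im (L2_inner \<Omega> u v)"
proof -
  have "L2_inner \<Omega> (\<lambda>x. \<i> * u x) v = - \<i> * L2_inner \<Omega> u v"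
    unfolding L2_inner_def by (subst integral_mult_right_zero[symmetric]) (simp add: mult.assoc)
  then show ?thesis by simp
qed

lemma L2_inner3_mult_i: "Re (L2_inner3 \<Omega> (\<lambda>x. \<i> *s u x) v) = Im (L2_inner3 \<Omega> u v)"
proof -
  have "L2_inner3 \<Omega> (\<lambda>x. \<i> *s u x) v = - \<i> * L2_inner3 \<Omega> u v"
    unfolding L2_inner3_def by (subst integral_mult_right_zero[symmetric]) (simp add: sum_distrib_left mult.assoc)
  then show ?thesis by simp
qed

text \<open>The operator \<open>a\<close> acts on representatives but respects \<open>L2_eq\<close>,
  so it descends to classes.\<close>

lemma emb_bounded_op:
  assumes a: "L2_bounded_op \<Omega> a" and u: "u \<in> L2_space \<Omega>"
  shows "emb \<Omega> (a u) = emb \<Omega> (a (rep_L2 (emb \<Omega> u)))"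
proof -
  have R: "rep_L2 (emb \<Omega> u) \<in> L2_space \<Omega>" by (rule rep_L2_space[OF meas])
  have "L2_eq \<Omega> u (rep_L2 (emb \<Omega> u))"
    using emb_rep_emb[OF meas u] emb_eq_iff[OF meas u R] by simp
  then have "L2_eq \<Omega> (a u) (a (rep_L2 (emb \<Omega> u)))" using a u R unfolding L2_bounded_op_def by blast
  then show ?thesis using a u R by (subst emb_eq_iff[OF meas]) (auto simp: L2_bounded_op_def)
qed

lemma bounded_linear_bounded_op:
  assumes a: "L2_bounded_op \<Omega> a"
  shows "bounded_linear (\<lambda>U. emb \<Omega> (a (rep_L2 U)))"
proof -
  note R = rep_L2_space[OF meas]
  have aR: "u \<in> L2_space \<Omega> \<Longrightarrow> a u \<in> L2_space \<Omega>" for u using a by (auto simp: L2_bounded_op_def)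
  obtain C where C: "\<And>u. u \<in> L2_space \<Omega> \<Longrightarrow> L2_norm \<Omega> (a u) \<le> C * L2_norm \<Omega> u"
    using a unfolding L2_bounded_op_def by (elim conjE exE) (rule that, blast)
  have cong: "emb \<Omega> (a u) = emb \<Omega> (a v)" if "u \<in> L2_space \<Omega>" "v \<in> L2_space \<Omega>" "L2_eq \<Omega> u v" for u v
    using a that by (subst emb_eq_iff[OF meas]) (auto simp: L2_bounded_op_def)
  show ?thesis
  proof (rule bounded_linear_intro)
    fix U V :: "(real^3, complex^3) L2" and c
    have UV: "(\<lambda>x. rep_L2 U x + rep_L2 V x) \<in> L2_space \<Omega>" by (intro L2_space_add[OF meas] R)
    have "emb \<Omega> (a (rep_L2 (U + V))) = emb \<Omega> (a (\<lambda>x. rep_L2 U x + rep_L2 V x))"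
      by (rule cong[OF R UV L2_eq_rep_add[OF meas]])
    also have "\<dots> = emb \<Omega> (\<lambda>x. a (rep_L2 U) x + a (rep_L2 V) x)"
      using a R[of U] R[of V] aR[OF UV] aR[OF R[of U]] aR[OF R[of V]]
      by (subst emb_eq_iff[OF meas]) (auto simp: L2_bounded_op_def intro: L2_space_add[OF meas])
    also have "\<dots> = emb \<Omega> (a (rep_L2 U)) + emb \<Omega> (a (rep_L2 V))"
      by (intro emb_add[OF meas] aR R)
    finally show "emb \<Omega> (a (rep_L2 (U + V))) = emb \<Omega> (a (rep_L2 U)) + emb \<Omega> (a (rep_L2 V))" .
    have smult: "c *\<^sub>R v = complex_of_real c *s v" for v :: "complex^3"
      unfolding vec_eq_iff vector_smult_component vector_scaleR_component
      unfolding scaleR_conv_of_real by simp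
    have cU: "(\<lambda>x. c *\<^sub>R rep_L2 U x) \<in> L2_space \<Omega>" by (intro L2_space_scaleR[OF meas] R)
    have "emb \<Omega> (a (rep_L2 (c *\<^sub>R U))) = emb \<Omega> (a (\<lambda>x. c *\<^sub>R rep_L2 U x))"
      by (rule cong[OF R cU L2_eq_rep_scaleR[OF meas]])
    also have "\<dots> = emb \<Omega> (\<lambda>x. c *\<^sub>R a (rep_L2 U) x)"
    proof (subst emb_eq_iff[OF meas])
      show "a (\<lambda>x. c *\<^sub>R rep_L2 U x) \<in> L2_space \<Omega>" by (rule aR[OF cU])
      show "(\<lambda>x. c *\<^sub>R a (rep_L2 U) x) \<in> L2_space \<Omega>" by (intro L2_space_scaleR[OF meas] aR R)
      show "L2_eq \<Omega> (a (\<lambda>x. c *\<^sub>R rep_L2 U x)) (\<lambda>x. c *\<^sub>R a (rep_L2 U) x)"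
        unfolding smult using a R[of U] by (simp add: L2_bounded_op_def)
    qed
    also have "\<dots> = c *\<^sub>R emb \<Omega> (a (rep_L2 U))" by (intro emb_scaleR[OF meas] aR R)
    finally show "emb \<Omega> (a (rep_L2 (c *\<^sub>R U))) = c *\<^sub>R emb \<Omega> (a (rep_L2 U))" .
    have "norm (emb \<Omega> (a (rep_L2 U))) \<le> C * norm (emb \<Omega> (rep_L2 U))"
      using C[OF R] by (simp add: norm_emb[OF meas] aR R)
    \<comment> \<open>Nothing forces the constant \<open>C\<close> of \<open>L2_bounded_op\<close>
      to be nonnegative, hence the absolute value.\<close>
    also have "\<dots> \<le> \<bar>C\<bar> * norm U"
      by (intro mult_mono norm_emb_rep_le[OF meas]) auto
    finally show "norm (emb \<Omega> (a (rep_L2 U))) \<le> norm U * \<bar>C\<bar>" by (simp add: mult.commute)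
  qed
qed

text \<open>For the symmetric real inner product, \<open>a\<close> and its adjoint have the same
  quadratic form, so averaging them does not change it.\<close>

lemma L2_Re_ge_coercive:
  assumes a: "L2_bounded_op \<Omega> a" "L2_Re_ge \<Omega> c a" and u: "u \<in> L2_space \<Omega>"
  shows "c * (norm (emb \<Omega> u))\<^sup>2 \<le> emb \<Omega> u \<bullet> emb \<Omega> (a u)"
proof -
  obtain b where b: "L2_adjoint \<Omega> a b"
    and le: "c * (L2_norm \<Omega> u)\<^sup>2 \<le> Re (L2_inner3 \<Omega> u (\<lambda>x. (1/2) *s (a u x + b u x)))"
    using a(2) u unfolding L2_Re_ge_def by blast
  have au: "a u \<in> L2_space \<Omega>" and bu: "b u \<in> L2_space \<Omega>"
    using a(1) b u by (auto simp: L2_bounded_op_def L2_adjoint_def)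
  have "L2_inner3 \<Omega> (a u) u = L2_inner3 \<Omega> u (b u)" using b u by (simp add: L2_adjoint_def)
  then have ab: "emb \<Omega> (a u) \<bullet> emb \<Omega> u = emb \<Omega> u \<bullet> emb \<Omega> (b u)"
    using L2_inner3_Re[OF au u] L2_inner3_Re[OF u bu] by simp
  have half: "(\<lambda>x. (1/2) *s (a u x + b u x)) = (\<lambda>x. (1/2::real) *\<^sub>R (a u x + b u x))"
    unfolding fun_eq_iff vec_eq_iff vector_smult_component vector_scaleR_component
      unfolding scaleR_conv_of_real by simp
  have "Re (L2_inner3 \<Omega> u (\<lambda>x. (1/2::real) *\<^sub>R (a u x + b u x))) = emb \<Omega> u \<bullet> emb \<Omega> (\<lambda>x. (1/2::real) *\<^sub>R (a u x + b u x))"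
    by (intro L2_inner3_Re u L2_space_scaleR[OF meas] L2_space_add[OF meas] au bu)
  also have "emb \<Omega> (\<lambda>x. (1/2::real) *\<^sub>R (a u x + b u x)) = (1/2) *\<^sub>R (emb \<Omega> (a u) + emb \<Omega> (b u))"
    using au bu by (simp add: emb_scaleR[OF meas] emb_add[OF meas] L2_space_add[OF meas])
  also have "emb \<Omega> u \<bullet> \<dots> = emb \<Omega> u \<bullet> emb \<Omega> (a u)"
    using ab by (simp add: inner_add_right inner_commute)
  finally show ?thesis using le unfolding half by (simp add: norm_emb[OF meas u])
qed

end

section \<open>The nonlinearity\<close>

definition superposition :: "(real^3) set \<Rightarrow> (complex^3 \<Rightarrow> complex) \<Rightarrow> (real^3, complex^3) L2 \<Rightarrow> (real^3, complex) L2" where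
  "superposition \<Omega> F E = emb \<Omega> (\<lambda>x. F (rep_L2 E x))"

context
  fixes \<Omega> :: "(real^3) set" and M :: real and F :: "complex^3 \<Rightarrow> complex"
  assumes lm: "\<Omega> \<in> lmeasurable" and F: "continuous_on UNIV F" "\<And>z. norm (F z) \<le> M"
begin

lemma superposition_bound_nonneg: "0 \<le> M"
  using F(2)[of 0] norm_ge_zero order_trans by blast

lemma superposition_L2_space:
  assumes "restr \<Omega> e \<in> borel_measurable lebesgue"
  shows "(\<lambda>x. F (e x)) \<in> L2_space \<Omega>"
proof -
  have m: "\<Omega> \<in> sets lebesgue" using lm by auto
  show ?thesis
    unfolding L2_space_iff[OF m]
  proof (rule square_integrable_bound[OF const_indicator_square_integrable[OF lm superposition_bound_nonneg]])
    have [measurable]: "F \<in> borel_measurable borel" by (rule borel_measurable_continuous_onI[OF F(1)])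
    note assms[measurable]
    \<comment> \<open>The field is cut off first to make it measurable on the whole space; since
      \<open>F 0\<close> may differ from 0, a second cut-off follows.\<close>
    have "(\<lambda>x. indicator \<Omega> x *\<^sub>R F (restr \<Omega> e x)) \<in> borel_measurable lebesgue" using m by measurable
    also have "(\<lambda>x. indicator \<Omega> x *\<^sub>R F (restr \<Omega> e x)) = restr \<Omega> (\<lambda>x. F (e x))" by (auto simp: restr_def)
    finally show "restr \<Omega> (\<lambda>x. F (e x)) \<in> borel_measurable lebesgue" .
    show "AE x in lebesgue. norm (restr \<Omega> (\<lambda>x. F (e x)) x) \<le> norm (M * indicator \<Omega> x :: real)"
      using F(2) superposition_bound_nonneg by (intro AE_I2) (auto simp: restr_def)
  qed
qed

lemma rep_superposition: "AE x in lebesgue. rep_L2 (superposition \<Omega> F E) x = restr \<Omega> (\<lambda>x. F (rep_L2 E x)) x"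
proof -
  have m: "\<Omega> \<in> sets lebesgue" using lm by auto
  show ?thesis
    unfolding superposition_def
    by (intro rep_emb m superposition_L2_space square_integrable_measurable restr_square_integrable rep_L2_square_integrable)
qed

lemma superposition_kernels: "superposition \<Omega> F E \<in> kernels \<Omega> M"
proof -
  have "AE x in lebesgue. norm (rep_L2 (superposition \<Omega> F E) x) \<le> M * indicator \<Omega> x"
    using rep_superposition[of E] by eventually_elim (use F(2) in \<open>auto simp: restr_def\<close>)
  then show ?thesis by (simp add: kernels_def)
qed

text \<open>Along a further subsequence the fields converge almost everywhere, so continuity of
  \<open>F\<close> and the majorant \<open>M\<close> on \<Omega> give norm convergence; the
  subsequence principle does the rest.\<close>

lemma superposition_continuous:
  assumes "E \<longlonglongrightarrow> E'"
  shows "(\<lambda>n. superposition \<Omega> F (E n)) \<longlonglongrightarrow> superposition \<Omega> F E'"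
proof (rule tendsto_if_subsequences_have_convergent_subsequences)
  fix r :: "nat \<Rightarrow> nat" assume r: "strict_mono r"
  have "(\<lambda>n. E (r n)) \<longlonglongrightarrow> E'" using LIMSEQ_subseq_LIMSEQ[OF assms r] by (simp add: comp_def)
  then obtain s where s: "strict_mono s" "AE x in lebesgue. (\<lambda>n. rep_L2 (E (r (s n))) x) \<longlonglongrightarrow> rep_L2 E' x"
    by (rule L2_convergent_AE_subsequence) blast
  have "(\<lambda>n. superposition \<Omega> F (E (r (s n)))) \<longlonglongrightarrow> superposition \<Omega> F E'"
  proof (rule L2_dominated_convergence[OF _ const_indicator_square_integrable[OF lm superposition_bound_nonneg]])
    have "AE x in lebesgue. \<forall>n. rep_L2 (superposition \<Omega> F (E (r (s n)))) x = restr \<Omega> (\<lambda>x. F (rep_L2 (E (r (s n))) x)) x"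
      unfolding AE_all_countable using rep_superposition by blast
    then show "AE x in lebesgue. (\<lambda>n. rep_L2 (superposition \<Omega> F (E (r (s n)))) x) \<longlonglongrightarrow> rep_L2 (superposition \<Omega> F E') x"
      using s(2) rep_superposition[of E']
    proof eventually_elim
      fix x assume *: "\<forall>n. rep_L2 (superposition \<Omega> F (E (r (s n)))) x = restr \<Omega> (\<lambda>x. F (rep_L2 (E (r (s n))) x)) x"
        "(\<lambda>n. rep_L2 (E (r (s n))) x) \<longlonglongrightarrow> rep_L2 E' x" "rep_L2 (superposition \<Omega> F E') x = restr \<Omega> (\<lambda>x. F (rep_L2 E' x)) x"
      have "(\<lambda>n. F (rep_L2 (E (r (s n))) x)) \<longlonglongrightarrow> F (rep_L2 E' x)"
        using continuous_on_tendsto_compose[OF F(1) *(2)] by simp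
      then show "(\<lambda>n. rep_L2 (superposition \<Omega> F (E (r (s n)))) x) \<longlonglongrightarrow> rep_L2 (superposition \<Omega> F E') x"
        using *(1,3) by (simp add: restr_def)
    qed
    fix n
    have "AE x in lebesgue. norm (rep_L2 (superposition \<Omega> F (E (r (s n)))) x) \<le> M * indicator \<Omega> x"
      using superposition_kernels[of "E (r (s n))"] by (simp add: kernels_def)
    then show "AE x in lebesgue. norm (rep_L2 (superposition \<Omega> F (E (r (s n)))) x) \<le> norm (M * indicator \<Omega> x :: real)"
      by eventually_elim (use superposition_bound_nonneg in simp)
  qed
  with s(1) show "\<exists>s. strict_mono s \<and> (\<lambda>n. superposition \<Omega> F (E (r (s n)))) \<longlonglongrightarrow> superposition \<Omega> F E'" by blast
qed

end

section \<open>The nonlinear problem\<close>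

text \<open>Here \<open>Eg\<close> stands for the class of a field with prescribed curl. The
  conclusion is the weak form of the divergence equation, with \<open>V\<close> as test function and
  \<open>Y\<close> as its gradient.\<close>

lemma frozen_kernel_fixed_point:
  fixes A :: "(real^3, complex^3) L2 \<Rightarrow> (real^3, complex^3) L2"
  assumes lm: "\<Omega> \<in> lmeasurable" and ball: "\<Omega> \<subseteq> cball 0 r" "0 \<le> r"
    and F: "continuous_on UNIV F" "\<And>z. norm (F z) \<le> M"
    and A: "bounded_linear A" "\<And>U Z. (U, Z) \<in> graph0 \<Omega> \<Longrightarrow> \<alpha> * (norm Z)\<^sup>2 \<le> Z \<bullet> A Z"
    and small: "M * measure lebesgue \<Omega> < \<alpha>"
  obtains U Z where "(U, Z) \<in> graph0 \<Omega>"
    "\<And>V Y. (V, Y) \<in> graph0 \<Omega> \<Longrightarrow>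
      Y \<bullet> (A (Eg + Z) + conv_op \<Omega> (superposition \<Omega> F (Eg + Z)) (Eg + Z)) = V \<bullet> f"
proof -
  have meas: "\<Omega> \<in> sets lebesgue" using lm by auto
  note M = superposition_bound_nonneg[OF lm F]
  let ?W = "graph0 \<Omega>" and ?K = "kernels \<Omega> M"
  \<comment> \<open>Only the gradient component enters the form: with 0 in the first place,
    \<open>v \<bullet> T \<Phi> w\<close> pairs gradients, while \<open>b\<close> pairs
    \<open>f\<close> with the function and moves the known field \<open>Eg\<close> to the right-hand
    side.\<close>
  define T where "T \<Phi> w = (0 :: (real^3, complex) L2, A (snd w) + conv_op \<Omega> \<Phi> (snd w))"
    for \<Phi> and w :: "(real^3, complex) L2 \<times> (real^3, complex^3) L2"
  define b where "b \<Phi> = (f, - (A Eg + conv_op \<Omega> \<Phi> Eg))" for \<Phi>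
  define \<delta> where "\<delta> = \<alpha> - M * measure lebesgue \<Omega>"
  \<comment> \<open>Poincare's inequality bounds the squared graph norm by
    \<open>4 * r\<^sup>2 + 1\<close> times that of the gradient, so coercivity \<delta> on gradients
    becomes \<open>c\<close> on pairs.\<close>
  define c where "c = \<delta> / (4 * r\<^sup>2 + 1)"
  have \<delta>: "0 < \<delta>" using small by (simp add: \<delta>_def)
  have r2: "0 < 4 * r\<^sup>2 + 1" by (simp add: add_nonneg_pos)
  have c: "0 < c" using \<delta> r2 by (simp add: c_def)
  have bl: "bounded_linear (T \<Phi>)" if "\<Phi> \<in> ?K" for \<Phi>
    unfolding T_def
    by (intro bounded_linear_Pair bounded_linear_zero bounded_linear_add
        bounded_linear_compose[OF A(1) bounded_linear_snd]
        bounded_linear_compose[OF bounded_linear_conv_op[OF lm M that] bounded_linear_snd])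
  have coercive: "c * (norm w)\<^sup>2 \<le> w \<bullet> T \<Phi> w" if "\<Phi> \<in> ?K" "w \<in> ?W" for \<Phi> w
  proof -
    obtain U Z where w: "w = (U, Z)" by (cases w)
    have "(norm U)\<^sup>2 \<le> (2 * r * norm Z)\<^sup>2"
      using graph0_poincare[OF meas _ ball, of U Z] that(2) by (intro power_mono) (auto simp: w)
    then have "(norm w)\<^sup>2 \<le> (4 * r\<^sup>2 + 1) * (norm Z)\<^sup>2"
      by (simp add: w norm_Pair power_mult_distrib algebra_simps)
    then have "c * (norm w)\<^sup>2 \<le> c * ((4 * r\<^sup>2 + 1) * (norm Z)\<^sup>2)" using c by (intro mult_left_mono) auto
    also have "\<dots> = \<delta> * (norm Z)\<^sup>2" using r2 by (simp add: c_def)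
    also have "\<dots> \<le> Z \<bullet> A Z + Z \<bullet> conv_op \<Omega> \<Phi> Z"
    proof -
      have "\<bar>Z \<bullet> conv_op \<Omega> \<Phi> Z\<bar> \<le> norm Z * (M * measure lebesgue \<Omega> * norm Z)"
        using Cauchy_Schwarz_ineq2[of Z "conv_op \<Omega> \<Phi> Z"] norm_conv_op_le[OF lm M that(1), of Z]
        by (meson mult_left_mono norm_ge_zero order_trans)
      also have "\<dots> = M * measure lebesgue \<Omega> * (norm Z)\<^sup>2" by (simp add: power2_eq_square)
      finally have "\<bar>Z \<bullet> conv_op \<Omega> \<Phi> Z\<bar> \<le> M * measure lebesgue \<Omega> * (norm Z)\<^sup>2" .
      moreover have "\<alpha> * (norm Z)\<^sup>2 \<le> Z \<bullet> A Z" using A(2) that(2) by (simp add: w)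
      moreover have "\<delta> * (norm Z)\<^sup>2 = \<alpha> * (norm Z)\<^sup>2 - M * measure lebesgue \<Omega> * (norm Z)\<^sup>2"
        by (simp add: \<delta>_def left_diff_distrib)
      ultimately show ?thesis by linarith
    qed
    also have "\<dots> = w \<bullet> T \<Phi> w" by (simp add: w T_def inner_Pair inner_add_right)
    finally show ?thesis .
  qed
  \<comment> \<open>The implication inside the existential allows the choice of a solution map
    \<open>S\<close> defined for all \<Phi>.\<close>
  have "\<exists>w. \<Phi> \<in> ?K \<longrightarrow> w \<in> ?W \<and> (\<forall>v\<in>?W. v \<bullet> T \<Phi> w = v \<bullet> b \<Phi>)" for \<Phi>
  proof (cases "\<Phi> \<in> ?K")
    case True
    show ?thesis
    proof (rule lax_milgram_subspace[OF subspace_graph0[OF meas] closed_graph0 bl[OF True] c coercive[OF True], of "b \<Phi>"])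
      fix w assume "w \<in> ?W" "\<And>v. v \<in> ?W \<Longrightarrow> v \<bullet> T \<Phi> w = v \<bullet> b \<Phi>"
      then show ?thesis by (intro exI[of _ w]) simp
    qed
  qed auto
  then obtain S where S: "\<And>\<Phi>. \<Phi> \<in> ?K \<Longrightarrow> S \<Phi> \<in> ?W" "\<And>\<Phi> v. \<Phi> \<in> ?K \<Longrightarrow> v \<in> ?W \<Longrightarrow> v \<bullet> T \<Phi> (S \<Phi>) = v \<bullet> b \<Phi>"
    by metis
  have S_cont: "(\<lambda>n. S (X n)) \<longlonglongrightarrow> S \<Phi>"
    if X: "\<And>n. X n \<in> ?K" "\<Phi> \<in> ?K" "\<And>y. (\<lambda>n. X n \<bullet> y) \<longlonglongrightarrow> \<Phi> \<bullet> y" for X \<Phi>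
  proof -
    have conv: "(\<lambda>n. conv_op \<Omega> (X n) H) \<longlonglongrightarrow> conv_op \<Omega> \<Phi> H" for H
      by (rule conv_op_weakly_continuous[OF lm M X])
    have "(\<lambda>n. b (X n)) \<longlonglongrightarrow> b \<Phi>" "(\<lambda>n. T (X n) (S \<Phi>)) \<longlonglongrightarrow> T \<Phi> (S \<Phi>)"
      unfolding b_def T_def by (intro tendsto_intros conv)+
    then have "(\<lambda>n. norm (b (X n) - b \<Phi>) + norm (T (X n) (S \<Phi>) - T \<Phi> (S \<Phi>))) \<longlonglongrightarrow> 0 + 0"
      by (intro tendsto_add tendsto_norm_zero) (simp_all add: LIM_zero_iff)
    then have "(\<lambda>n. (norm (b (X n) - b \<Phi>) + norm (T (X n) (S \<Phi>) - T \<Phi> (S \<Phi>))) / c) \<longlonglongrightarrow> 0"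
      using tendsto_divide_zero by auto
    moreover have "norm (S (X n) - S \<Phi>) \<le> (norm (b (X n) - b \<Phi>) + norm (T (X n) (S \<Phi>) - T \<Phi> (S \<Phi>))) / c" for n
    proof -
      \<comment> \<open>The operator with the moving kernel supplies coercivity, with the same
        \<open>c\<close> for all \<open>n\<close>; the operators are compared at the fixed
        \<open>S \<Phi>\<close>, where strong convergence applies.\<close>
      have "c * norm (S (X n) - S \<Phi>) \<le> norm (b (X n) - b \<Phi>) + norm (T (X n) (S \<Phi>) - T \<Phi> (S \<Phi>))"
        by (rule variational_solution_stable[where W="?W" and T="T \<Phi>" and T'="T (X n)"])
           (auto intro!: subspace_graph0[OF meas] bl coercive S X)
      then show ?thesis using c by (simp add: pos_le_divide_eq mult.commute)
    qed
    ultimately have "(\<lambda>n. S (X n) - S \<Phi>) \<longlonglongrightarrow> 0"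
      by (intro Lim_null_comparison[of "\<lambda>n. S (X n) - S \<Phi>"]) auto
    then show ?thesis by (simp add: LIM_zero_iff)
  qed
  \<comment> \<open>A fixed point is a kernel reproduced by the field that it generates.\<close>
  define G where "G \<Phi> = superposition \<Omega> F (Eg + snd (S \<Phi>))" for \<Phi>
  obtain \<Phi> where \<Phi>: "\<Phi> \<in> ?K" "G \<Phi> = \<Phi>"
  proof (rule weak_schauder[OF kernels_convex[OF lm M] kernels_closed[OF lm M] kernels_bounded[OF lm M] kernels_zero[OF lm M]])
    show "G \<Phi> \<in> ?K" for \<Phi> unfolding G_def by (rule superposition_kernels[OF lm F])
    show "(\<lambda>n. G (X n)) \<longlonglongrightarrow> G \<Phi>"
      if X: "\<And>n. X n \<in> ?K" "\<Phi> \<in> ?K" "\<And>y. (\<lambda>n. X n \<bullet> y) \<longlonglongrightarrow> \<Phi> \<bullet> y" for X \<Phi>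
      unfolding G_def by (intro superposition_continuous[OF lm F] tendsto_intros S_cont[OF X])
  qed
  obtain U Z where UZ: "S \<Phi> = (U, Z)" by (cases "S \<Phi>")
  have fix\<Phi>: "superposition \<Omega> F (Eg + Z) = \<Phi>" using \<Phi>(2) by (simp add: G_def UZ)
  show ?thesis
  proof (rule that)
    show "(U, Z) \<in> ?W" using S(1)[OF \<Phi>(1)] by (simp add: UZ)
    fix V Y assume "(V, Y) \<in> ?W"
    from S(2)[OF \<Phi>(1) this] have "Y \<bullet> (A Z + conv_op \<Omega> \<Phi> Z) = V \<bullet> f - Y \<bullet> (A Eg + conv_op \<Omega> \<Phi> Eg)"
      by (simp add: UZ T_def b_def inner_Pair inner_diff_right inner_add_right)
    then show "Y \<bullet> (A (Eg + Z) + conv_op \<Omega> (superposition \<Omega> F (Eg + Z)) (Eg + Z)) = V \<bullet> f"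
      unfolding fix\<Phi> bounded_linear.linear[OF A(1), THEN linear_add]
        bounded_linear.linear[OF bounded_linear_conv_op[OF lm M \<Phi>(1)], THEN linear_add]
      by (simp add: inner_add_right)
  qed
qed

text \<open>Passing to classes changes kernel and field only on null sets within \<Omega>, and a
  convolution does not see this at any point \<open>x\<close>.\<close>

lemma convolve_zero_extend:
  assumes lm: "\<Omega> \<in> lmeasurable" and F: "continuous_on UNIV F" "\<And>z. norm (F z) \<le> M"
    and E: "E \<in> L2_space \<Omega>"
  shows "convolve \<Omega> (zero_extend \<Omega> (\<lambda>z. F (E z))) E
    = convolve \<Omega> (rep_L2 (superposition \<Omega> F (emb \<Omega> E))) (rep_L2 (emb \<Omega> E))"
proof (rule ext, rule convolve_cong_AE)
  show meas: "\<Omega> \<in> sets lebesgue" using lm by auto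
  have eq: "zero_extend \<Omega> (\<lambda>z. F (E z)) = restr \<Omega> (\<lambda>z. F (E z))"
    by (auto simp: zero_extend_def restr_def)
  have mE: "restr \<Omega> E \<in> borel_measurable lebesgue"
    using E by (simp add: L2_space_iff[OF meas] square_integrable_measurable)
  then show "restr \<Omega> E \<in> borel_measurable lebesgue" .
  show "zero_extend \<Omega> (\<lambda>z. F (E z)) \<in> borel_measurable lebesgue"
    using superposition_L2_space[OF lm F mE] by (simp add: eq L2_space_iff[OF meas] square_integrable_measurable)
  show "rep_L2 (superposition \<Omega> F (emb \<Omega> E)) \<in> borel_measurable lebesgue"
    by (intro square_integrable_measurable rep_L2_square_integrable)
  show "restr \<Omega> (rep_L2 (emb \<Omega> E)) \<in> borel_measurable lebesgue"
    by (intro square_integrable_measurable restr_square_integrable meas rep_L2_square_integrable)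
  show "AE x in lebesgue. zero_extend \<Omega> (\<lambda>z. F (E z)) x = rep_L2 (superposition \<Omega> F (emb \<Omega> E)) x"
    using rep_superposition[OF lm F, of "emb \<Omega> E"] rep_emb[OF meas E]
    by eventually_elim (simp add: zero_extend_def restr_def)
  show "AE x in lebesgue. restr \<Omega> E x = restr \<Omega> (rep_L2 (emb \<Omega> E)) x"
    using rep_emb[OF meas E] by eventually_elim (simp add: restr_def)
qed

theorem theorem4p1:
  fixes \<Omega> :: "(real^3) set"
    and \<alpha> \<beta> :: real
    and a :: "(real^3 \<Rightarrow> complex^3) \<Rightarrow> real^3 \<Rightarrow> complex^3"
    and F :: "complex^3 \<Rightarrow> complex"
    and f :: "real^3 \<Rightarrow> complex"
    and g :: "real^3 \<Rightarrow> complex^3"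
  assumes "open \<Omega>" and "bounded \<Omega>" and "weak_Lipschitz \<Omega>" and "connected (- \<Omega>)"
    and "0 < \<alpha>" and "\<alpha> \<le> \<beta>"
    and "a \<in> material_laws \<Omega> \<alpha> \<beta>"
    and "continuous_on UNIV F" and "bounded (range F)"
    and "f \<in> L2_space \<Omega>"
    and "g \<in> Range (curl0 \<Omega>)"
    and "(SUP z. cmod (F z)) * measure lebesgue \<Omega> < \<alpha>"
  shows "\<exists>E\<in>L2_space \<Omega>.
           E \<in> Domain (curl0 \<Omega>) \<and> epsilon_law \<Omega> a F E \<in> Domain (div_op \<Omega>) \<and>
           (epsilon_law \<Omega> a F E, \<lambda>x. - f x) \<in> div_op \<Omega> \<and> (E, g) \<in> curl0 \<Omega>"
proof -
  have lm: "\<Omega> \<in> lmeasurable" using assms(1,2) by (simp add: lmeasurable_open)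
  have meas: "\<Omega> \<in> sets lebesgue" using lm by auto
  obtain r where "0 < r" "\<Omega> \<subseteq> cball 0 r"
    using assms(2) by (auto simp: bounded_pos subset_eq)
  then have ball: "\<Omega> \<subseteq> cball 0 r" "0 \<le> r" by auto
  define M where "M = (SUP z. cmod (F z))"
  obtain B where "\<And>z. cmod (F z) \<le> B" using assms(9) by (auto simp: bounded_iff)
  \<comment> \<open>A supremum of reals is an upper bound only for sets bounded above; this is where
    boundedness of \<open>F\<close> gives \<open>M\<close> its meaning.\<close>
  then have "bdd_above (range (\<lambda>z. cmod (F z)))" by (intro bdd_aboveI2)
  then have F: "continuous_on UNIV F" "\<And>z. norm (F z) \<le> M"
    unfolding M_def using assms(8) by (auto intro: cSUP_upper)
  have a: "L2_bounded_op \<Omega> a" "L2_Re_ge \<Omega> \<alpha> a"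
    using assms(7) by (auto simp: material_laws_def)
  define A where "A U = emb \<Omega> (a (rep_L2 U))" for U
  obtain e where e: "(e, g) \<in> curl0 \<Omega>" using assms(11) by blast
  have eL: "e \<in> L2_space \<Omega>" using e by (auto simp: curl0_def L2_closure_def)
  have A: "bounded_linear A" unfolding A_def[abs_def] by (rule bounded_linear_bounded_op[OF meas a(1)])
  \<comment> \<open>Coercivity of \<open>a\<close> concerns fields on \<Omega>; it transfers to
    \<open>Z\<close> because \<open>Z\<close> vanishes outside \<Omega>.\<close>
  have A_coercive: "\<alpha> * (norm Z)\<^sup>2 \<le> Z \<bullet> A Z" if "(U, Z) \<in> graph0 \<Omega>" for U Z
    using L2_Re_ge_coercive[OF meas a rep_L2_space[OF meas], of Z] graph0_supported[OF meas that] by (simp add: A_def)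
  obtain U Z where UZ: "(U, Z) \<in> graph0 \<Omega>" and sol: "\<And>V Y. (V, Y) \<in> graph0 \<Omega> \<Longrightarrow>
      Y \<bullet> (A (emb \<Omega> e + Z) + conv_op \<Omega> (superposition \<Omega> F (emb \<Omega> e + Z)) (emb \<Omega> e + Z)) = V \<bullet> emb \<Omega> f"
    by (rule frozen_kernel_fixed_point[OF lm ball F A A_coercive, where Eg = "emb \<Omega> e" and f = "emb \<Omega> f"])
       (use assms(12) in \<open>auto simp: M_def\<close>)
  define E where "E = (\<lambda>x. e x + rep_L2 Z x)"
  have EL: "E \<in> L2_space \<Omega>" unfolding E_def by (intro L2_space_add[OF meas] eL rep_L2_space[OF meas])
  have embE: "emb \<Omega> E = emb \<Omega> e + Z"
    using emb_add[OF meas eL rep_L2_space[OF meas], of Z] graph0_supported[OF meas UZ] by (simp add: E_def)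
  have curlE: "(E, g) \<in> curl0 \<Omega>" unfolding E_def by (rule curl0_add_graph0[OF meas e UZ])
  let ?D = "epsilon_law \<Omega> a F E"
  let ?\<Phi> = "superposition \<Omega> F (emb \<Omega> E)"
  have aE: "a E \<in> L2_space \<Omega>" using a(1) EL by (auto simp: L2_bounded_op_def)
  have D: "?D = (\<lambda>x. a E x + convolve \<Omega> (rep_L2 ?\<Phi>) (rep_L2 (emb \<Omega> E)) x)"
    unfolding epsilon_law_def[abs_def] convolve_zero_extend[OF lm F EL] ..
  have conv: "convolve \<Omega> (rep_L2 ?\<Phi>) (rep_L2 (emb \<Omega> E)) \<in> L2_space \<Omega>"
    by (rule convolve_L2_space[OF lm superposition_bound_nonneg[OF lm F] superposition_kernels[OF lm F]])
  have DL: "?D \<in> L2_space \<Omega>" unfolding D by (rule L2_space_add[OF meas aE conv])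
  have embD: "emb \<Omega> ?D = A (emb \<Omega> E) + conv_op \<Omega> ?\<Phi> (emb \<Omega> E)"
    unfolding D emb_add[OF meas aE conv] by (simp add: conv_op_def A_def emb_bounded_op[OF meas a(1) EL])
  have real: "Re (L2_inner3 \<Omega> z ?D) = Re (L2_inner \<Omega> u f)" if uz: "(u, z) \<in> grad0 \<Omega>" for u z
  proof -
    have L: "u \<in> L2_space \<Omega>" "z \<in> L2_space \<Omega>" using uz by (auto simp: grad0_def L2_closure_def)
    show ?thesis
      using sol[OF grad0_graph0[OF meas uz]] L assms(10) DL
      by (simp add: L2_inner3_Re[OF meas] L2_inner_Re[OF meas] embD embE)
  qed
  \<comment> \<open>The identity of real parts, used for \<open>(u, z)\<close> and for its multiple
    by \<open>\<i>\<close>, gives equality of complex numbers. The sign in \<open>div_op\<close>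
    cancels that of \<open>- f\<close>.\<close>
  have "L2_inner3 \<Omega> z ?D = - L2_inner \<Omega> u (\<lambda>x. - f x)" if uz: "(u, z) \<in> grad0 \<Omega>" for u z
  proof -
    have "L2_inner3 \<Omega> z ?D = L2_inner \<Omega> u f"
      using real[OF uz] real[OF grad0_mult_i[OF meas uz]]
      by (intro complex_eqI) (simp_all add: L2_inner_mult_i[OF meas] L2_inner3_mult_i[OF meas])
    then show ?thesis by (simp add: L2_inner_def)
  qed
  moreover have "(\<lambda>x. - f x) \<in> L2_space \<Omega>"
    by (intro L2_space_bounded_linear[OF meas bounded_linear_minus[OF bounded_linear_ident]] assms(10))
  ultimately have "(?D, \<lambda>x. - f x) \<in> div_op \<Omega>"
    using DL by (auto simp: div_op_def)
  with EL curlE show ?thesis by blast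
qed

end
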